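(* Let $(\vec{U},P)$ be a smooth solution of the steady-state Navier-Stokes equations on $\mathbb{R}^3$, $$-\Delta \vec{U} + (\vec{U}\cdot\vec{\nabla})\vec{U} + \vec{\nabla}P = 0, \qquad \operatorname{div}(\vec{U}) = 0 .$$ If $\vec{U}\in L^p(\mathbb{R}^3)$ with $\frac{3}{2}<p<3$, then $\vec{U}=0$ and $P=0$.
   Context: Here $\vec{U}=(U_1,U_2,U_3):\mathbb{R}^3\to\mathbb{R}^3$ is the velocity and $P:\mathbb{R}^3\to\mathbb{R}$ is the pressure. A couple $(\vec{U},P)$ is called a smooth solution if $\vec{U}\in\mathcal{C}^2(\mathbb{R}^3)$, $P\in\mathcal{C}^1(\mathbb{R}^3)$, and the couple satisfies the equations in the classical sense. The notation $\vec{U}\in L^p(\mathbb{R}^3)$ means that each component of $\vec{U}$ is in $L^p(\mathbb{R}^3)$.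
   Formalization: The conclusion P = 0 is replaced by "P is constant": without a normalisation of the pressure the claim P = 0 fails, since U = 0, P = 1 is a smooth solution with U in L^p. *)

theory Defs
  imports "HOL-Analysis.Analysis"
begin

definition partial_deriv :: "3 \<Rightarrow> (real^3 \<Rightarrow> real) \<Rightarrow> real^3 \<Rightarrow> real" where
  "partial_deriv i f x = frechet_derivative f (at x) (axis i 1)"

(* frechet_derivative is unspecified where f is not differentiable, so differentiability is
   demanded explicitly at every level. *)
primrec C_class :: "nat \<Rightarrow> (real^3 \<Rightarrow> real) \<Rightarrow> bool" where
  "C_class 0 f \<longleftrightarrow> continuous_on UNIV f"
| "C_class (Suc k) f \<longleftrightarrow>
     (\<forall>x. f differentiable (at x)) \<and> (\<forall>i. C_class k (partial_deriv i f))"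

definition gradient :: "(real^3 \<Rightarrow> real) \<Rightarrow> real^3 \<Rightarrow> real^3" where
  "gradient f x = (\<chi> i. partial_deriv i f x)"

definition divergence :: "(real^3 \<Rightarrow> real^3) \<Rightarrow> real^3 \<Rightarrow> real" where
  "divergence U x = (\<Sum>i\<in>UNIV. partial_deriv i (\<lambda>y. U y $ i) x)"

definition laplacian :: "(real^3 \<Rightarrow> real^3) \<Rightarrow> real^3 \<Rightarrow> real^3" where
  "laplacian U x =
     (\<chi> i. \<Sum>j\<in>UNIV. partial_deriv j (partial_deriv j (\<lambda>y. U y $ i)) x)"

(* (U . nabla) V *)
definition advection :: "(real^3 \<Rightarrow> real^3) \<Rightarrow> (real^3 \<Rightarrow> real^3) \<Rightarrow> real^3 \<Rightarrow> real^3" where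
  "advection U V x = (\<chi> i. \<Sum>j\<in>UNIV. U x $ j * partial_deriv j (\<lambda>y. V y $ i) x)"

definition smooth_steady_NS_solution :: "(real^3 \<Rightarrow> real^3) \<Rightarrow> (real^3 \<Rightarrow> real) \<Rightarrow> bool" where
  "smooth_steady_NS_solution U P \<longleftrightarrow>
     (\<forall>i. C_class 2 (\<lambda>x. U x $ i)) \<and>
     C_class 1 P \<and>
     (\<forall>x. - laplacian U x + advection U U x + gradient P x = 0) \<and>
     (\<forall>x. divergence U x = 0)"

definition in_Lp :: "real \<Rightarrow> (real^3 \<Rightarrow> real) \<Rightarrow> bool" where
  "in_Lp p f \<longleftrightarrow>
     f \<in> borel_measurable lebesgue \<and> integrable lebesgue (\<lambda>x. \<bar>f x\<bar> powr p)"

end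

(* For U in L^p with p < 3 the rescaled solutions R U(R x), R >= 1, are uniformly bounded in L^q
   on a fixed cube, q = min p 2. On the unit scale this bounds the energy: testing with U times a
   cutoff leaves cubic terms, which interpolation between L^q and L^6 (Sobolev) bounds by a power
   of the energy that is less than 1 because q > 3/2; iterating over nested cubes absorbs them.
   Scaling back, the energy of U in a cube of size R is at most B / R, so U is constant, hence 0.

   The pressure is avoided by testing with divergence-free fields only. The cut-off velocity f is
   corrected to the divergence of an antisymmetric matrix built from D_i f, where D_i stands for
   d_i (-Laplace)^{-1} up to sign and smoothing. No singular kernel is needed: D_i f is the
   average of z_i m(z) f(x - t z) over 0 <= t <= 1 and z in a cube, m being a radial bump. The
   fundamental theorem of calculus in t gives sum_i D_i (d_i f) = c f - m * f, and since z_i m(z)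
   is a gradient, integration by parts in z gives d_l D_i f = d_i D_l f. *)
theory Submission
  imports Defs
begin

text \<open>The pressure comes with no integrability whatsoever, which is why it has to disappear
  before anything is estimated. The exponents come from one count: interpolating the second and
  fourth moments between L^q and L^6 gives powers whose half-sum is 3 (3 - q) / (6 - q), and for q <
  6 this is below 1 exactly when q > 3/2. The second moment can be interpolated in this way if q
  \<le> 2, hence q = min p 2. The bound p < 3 enters through scaling: the rescaled L^p integral
  carries the factor R^(p - 3). The iteration starts from a quantity known to be finite by
  smoothness; its size drops out in the limit. Cutting off v spoils div v = 0 in the layer where the
  cutoff varies. The test field is therefore localised at a positive distance from that layer, where
  the error it causes is smooth, at the price of a negative power of the distance. The pressure
  enters the equations through its gradient alone, so the conclusion about it is that P is
  constant.\<close>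

notation partial_deriv ("\<D>")

section \<open>Partial derivatives and smoothness\<close>

lemma partial_derivI:
  assumes "(f has_derivative f') (at x)"
  shows "\<D> i f x = f' (axis i 1)"
  unfolding partial_deriv_def using frechet_derivative_at[OF assms] by simp

text \<open>Linearity of the Frechet derivative, applied to the expansion of \<open>h\<close> in the
  standard basis.\<close>

lemma has_derivative_partial_deriv:
  assumes "f differentiable (at x)"
  shows "(f has_derivative (\<lambda>h. \<Sum>i\<in>UNIV. h $ i * \<D> i f x)) (at x)"
proof -
  have d: "(f has_derivative frechet_derivative f (at x)) (at x)"
    using assms frechet_derivative_works by blast
  interpret linear "frechet_derivative f (at x)"
    using d has_derivative_linear by blast
  have "frechet_derivative f (at x) h = (\<Sum>i\<in>UNIV. h $ i * \<D> i f x)" for h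
  proof -
    have "frechet_derivative f (at x) (\<Sum>i\<in>UNIV. h $ i *\<^sub>R axis i 1)
        = (\<Sum>i\<in>UNIV. h $ i * \<D> i f x)"
      unfolding sum scale partial_deriv_def by simp
    then show ?thesis using basis_expansion[of h] by (simp add: scalar_mult_eq_scaleR)
  qed
  then have "frechet_derivative f (at x) = (\<lambda>h. \<Sum>i\<in>UNIV. h $ i * \<D> i f x)"
    by blast
  then show ?thesis using d by metis
qed

lemma C_class_partial_deriv: "C_class (Suc k) f \<Longrightarrow> C_class k (\<D> i f)"
  by simp

lemma C_class_continuous: "C_class k f \<Longrightarrow> continuous_on A f"
proof (cases k)
  case (Suc l)
  assume "C_class k f"
  then show ?thesis unfolding Suc
    by (intro continuous_at_imp_continuous_on ballI differentiable_imp_continuous_within) simp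
qed (auto intro: continuous_on_subset)

lemma C_class_Suc: "C_class (Suc k) f \<Longrightarrow> C_class k f"
proof (induction k arbitrary: f)
  case 0
  then show ?case using C_class_continuous[OF 0] by simp
qed simp

lemma C_class_mono: "C_class n f \<Longrightarrow> m \<le> n \<Longrightarrow> C_class m f"
  by (induction n) (use C_class_Suc le_Suc_eq in blast)+

lemma partial_deriv_const [simp]: "\<D> i (\<lambda>x. c) = (\<lambda>x. 0)"
  by (rule ext, rule partial_derivI[where f'="\<lambda>h. 0", THEN trans]) auto

lemma C_class_const [simp]: "C_class k (\<lambda>x. c)"
  by (induction k arbitrary: c) auto

lemma partial_deriv_add:
  assumes "f differentiable (at x)" "g differentiable (at x)"
  shows "\<D> i (\<lambda>x. f x + g x) x = \<D> i f x + \<D> i g x"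
  using partial_derivI[OF has_derivative_add[OF assms[unfolded frechet_derivative_works]]]
  by (simp add: partial_deriv_def)

lemma partial_deriv_diff:
  assumes "f differentiable (at x)" "g differentiable (at x)"
  shows "\<D> i (\<lambda>x. f x - g x) x = \<D> i f x - \<D> i g x"
  using partial_derivI[OF has_derivative_diff[OF assms[unfolded frechet_derivative_works]]]
  by (simp add: partial_deriv_def)

lemma partial_deriv_mult:
  assumes "f differentiable (at x)" "g differentiable (at x)"
  shows "\<D> i (\<lambda>x. f x * g x) x = \<D> i f x * g x + f x * \<D> i g x"
  using partial_derivI[OF has_derivative_mult[OF assms[unfolded frechet_derivative_works]]]
  by (simp add: partial_deriv_def)

lemma partial_deriv_sum:
  assumes "\<And>j. j \<in> A \<Longrightarrow> (f j) differentiable (at x)"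
  shows "\<D> i (\<lambda>x. \<Sum>j\<in>A. f j x) x = (\<Sum>j\<in>A. \<D> i (f j) x)"
  using partial_derivI[OF has_derivative_sum[of A f "\<lambda>j. frechet_derivative (f j) (at x)" "at x"]] assms
  by (simp add: partial_deriv_def frechet_derivative_works)

lemma C_class_add:
  "C_class k f \<Longrightarrow> C_class k g \<Longrightarrow> C_class k (\<lambda>x. f x + g x)"
proof (induction k arbitrary: f g)
  case (Suc k)
  have "\<D> i (\<lambda>x. f x + g x) = (\<lambda>x. \<D> i f x + \<D> i g x)" for i
    by (rule ext, rule partial_deriv_add) (use Suc.prems in auto)
  with Suc show ?case by auto
qed (auto intro: continuous_intros)

lemma C_class_mult:
  "C_class k f \<Longrightarrow> C_class k g \<Longrightarrow> C_class k (\<lambda>x. f x * g x)"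
proof (induction k arbitrary: f g)
  case (Suc k)
  have "\<D> i (\<lambda>x. f x * g x) =
      (\<lambda>x. \<D> i f x * g x + f x * \<D> i g x)" for i
    by (rule ext, rule partial_deriv_mult) (use Suc.prems in auto)
  moreover have "C_class k (\<lambda>x. \<D> i f x * g x + f x * \<D> i g x)" for i
    using Suc.prems C_class_Suc by (intro C_class_add Suc.IH) auto
  ultimately show ?case using Suc.prems by auto
qed (auto intro: continuous_intros)

lemma C_class_cmult: "C_class k f \<Longrightarrow> C_class k (\<lambda>x. c * f x)"
  by (rule C_class_mult) auto

lemma C_class_diff:
  "C_class k f \<Longrightarrow> C_class k g \<Longrightarrow> C_class k (\<lambda>x. f x - g x)"
  using C_class_add[of k f "\<lambda>x. (-1) * g x"] C_class_cmult[of k g "-1"] by simp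

lemma C_class_sum:
  "finite A \<Longrightarrow> (\<And>j. j \<in> A \<Longrightarrow> C_class k (f j)) \<Longrightarrow> C_class k (\<lambda>x. \<Sum>j\<in>A. f j x)"
  by (induction A rule: finite_induct) (auto intro: C_class_add)

lemma partial_deriv_cmult:
  assumes "f differentiable (at x)"
  shows "\<D> i (\<lambda>x. c * f x) x = c * \<D> i f x"
  using partial_deriv_mult[of "\<lambda>x. c" x f i] assms by simp

lemma differentiable_affine_comp:
  assumes "f differentiable (at (a + c *\<^sub>R x))"
  shows "((\<lambda>x::real^3. f (a + c *\<^sub>R x)) has_derivative
     (\<lambda>h. frechet_derivative f (at (a + c *\<^sub>R x)) (c *\<^sub>R h))) (at x)"
proof -
  have "((\<lambda>x::real^3. a + c *\<^sub>R x) has_derivative (\<lambda>h. c *\<^sub>R h)) (at x)"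
    by (auto intro!: derivative_eq_intros)
  from has_derivative_compose[OF this] show ?thesis
    using assms frechet_derivative_works by blast
qed

lemma partial_deriv_affine:
  assumes "f differentiable (at (a + c *\<^sub>R x))"
  shows "\<D> i (\<lambda>x. f (a + c *\<^sub>R x)) x = c * \<D> i f (a + c *\<^sub>R x)"
proof -
  have "linear (frechet_derivative f (at (a + c *\<^sub>R x)))"
    using assms by (rule linear_frechet_derivative)
  then show ?thesis
    using partial_derivI[OF differentiable_affine_comp[OF assms], of i]
    by (simp add: partial_deriv_def linear_cmul)
qed

lemma C_class_affine: "C_class k f \<Longrightarrow> C_class k (\<lambda>x. f (a + c *\<^sub>R x))"
proof (induction k arbitrary: f)
  case 0
  have "continuous_on UNIV f"
    using 0 by simp
  then have "continuous_on UNIV (\<lambda>x. f (a + c *\<^sub>R x))"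
    by (rule continuous_on_compose2) (auto intro!: continuous_intros)
  then show ?case by simp
next
  case (Suc k)
  have "\<D> i (\<lambda>x. f (a + c *\<^sub>R x)) = (\<lambda>x. c * \<D> i f (a + c *\<^sub>R x))" for i
    by (rule ext, rule partial_deriv_affine) (use Suc.prems in auto)
  moreover have "(\<lambda>x. f (a + c *\<^sub>R x)) differentiable (at x)" for x
    using differentiable_affine_comp[of f a c x] Suc.prems by (auto simp: differentiable_def)
  ultimately show ?case using Suc by (auto intro: C_class_cmult)
qed

text \<open>Cutoffs are built from functions of one coordinate. The one-variable derivatives are
  passed explicitly, so that pointwise bounds on them become bounds on the partial
  derivatives.\<close>

lemma C_class_coord:
  fixes c c1 c2 :: "real \<Rightarrow> real"
  assumes c: "\<And>s. (c has_field_derivative c1 s) (at s)"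
    and c1: "\<And>s. (c1 has_field_derivative c2 s) (at s)"
    and c2: "continuous_on UNIV c2"
  shows "C_class 2 (\<lambda>x. c (x $ i))"
    and "\<D> j (\<lambda>x. c (x $ i)) x = (if j = i then c1 (x $ i) else 0)"
    and "\<D> j (\<lambda>x. c1 (x $ i)) x = (if j = i then c2 (x $ i) else 0)"
proof -
  have *: "((\<lambda>x::real^3. g (x $ i)) has_derivative (\<lambda>h. g1 (x $ i) * h $ i)) (at x)"
    if "\<And>s. (g has_field_derivative g1 s) (at s)" for g g1 :: "real \<Rightarrow> real" and x
  proof -
    have "((\<lambda>x::real^3. x $ i) has_derivative (\<lambda>h. h $ i)) (at x)"
      by (rule bounded_linear_imp_has_derivative[OF bounded_linear_vec_nth])
    from has_derivative_compose[OF this, of g] that show ?thesis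
      unfolding has_field_derivative_def by (simp add: o_def)
  qed
  have pd: "\<D> j (\<lambda>x. g (x $ i)) = (\<lambda>x. if j = i then g1 (x $ i) else 0)"
    if "\<And>s. (g has_field_derivative g1 s) (at s)" for g g1 :: "real \<Rightarrow> real" and j
    using partial_derivI[OF *[OF that]] by (auto simp: axis_def fun_eq_iff)
  have df: "(\<lambda>x::real^3. g (x $ i)) differentiable (at x)"
    if "\<And>s. (g has_field_derivative g1 s) (at s)" for g g1 :: "real \<Rightarrow> real" and x
    using *[OF that] by (auto simp: differentiable_def)
  have cont: "continuous_on UNIV (\<lambda>x::real^3. c2 (x $ i))"
    by (intro continuous_on_compose2[OF c2]) (auto intro!: continuous_intros)
  have "continuous_on UNIV (\<lambda>x::real^3. if j = i then c2 (x $ i) else 0)" for j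
    using cont by (cases "j = i") auto
  then have "C_class 1 (\<lambda>x. c1 (x $ i))"
    using df[OF c1] by (auto simp: pd[OF c1])
  then have "C_class 1 (\<lambda>x. if j = i then c1 (x $ i) else 0)" for j
    by (cases "j = i") auto
  then show "C_class 2 (\<lambda>x. c (x $ i))"
    using df[OF c] by (simp add: numeral_2_eq_2 pd[OF c])
  show "\<D> j (\<lambda>x. c (x $ i)) x = (if j = i then c1 (x $ i) else 0)"
    and "\<D> j (\<lambda>x. c1 (x $ i)) x = (if j = i then c2 (x $ i) else 0)"
    by (simp_all add: pd[OF c] pd[OF c1])
qed

lemma has_derivative_line:
  assumes "f differentiable (at (x + s *\<^sub>R v))"
  shows "((\<lambda>s. f (x + s *\<^sub>R v)) has_real_derivative
     (\<Sum>i\<in>UNIV. v $ i * \<D> i f (x + s *\<^sub>R v))) (at s)"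
proof -
  have "((\<lambda>s. x + s *\<^sub>R v) has_derivative (\<lambda>h. h *\<^sub>R v)) (at s)"
    by (auto intro!: derivative_eq_intros)
  from has_derivative_compose[OF this has_derivative_partial_deriv[OF assms]]
  moreover have "(\<lambda>t. \<Sum>i\<in>UNIV. (t *\<^sub>R v) $ i * \<D> i f (x + s *\<^sub>R v))
      = (*) (\<Sum>i\<in>UNIV. v $ i * \<D> i f (x + s *\<^sub>R v))"
    by (simp add: fun_eq_iff sum_distrib_left mult_ac)
  ultimately show ?thesis unfolding has_field_derivative_def by simp
qed

text \<open>With \<open>S\<close> the open complement of a cube, this passes vanishing outside the
  cube on to derivatives; with \<open>S\<close> an open cube on which a cutoff is 1, it removes the
  gradient of the cutoff there.\<close>

lemma partial_deriv_eq_0: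
  assumes "open S" "x \<in> S" "\<And>y. y \<in> S \<Longrightarrow> f y = c"
  shows "\<D> i f x = 0"
proof -
  have "(f has_derivative (\<lambda>h. 0)) (at x)"
    by (rule has_derivative_transform_within_open[of "\<lambda>x. c" _ x UNIV S])
      (use assms in auto)
  then show ?thesis by (simp add: partial_derivI)
qed

section \<open>Compactly supported functions and integration by parts\<close>

text \<open>The closed ball of radius \<open>r\<close> in the maximum norm, empty for negative
  \<open>r\<close>.\<close>

definition cube :: "real \<Rightarrow> (real^3) set" where
  "cube r = cbox (\<chi> i. - r) (\<chi> i. r)"

definition cont_supp :: "(real^3 \<Rightarrow> real) \<Rightarrow> bool" where
  "cont_supp f \<longleftrightarrow> continuous_on UNIV f \<and> (\<exists>r. \<forall>x. x \<notin> cube r \<longrightarrow> f x = 0)"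

lemma mem_cube: "x \<in> cube r \<longleftrightarrow> (\<forall>i. \<bar>x $ i\<bar> \<le> r)"
  by (auto simp: cube_def mem_box_cart abs_le_iff minus_le_iff)

lemma cube_mono: "r \<le> s \<Longrightarrow> cube r \<subseteq> cube s"
  unfolding subset_iff mem_cube by (meson order_trans)

lemma cont_suppI:
  "continuous_on UNIV f \<Longrightarrow> (\<And>x. x \<notin> cube r \<Longrightarrow> f x = 0) \<Longrightarrow> cont_supp f"
  by (auto simp: cont_supp_def)

lemma cont_supp_cont: "cont_supp f \<Longrightarrow> continuous_on A f"
  by (auto simp: cont_supp_def intro: continuous_on_subset)

lemma cont_supp_multL: "continuous_on UNIV g \<Longrightarrow> cont_supp f \<Longrightarrow> cont_supp (\<lambda>x. g x * f x)"
  unfolding cont_supp_def by (auto intro!: continuous_intros)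

lemma cont_supp_multR: "cont_supp f \<Longrightarrow> continuous_on UNIV g \<Longrightarrow> cont_supp (\<lambda>x. f x * g x)"
  unfolding cont_supp_def by (auto intro!: continuous_intros)

lemma cont_supp_cmult: "cont_supp f \<Longrightarrow> cont_supp (\<lambda>x. c * f x)"
  by (rule cont_supp_multL) auto

lemma cont_supp_add: 
  assumes "cont_supp f" "cont_supp g" shows "cont_supp (\<lambda>x. f x + g x)"
proof -
  obtain r s where r: "\<And>x. x \<notin> cube r \<Longrightarrow> f x = 0" and s: "\<And>x. x \<notin> cube s \<Longrightarrow> g x = 0"
    using assms unfolding cont_supp_def by blast
  show ?thesis
  proof (rule cont_suppI[where r="max r s"])
    show "continuous_on UNIV (\<lambda>x. f x + g x)"
      using assms by (auto intro!: continuous_intros simp: cont_supp_cont)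
    show "f x + g x = 0" if "x \<notin> cube (max r s)" for x
      using that r[of x] s[of x] cube_mono[of r "max r s"] cube_mono[of s "max r s"]
      by (metis add_0 max.cobounded1 max.cobounded2 subsetD)
  qed
qed

lemma cont_supp_diff: "cont_supp f \<Longrightarrow> cont_supp g \<Longrightarrow> cont_supp (\<lambda>x. f x - g x)"
  using cont_supp_add[of f "\<lambda>x. (-1) * g x"] cont_supp_cmult[of g "-1"] by simp

lemma cont_supp_0: "cont_supp (\<lambda>x. 0)"
  by (auto simp: cont_supp_def)

lemma cont_supp_sum:
  "finite A \<Longrightarrow> (\<And>j. j \<in> A \<Longrightarrow> cont_supp (f j)) \<Longrightarrow> cont_supp (\<lambda>x. \<Sum>j\<in>A. f j x)"
  by (induction A rule: finite_induct) (auto intro: cont_supp_add cont_supp_0)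

lemma cont_supp_power2: "cont_supp f \<Longrightarrow> cont_supp (\<lambda>x. (f x)\<^sup>2)"
  unfolding power2_eq_square by (rule cont_supp_multL) (auto simp: cont_supp_cont)

lemma cont_supp_has_integral:
  fixes f :: "real^3 \<Rightarrow> real"
  assumes "continuous_on UNIV f" "\<And>x. x \<notin> cube r \<Longrightarrow> f x = 0"
  shows "(f has_integral integral (cube r) f) UNIV"
proof -
  have "f integrable_on cube r"
    unfolding cube_def
    by (rule integrable_continuous) (rule continuous_on_subset[OF assms(1)], simp)
  then have "(f has_integral integral (cube r) f) (cube r)"
    by (rule integrable_integral)
  then show ?thesis
    by (rule has_integral_on_superset) (use assms(2) in auto)
qed

lemma integral_UNIV_cube:
  fixes f :: "real^3 \<Rightarrow> real"
  assumes "continuous_on UNIV f" "\<And>x. x \<notin> cube r \<Longrightarrow> f x = 0"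
  shows "integral UNIV f = integral (cube r) f"
  using cont_supp_has_integral[OF assms] by blast

lemma cont_supp_integrable: "cont_supp f \<Longrightarrow> f integrable_on UNIV"
  unfolding cont_supp_def using cont_supp_has_integral by blast

lemma integrable_on_cube: "continuous_on UNIV f \<Longrightarrow> f integrable_on cube r" for f :: "_ \<Rightarrow> real"
  unfolding cube_def by (rule integrable_continuous[OF continuous_on_subset]) auto

section \<open>Translation invariance, integration by parts, symmetry of second derivatives\<close>

lemma integral_translate:
  assumes "cont_supp f" shows "integral UNIV (\<lambda>x. f (x + c)) = integral UNIV f"
proof -
  obtain r where r: "\<And>x. x \<notin> cube r \<Longrightarrow> f x = 0" using assms unfolding cont_supp_def by blast
  let ?a = "(\<chi> i. - r) :: real^3" and ?b = "(\<chi> i. r) :: real^3"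
  have cf: "continuous_on UNIV f" using assms by (rule cont_supp_cont)
  have "(f has_integral integral (cube r) f) (cbox ?a ?b)"
    using integrable_on_cube[OF cf, of r] unfolding cube_def by (rule integrable_integral)
  then have "((\<lambda>x. f (x + c)) has_integral integral (cube r) f) (cbox (?a - c) (?b - c))"
    using has_integral_shift_cbox_iff[of f c "integral (cube r) f" "?a - c" "?b - c"]
    by (simp add: o_def add.commute)
  then have "((\<lambda>x. f (x + c)) has_integral integral (cube r) f) UNIV"
  proof (rule has_integral_on_superset)
    fix x assume "x \<notin> cbox (?a - c) (?b - c)"
    then have "x + c \<notin> cube r" by (auto simp: cube_def mem_box_cart algebra_simps)
    then show "f (x + c) = 0" by (rule r)
  qed auto
  then show ?thesis using integral_UNIV_cube[OF cf r] by (metis integral_unique)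
qed

lemma cont_supp_partial_deriv:
  assumes "C_class 1 f" "cont_supp f" shows "cont_supp (\<D> i f)"
proof -
  obtain r where r: "\<And>x. x \<notin> cube r \<Longrightarrow> f x = 0" using assms unfolding cont_supp_def by blast
  show ?thesis
  proof (rule cont_suppI[where r=r])
    show "continuous_on UNIV (\<D> i f)" using assms by simp
    show "\<D> i f x = 0" if "x \<notin> cube r" for x
      by (rule partial_deriv_eq_0[where S="- cube r" and c=0])
        (use that r in \<open>auto simp: cube_def open_Compl\<close>)
  qed
qed

text \<open>The integral of \<open>f (x + t e)\<close>, with \<open>e\<close> the i-th unit vector,
  is independent of \<open>t\<close>, and its derivative at \<open>t = 0\<close>, taken under the
  integral sign, is the integral of the partial derivative. The cube is enlarged by 1 to hold the
  supports of all translates with |t| < 1, so that one fixed box serves for the Leibniz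
  rule.\<close>

lemma integral_partial_deriv_0:
  assumes "C_class 1 f" "cont_supp f" shows "integral UNIV (\<D> i f) = 0"
proof -
  obtain r where r: "\<And>x. x \<notin> cube r \<Longrightarrow> f x = 0" using assms unfolding cont_supp_def by blast
  have cf: "continuous_on UNIV f" and cd: "continuous_on UNIV (\<D> i f)"
    using assms by (auto intro: cont_supp_cont)
  let ?e = "axis i 1 :: real^3"
  have sum_e: "(\<Sum>j\<in>UNIV. ?e $ j * g j) = g i" for g :: "3 \<Rightarrow> real"
    by (simp add: axis_def if_distrib[of "\<lambda>x. x * _"] cong: if_cong)
  have out: "f (x + t *\<^sub>R ?e) = 0" if "x \<notin> cube (r + 1)" "t \<in> {-1<..<1}" for x t
  proof (rule r, rule notI)
    assume "x + t *\<^sub>R ?e \<in> cube r"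
    then have "\<bar>x $ j + t * ?e $ j\<bar> \<le> r" for j by (auto simp: mem_cube)
    moreover have "\<bar>t * ?e $ j\<bar> \<le> 1" for j using that(2) by (auto simp: axis_def)
    ultimately have "\<bar>x $ j\<bar> \<le> r + 1" for j
      using abs_triangle_ineq4[of "x $ j + t * ?e $ j" "t * ?e $ j"]
      by (metis (no_types, lifting) add_diff_cancel_right' add_mono order_trans)
    then show False using that(1) by (auto simp: mem_cube)
  qed
  have const: "integral (cube (r + 1)) (\<lambda>x. f (x + t *\<^sub>R ?e)) = integral UNIV f"
    if "t \<in> {-1<..<1}" for t
  proof -
    have "continuous_on UNIV (\<lambda>x. f (x + t *\<^sub>R ?e))"
      by (rule continuous_on_compose2[OF cf]) (auto intro!: continuous_intros)
    from integral_UNIV_cube[OF this out] that integral_translate[OF assms(2)] show ?thesis by metis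
  qed
  have "((\<lambda>t. integral (cbox (\<chi> i. - (r+1)) (\<chi> i. r+1)) (\<lambda>x. f (x + t *\<^sub>R ?e))) has_field_derivative
     integral (cbox (\<chi> i. - (r+1)) (\<chi> i. r+1)) (\<lambda>x. \<D> i f (x + 0 *\<^sub>R ?e)))
     (at 0 within {-1<..<1})"
  proof (rule leibniz_rule_field_derivative)
    fix t :: real and x :: "real^3"
    have "f differentiable (at (x + t *\<^sub>R ?e))" using assms(1) by simp
    from has_derivative_line[OF this]
    show "((\<lambda>t. f (x + t *\<^sub>R ?e)) has_field_derivative \<D> i f (x + t *\<^sub>R ?e))
      (at t within {-1<..<1})"
      unfolding sum_e by (rule has_field_derivative_at_within)
  next
    fix t :: real
    have "continuous_on UNIV (\<lambda>x. f (x + t *\<^sub>R ?e))"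
      by (rule continuous_on_compose2[OF cf]) (auto intro!: continuous_intros)
    then show "(\<lambda>x. f (x + t *\<^sub>R ?e)) integrable_on cbox (\<chi> i. - (r+1)) (\<chi> i. r+1)"
      using integrable_on_cube unfolding cube_def by blast
  next
    show "continuous_on ({-1<..<1} \<times> cbox (\<chi> i. - (r+1)) (\<chi> i. r+1))
      (\<lambda>(t, x). \<D> i f (x + t *\<^sub>R ?e))"
      unfolding split_beta
      by (rule continuous_on_compose2[OF cd]) (auto intro!: continuous_intros)
  qed auto
  then have "((\<lambda>t. integral (cube (r+1)) (\<lambda>x. f (x + t *\<^sub>R ?e))) has_field_derivative
     integral (cube (r+1)) (\<D> i f)) (at 0)"
    by (simp add: at_within_open[of _ "{-1<..<1}"] cube_def)
  moreover have "((\<lambda>t. integral (cube (r+1)) (\<lambda>x. f (x + t *\<^sub>R ?e))) has_field_derivative 0) (at 0)"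
    by (rule has_field_derivative_transform_within_open[of "\<lambda>t. integral UNIV f" _ _ "{-1<..<1}"])
      (auto simp: const)
  ultimately have *: "integral (cube (r+1)) (\<D> i f) = 0"
    by (rule DERIV_unique)
  have "\<D> i f x = 0" if "x \<notin> cube (r + 1)" for x
    by (rule partial_deriv_eq_0[where S="- cube r" and c=0])
        (use that r cube_mono[of r "r+1"] in \<open>auto simp: cube_def open_Compl\<close>)
  from integral_UNIV_cube[OF cd this] * show ?thesis by metis
qed

lemma integration_by_parts:
  assumes "C_class 1 f" "C_class 1 g" "cont_supp f"
  shows "integral UNIV (\<lambda>x. f x * \<D> i g x) = - integral UNIV (\<lambda>x. \<D> i f x * g x)"
proof -
  have "cont_supp (\<lambda>x. f x * g x)"
    using assms(3) C_class_continuous[OF assms(2)] by (rule cont_supp_multR)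
  then have "integral UNIV (\<D> i (\<lambda>x. f x * g x)) = 0"
    using assms by (intro integral_partial_deriv_0 C_class_mult)
  moreover have "\<D> i (\<lambda>x. f x * g x) = (\<lambda>x. \<D> i f x * g x + f x * \<D> i g x)"
    by (rule ext, rule partial_deriv_mult) (use assms in auto)
  moreover have "cont_supp (\<lambda>x. \<D> i f x * g x)" "cont_supp (\<lambda>x. f x * \<D> i g x)"
    using assms C_class_continuous[OF assms(2)] by (auto intro!: cont_supp_multR cont_supp_partial_deriv)
  ultimately show ?thesis
    using integral_add[of "\<lambda>x. \<D> i f x * g x" UNIV "\<lambda>x. f x * \<D> i g x"]
    by (auto dest!: cont_supp_integrable)
qed

text \<open>Differentiating the fundamental theorem of calculus along direction \<open>i\<close> in
  direction \<open>j\<close> shows that the increment of \<open>\<D> j f\<close> along a segment in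
  direction \<open>i\<close> is the integral of \<open>\<D> j (\<D> i f)\<close>. The derivative in
  the length of the segment at 0 is the claim.\<close>

lemma partial_deriv_commute:
  assumes "C_class 2 f" shows "\<D> i (\<D> j f) x = \<D> j (\<D> i f) x"
proof -
  have 1: "C_class 1 f" "C_class 1 (\<D> i f)" "C_class 1 (\<D> j f)"
    using assms C_class_mono[OF assms, of 1] by (auto simp: numeral_2_eq_2)
  have cd: "continuous_on UNIV (\<D> j (\<D> i f))"
      "continuous_on UNIV (\<D> i f)"
    using 1 C_class_continuous by auto
  have df: "g differentiable (at y)" if "C_class 1 g" for g y using that by simp
  let ?e = "\<lambda>k. axis k 1 :: real^3"
  have sum_e: "(\<Sum>j\<in>UNIV. ?e k $ j * g j) = g k" for g :: "3 \<Rightarrow> real" and k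
    by (simp add: axis_def if_distrib[of "\<lambda>x. x * _"] cong: if_cong)
  have ftc: "integral {0..s} (\<lambda>t. \<D> i f (y + t *\<^sub>R ?e i)) = f (y + s *\<^sub>R ?e i) - f y"
    if "s \<ge> 0" for s :: real and y
  proof -
    have "((\<lambda>t. \<D> i f (y + t *\<^sub>R ?e i)) has_integral
        f (y + s *\<^sub>R ?e i) - f (y + 0 *\<^sub>R ?e i)) {0..s}"
      using has_derivative_line[OF df[OF 1(1)], where x=y and v="?e i"] that unfolding sum_e
      by (intro fundamental_theorem_of_calculus)
       (auto simp: has_real_derivative_iff_has_vector_derivative[symmetric] intro: has_field_derivative_at_within)
    then show ?thesis by simp (metis integral_unique)
  qed
  have "integral {0..s} (\<lambda>t. \<D> j (\<D> i f) (x + t *\<^sub>R ?e i)) =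
     \<D> j f (x + s *\<^sub>R ?e i) - \<D> j f x" if "s \<ge> 0" for s :: real
  proof -
    have "((\<lambda>r. integral (cbox 0 s) (\<lambda>t. \<D> i f (x + t *\<^sub>R ?e i + r *\<^sub>R ?e j))) has_field_derivative
       integral (cbox 0 s) (\<lambda>t. \<D> j (\<D> i f) (x + t *\<^sub>R ?e i + 0 *\<^sub>R ?e j))) (at 0 within UNIV)"
    proof (rule leibniz_rule_field_derivative)
      fix r t :: real
      from has_derivative_line[OF df[OF 1(2)], where x="x + t *\<^sub>R ?e i" and s=r and v="?e j"]
      show "((\<lambda>r. \<D> i f (x + t *\<^sub>R ?e i + r *\<^sub>R ?e j)) has_field_derivative
         \<D> j (\<D> i f) (x + t *\<^sub>R ?e i + r *\<^sub>R ?e j)) (at r within UNIV)"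
        unfolding sum_e by simp
    next
      show "(\<lambda>t. \<D> i f (x + t *\<^sub>R ?e i + r *\<^sub>R ?e j)) integrable_on cbox 0 s" for r
        by (intro integrable_continuous continuous_on_compose2[OF cd(2)]) (auto intro!: continuous_intros)
      show "continuous_on (UNIV \<times> cbox 0 s)
        (\<lambda>(r, t). \<D> j (\<D> i f) (x + t *\<^sub>R ?e i + r *\<^sub>R ?e j))"
        unfolding split_beta by (rule continuous_on_compose2[OF cd(1)]) (auto intro!: continuous_intros)
    qed auto
    moreover have "integral (cbox 0 s) (\<lambda>t. \<D> i f (x + t *\<^sub>R ?e i + r *\<^sub>R ?e j)) =
        f (x + s *\<^sub>R ?e i + r *\<^sub>R ?e j) - f (x + r *\<^sub>R ?e j)" for r
      using ftc[OF that, of "x + r *\<^sub>R ?e j"] by (simp add: algebra_simps)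
    moreover have "((\<lambda>r. f (x + s *\<^sub>R ?e i + r *\<^sub>R ?e j) - f (x + r *\<^sub>R ?e j)) has_field_derivative
        \<D> j f (x + s *\<^sub>R ?e i + 0 *\<^sub>R ?e j) - \<D> j f (x + 0 *\<^sub>R ?e j)) (at 0)"
      using has_derivative_line[OF df[OF 1(1)], where x="x + s *\<^sub>R ?e i" and s=0 and v="?e j"]
        has_derivative_line[OF df[OF 1(1)], where x=x and s=0 and v="?e j"] unfolding sum_e
      by (rule DERIV_diff)
    ultimately show ?thesis using DERIV_unique by fastforce
  qed
  note key = this
  \<comment> \<open>\<open>key\<close> covers nonnegative lengths, so the derivatives at 0 are
    one-sided, taken within \<open>{0..1}\<close>.\<close>
  have "((\<lambda>s. integral {0..s} (\<lambda>t. \<D> j (\<D> i f) (x + t *\<^sub>R ?e i))) has_real_derivative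
     \<D> j (\<D> i f) (x + (0::real) *\<^sub>R ?e i)) (at 0 within {0..1})"
    by (rule integral_has_real_derivative)
      (auto intro!: continuous_on_compose2[OF cd(1)] continuous_intros)
  then have "((\<lambda>s. \<D> j f (x + s *\<^sub>R ?e i) - \<D> j f x) has_real_derivative
     \<D> j (\<D> i f) (x + (0::real) *\<^sub>R ?e i)) (at 0 within {0..1})"
    by (rule has_field_derivative_transform_within[where d=1]) (auto simp: key)
  moreover have "((\<lambda>s. \<D> j f (x + s *\<^sub>R ?e i) - \<D> j f x) has_real_derivative
     \<D> i (\<D> j f) (x + 0 *\<^sub>R ?e i) - 0) (at 0 within {0..1})"
    using has_derivative_line[OF df[OF 1(3)], where x=x and s=0 and v="?e i"] unfolding sum_e
    by (rule has_field_derivative_at_within[OF DERIV_diff[OF _ DERIV_const]])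
  moreover have "at (0::real) within {0..1} \<noteq> bot"
    using trivial_limit_within[of 0 "{0..1::real}"] islimpt_Icc[of 0 1 0] by auto
  ultimately show ?thesis
    unfolding has_field_derivative_iff using tendsto_unique by fastforce
qed

section \<open>Averages over a box\<close>

definition tz_box :: "(real \<times> (real^3)) set" where
  "tz_box = cbox (0, \<chi> i. - 1) (1, \<chi> i. 1)"

text \<open>One scheme for all operators: \<open>s t = t\<close> averages over segments,
  \<open>s t = 1\<close> is a convolution. The condition on \<open>s\<close> in
  \<open>avg_weight\<close> makes supports grow by at most 1 in each coordinate.\<close>

definition avg :: "(real \<Rightarrow> real^3 \<Rightarrow> real) \<Rightarrow> (real \<Rightarrow> real) \<Rightarrow> (real^3 \<Rightarrow> real) \<Rightarrow> real^3 \<Rightarrow> real" where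
  "avg w s f x = integral tz_box (\<lambda>(t, z). w t z * f (x - s t *\<^sub>R z))"

definition avg_weight :: "(real \<Rightarrow> real^3 \<Rightarrow> real) \<Rightarrow> (real \<Rightarrow> real) \<Rightarrow> bool" where
  "avg_weight w s \<longleftrightarrow> continuous_on UNIV (\<lambda>p. w (fst p) (snd p)) \<and> continuous_on UNIV s \<and>
     (\<forall>t\<in>{0..1}. \<bar>s t\<bar> \<le> 1)"

lemma mem_tz_box: "(t, z) \<in> tz_box \<longleftrightarrow> t \<in> {0..1} \<and> z \<in> cube 1"
  by (simp add: tz_box_def cube_def cbox_Pair_eq)

lemma avg_arg_continuous:
  assumes "avg_weight w s" "continuous_on UNIV f"
  shows "continuous_on A (\<lambda>q. w (fst (snd q)) (snd (snd q)) * f (fst q - s (fst (snd q)) *\<^sub>R snd (snd q)))"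
proof -
  have w: "continuous_on UNIV (\<lambda>p. w (fst p) (snd p))" and s: "continuous_on UNIV s"
    using assms(1) by (auto simp: avg_weight_def)
  show ?thesis
    by (intro continuous_on_mult continuous_on_compose2[OF w] continuous_on_compose2[OF assms(2)]
      continuous_intros continuous_on_compose2[OF s]) auto
qed

lemma avg_arg_continuous1:
  assumes "avg_weight w s" "continuous_on UNIV f"
  shows "continuous_on A (\<lambda>(t, z). w t z * f (x - s t *\<^sub>R z))"
proof -
  have "continuous_on A (\<lambda>p. (x, p))" by (intro continuous_intros)
  from continuous_on_compose2[OF avg_arg_continuous[OF assms, of UNIV] this] show ?thesis
    by (simp add: split_beta)
qed

lemma avg_arg_integrable:
  assumes "avg_weight w s" "continuous_on UNIV f"
  shows "(\<lambda>(t, z). w t z * f (x - s t *\<^sub>R z)) integrable_on tz_box"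
  unfolding tz_box_def by (intro integrable_continuous avg_arg_continuous1 assms)

lemma avg_continuous:
  assumes "avg_weight w s" "continuous_on UNIV f"
  shows "continuous_on UNIV (avg w s f)"
  unfolding avg_def[abs_def] tz_box_def
  by (rule integral_continuous_on_param)
    (use avg_arg_continuous[OF assms] in \<open>simp add: split_beta\<close>)

lemma avg_has_derivative:
  assumes w: "avg_weight w s" and f: "C_class 1 f"
  shows "(avg w s f has_derivative (\<lambda>h. \<Sum>i\<in>UNIV. h $ i * avg w s (\<D> i f) x)) (at x)"
proof -
  \<comment> \<open>The derivative of the integrand in \<open>x\<close> is a bounded linear map
    depending on \<open>(t, z)\<close>; expanding it in the coordinate functionals reduces its
    integral to three scalar averages.\<close>
  define c :: "3 \<Rightarrow> (real^3) \<Rightarrow>\<^sub>L real" where "c i = Blinfun (\<lambda>h. h $ i)" for i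
  have c: "blinfun_apply (c i) h = h $ i" for i h
    unfolding c_def by (simp add: bounded_linear_Blinfun_apply bounded_linear_vec_nth)
  have cf: "continuous_on UNIV f" and cd: "\<And>i. continuous_on UNIV (\<D> i f)"
    using f by (auto intro: C_class_continuous[OF f])
  define G where "G x = (\<lambda>(t, z). \<Sum>i\<in>UNIV. (w t z * \<D> i f (x - s t *\<^sub>R z)) *\<^sub>R c i)" for x
  have "((\<lambda>x. integral (cbox (0, \<chi> i. - 1) (1, \<chi> i. 1)) (\<lambda>(t, z). w t z * f (x - s t *\<^sub>R z)))
     has_derivative integral (cbox (0, \<chi> i. - 1) (1, \<chi> i. 1)) (G x)) (at x within UNIV)"
  proof (rule leibniz_rule)
    fix y :: "real^3" and p :: "real \<times> (real^3)"
    obtain t z where p: "p = (t, z)" by fastforce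
    have "((\<lambda>y. f ((- s t *\<^sub>R z) + 1 *\<^sub>R y)) has_derivative
       (\<lambda>h. frechet_derivative f (at ((- s t *\<^sub>R z) + 1 *\<^sub>R y)) (1 *\<^sub>R h))) (at y)"
      by (rule differentiable_affine_comp) (use f in simp)
    moreover have "frechet_derivative f (at (y - s t *\<^sub>R z)) = 
       (\<lambda>h. \<Sum>i\<in>UNIV. h $ i * \<D> i f (y - s t *\<^sub>R z))"
      using frechet_derivative_at[OF has_derivative_partial_deriv[of f "y - s t *\<^sub>R z"]] f by simp
    ultimately have "((\<lambda>y. f (y - s t *\<^sub>R z)) has_derivative
       (\<lambda>h. \<Sum>i\<in>UNIV. h $ i * \<D> i f (y - s t *\<^sub>R z))) (at y)"
      by simp
    from has_derivative_mult_right[OF this, of "w t z"]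
    have "((\<lambda>y. w t z * f (y - s t *\<^sub>R z)) has_derivative
       (\<lambda>h. w t z * (\<Sum>i\<in>UNIV. h $ i * \<D> i f (y - s t *\<^sub>R z)))) (at y)" .
    moreover have "blinfun_apply (G y p) = (\<lambda>h. w t z * (\<Sum>i\<in>UNIV. h $ i * \<D> i f (y - s t *\<^sub>R z)))"
      unfolding p G_def by (simp add: fun_eq_iff blinfun.sum_left blinfun.scaleR_left c sum_distrib_left mult_ac)
    ultimately show "((\<lambda>y. case p of (t, z) \<Rightarrow> w t z * f (y - s t *\<^sub>R z)) has_derivative blinfun_apply (G y p))
      (at y within UNIV)"
      unfolding p by simp
  next
    show "(\<lambda>(t, z). w t z * f (y - s t *\<^sub>R z)) integrable_on cbox (0, \<chi> i. - 1) (1, \<chi> i. 1)" for y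
      using avg_arg_integrable[OF w cf] unfolding tz_box_def .
    show "continuous_on (UNIV \<times> cbox (0, \<chi> i. - 1) (1, \<chi> i. 1)) (\<lambda>(x, p). G x p)"
      unfolding G_def split_beta
      by (intro continuous_on_sum continuous_on_scaleR continuous_on_const avg_arg_continuous[OF w cd])
  qed auto
  moreover have "blinfun_apply (integral (cbox (0, \<chi> i. - 1) (1, \<chi> i. 1)) (G x))
      = (\<lambda>h. \<Sum>i\<in>UNIV. h $ i * avg w s (\<D> i f) x)"
  proof
    fix h
    have *: "((\<lambda>(t, z). (w t z * \<D> i f (x - s t *\<^sub>R z)) *\<^sub>R c i) has_integral
        avg w s (\<D> i f) x *\<^sub>R c i) tz_box" for i
      using has_integral_scaleR_left[OF integrable_integral[OF avg_arg_integrable[OF w cd[of i], of x]], of "c i"]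
      unfolding avg_def by (simp add: case_prod_unfold)
    have "(G x has_integral (\<Sum>i\<in>UNIV. avg w s (\<D> i f) x *\<^sub>R c i)) tz_box"
      unfolding G_def using has_integral_sum[OF finite_class.finite_UNIV *]
      by (simp add: case_prod_unfold)
    then have "integral tz_box (G x) = (\<Sum>i\<in>UNIV. avg w s (\<D> i f) x *\<^sub>R c i)"
      by (rule integral_unique)
    then show "blinfun_apply (integral (cbox (0, \<chi> i. - 1) (1, \<chi> i. 1)) (G x)) h
      = (\<Sum>i\<in>UNIV. h $ i * avg w s (\<D> i f) x)"
      unfolding tz_box_def by (simp add: blinfun.sum_left blinfun.scaleR_left c mult_ac)
  qed
  ultimately show ?thesis
    by (metis (no_types, lifting) avg_def[abs_def] tz_box_def ext)
qed

lemma partial_deriv_avg: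
  assumes "avg_weight w s" "C_class 1 f"
  shows "\<D> i (avg w s f) = avg w s (\<D> i f)"
proof
  fix x
  show "\<D> i (avg w s f) x = avg w s (\<D> i f) x"
    using partial_derivI[OF avg_has_derivative[OF assms, of x], of i]
    by (simp add: axis_def if_distrib[of "\<lambda>x. x * _"] cong: if_cong)
qed

lemma C_class_avg:
  assumes "avg_weight w s" "C_class k f"
  shows "C_class k (avg w s f)"
  using assms(2)
proof (induction k arbitrary: f)
  case 0
  then show ?case using avg_continuous[OF assms(1)] by simp
next
  case (Suc k)
  have 1: "C_class 1 f" using C_class_mono[OF Suc.prems, of 1] by simp
  show ?case
    using avg_has_derivative[OF assms(1) 1] Suc
    by (auto simp: differentiable_def partial_deriv_avg[OF assms(1) 1])
qed

lemma not_mem_cube_shift: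
  assumes "x \<notin> cube (r + 1)" "\<bar>c\<bar> \<le> 1" "z \<in> cube 1"
  shows "x - c *\<^sub>R z \<notin> cube r"
proof -
  obtain i where i: "\<bar>x $ i\<bar> > r + 1" using assms(1) by (auto simp: mem_cube not_le)
  have "\<bar>c * z $ i\<bar> \<le> 1"
    using mult_mono[OF assms(2), of "\<bar>z $ i\<bar>" 1] assms(3) by (simp add: abs_mult mem_cube)
  then have "\<bar>(x - c *\<^sub>R z) $ i\<bar> > r" using i by simp
  then show ?thesis by (auto simp: mem_cube not_le intro!: exI[of _ i])
qed

lemma avg_outside:
  assumes "avg_weight w s" "\<And>x. x \<notin> cube r \<Longrightarrow> f x = 0" "x \<notin> cube (r + 1)"
  shows "avg w s f x = 0"
proof -
  have "w t z * f (x - s t *\<^sub>R z) = 0" if "(t, z) \<in> tz_box" for t z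
  proof -
    have s: "\<bar>s t\<bar> \<le> 1" and z: "\<And>i. \<bar>z $ i\<bar> \<le> 1"
      using that assms(1) by (auto simp: avg_weight_def mem_tz_box mem_cube)
    then have "x - s t *\<^sub>R z \<notin> cube r" using assms(3) by (intro not_mem_cube_shift) (simp_all add: mem_cube)
    then show ?thesis using assms(2) by simp
  qed
  then have "integral tz_box (\<lambda>(t, z). w t z * f (x - s t *\<^sub>R z)) = integral tz_box (\<lambda>p. 0)"
    by (intro integral_cong) auto
  then show ?thesis by (simp add: avg_def)
qed

lemma cont_supp_avg:
  assumes "avg_weight w s" "cont_supp f" shows "cont_supp (avg w s f)"
proof -
  obtain r where r: "\<And>x. x \<notin> cube r \<Longrightarrow> f x = 0" using assms unfolding cont_supp_def by blast
  show ?thesis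
    using avg_continuous[OF assms(1) cont_supp_cont[OF assms(2)]] avg_outside[OF assms(1) r]
    by (rule cont_suppI)
qed

text \<open>Integrate the square of \<open>c * g - I\<close>, where \<open>c\<close> is the volume
  of the box and \<open>I\<close> the integral of \<open>g\<close>. Volume 0 is treated separately
  because \<open>c\<close> is cancelled at the end.\<close>

lemma integral_square_le:
  fixes g :: "'a::euclidean_space \<Rightarrow> real"
  assumes "continuous_on (cbox a b) g"
  shows "(integral (cbox a b) g)\<^sup>2 \<le> measure lborel (cbox a b) * integral (cbox a b) (\<lambda>x. (g x)\<^sup>2)"
proof (cases "measure lborel (cbox a b) = 0")
  case True
  then have "integral (cbox a b) g = 0" by (rule integral_null)
  then show ?thesis using True by simp
next
  case False
  let ?c = "measure lborel (cbox a b)" and ?I = "integral (cbox a b) g"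
  have c: "?c > 0" using False by (simp add: order_less_le)
  have int: "g integrable_on cbox a b" "(\<lambda>x. (g x)\<^sup>2) integrable_on cbox a b"
    using assms by (auto intro!: integrable_continuous continuous_intros)
  have "((\<lambda>x. ?c\<^sup>2 * (g x)\<^sup>2 - (2 * ?c * ?I) * g x + ?I\<^sup>2) has_integral
     ?c\<^sup>2 * integral (cbox a b) (\<lambda>x. (g x)\<^sup>2) - (2 * ?c * ?I) * ?I + ?c *\<^sub>R ?I\<^sup>2) (cbox a b)"
    by (intro has_integral_add has_integral_diff has_integral_mult_right has_integral_const
       integrable_integral int)
  moreover have "0 \<le> ?c\<^sup>2 * (g x)\<^sup>2 - (2 * ?c * ?I) * g x + ?I\<^sup>2" for x
  proof -
    have "?c\<^sup>2 * (g x)\<^sup>2 - (2 * ?c * ?I) * g x + ?I\<^sup>2 = (?c * g x - ?I)\<^sup>2"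
      by (simp add: power2_eq_square algebra_simps)
    then show ?thesis by simp
  qed
  ultimately have "0 \<le> ?c\<^sup>2 * integral (cbox a b) (\<lambda>x. (g x)\<^sup>2) - (2 * ?c * ?I) * ?I + ?c *\<^sub>R ?I\<^sup>2"
    by (rule has_integral_nonneg)
  then have "0 \<le> ?c * (?c * integral (cbox a b) (\<lambda>x. (g x)\<^sup>2) - ?I\<^sup>2)"
    by (simp add: power2_eq_square algebra_simps)
  then show ?thesis using c by (simp add: zero_le_mult_iff)
qed

text \<open>Cauchy-Schwarz in \<open>(t, z)\<close> for each \<open>x\<close>, then an exchange of
  integrals: for fixed \<open>(t, z)\<close> the integral over \<open>x\<close> is that of a
  translate of the square of \<open>f\<close>, hence the same for all \<open>(t, z)\<close>.\<close>

lemma avg_L2_bound: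
  assumes w: "avg_weight w s" and f: "cont_supp f"
    and B: "\<And>t z. t \<in> {0..1} \<Longrightarrow> z \<in> cube 1 \<Longrightarrow> \<bar>w t z\<bar> \<le> B"
  shows "integral UNIV (\<lambda>x. (avg w s f x)\<^sup>2) \<le> (B * measure lborel tz_box)\<^sup>2 * integral UNIV (\<lambda>x. (f x)\<^sup>2)"
proof -
  obtain r where r: "\<And>x. x \<notin> cube r \<Longrightarrow> f x = 0" using f unfolding cont_supp_def by blast
  let ?a = "(\<chi> i. - (r+1)) :: real^3" and ?b = "(\<chi> i. r+1) :: real^3"
  let ?c = "(0, \<chi> i. - 1) :: real \<times> (real^3)" and ?d = "(1, \<chi> i. 1) :: real \<times> (real^3)"
  let ?k = "measure lborel tz_box"
  define h where "h x p = (f (x - s (fst p) *\<^sub>R snd p))\<^sup>2" for x p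
  have cf: "continuous_on UNIV f" using f by (rule cont_supp_cont)
  have s: "continuous_on UNIV s" using w by (auto simp: avg_weight_def)
  have ch: "continuous_on A (\<lambda>(x, p). h x p)" for A
    unfolding h_def split_beta
    by (intro continuous_on_power continuous_on_compose2[OF cf] continuous_intros continuous_on_compose2[OF s]) auto
  have ch2: "continuous_on A (\<lambda>x. h x p)" and ch1: "continuous_on A' (\<lambda>p. h x p)" for A A' x p
  proof -
    have "continuous_on A (\<lambda>x. (x, p))" "continuous_on A' (\<lambda>p. (x, p))"
      by (intro continuous_intros)+
    from this[THEN continuous_on_compose2[OF ch[of UNIV]]]
    show "continuous_on A (\<lambda>x. h x p)" "continuous_on A' (\<lambda>p. h x p)" by simp_all
  qed
  have pt: "(avg w s f x)\<^sup>2 \<le> ?k * B\<^sup>2 * integral (cbox ?c ?d) (h x)" for x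
  proof -
    have "(avg w s f x)\<^sup>2 \<le> ?k * integral tz_box (\<lambda>p. ((\<lambda>(t, z). w t z * f (x - s t *\<^sub>R z)) p)\<^sup>2)"
      unfolding avg_def tz_box_def
      by (intro integral_square_le avg_arg_continuous1[OF w cf])
    moreover have "integral tz_box (\<lambda>p. ((\<lambda>(t, z). w t z * f (x - s t *\<^sub>R z)) p)\<^sup>2)
        \<le> integral tz_box (\<lambda>p. B\<^sup>2 * h x p)"
      unfolding tz_box_def
    proof (rule integral_le)
      show "(\<lambda>p. ((\<lambda>(t, z). w t z * f (x - s t *\<^sub>R z)) p)\<^sup>2) integrable_on cbox ?c ?d"
        by (intro integrable_continuous continuous_on_power avg_arg_continuous1[OF w cf])
      show "(\<lambda>p. B\<^sup>2 * h x p) integrable_on cbox ?c ?d"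
        by (intro integrable_continuous continuous_intros ch1)
      show "((\<lambda>(t, z). w t z * f (x - s t *\<^sub>R z)) p)\<^sup>2 \<le> B\<^sup>2 * h x p" if "p \<in> cbox ?c ?d" for p
      proof -
        have "\<bar>w (fst p) (snd p)\<bar> \<le> B"
          using B[of "fst p" "snd p"] that by (cases p) (auto simp: cbox_Pair_eq cube_def)
        then have "(w (fst p) (snd p))\<^sup>2 \<le> B\<^sup>2"
          using power_mono[of "\<bar>w (fst p) (snd p)\<bar>" B 2] by simp
        then show ?thesis by (simp add: split_beta h_def power_mult_distrib mult_right_mono)
      qed
    qed
    moreover have "integral tz_box (\<lambda>p. B\<^sup>2 * h x p) = B\<^sup>2 * integral (cbox ?c ?d) (h x)"
      unfolding tz_box_def by simp
    ultimately show ?thesis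
      using mult_left_mono[of _ _ ?k] by (metis (no_types, lifting) measure_nonneg mult.assoc order_trans)
  qed
  have inner: "integral (cbox ?a ?b) (\<lambda>x. h x p) = integral UNIV (\<lambda>x. (f x)\<^sup>2)" if "p \<in> cbox ?c ?d" for p
  proof -
    have "h x p = 0" if x: "x \<notin> cube (r + 1)" for x
    proof -
      have s: "\<bar>s (fst p)\<bar> \<le> 1" and z: "\<And>i. \<bar>snd p $ i\<bar> \<le> 1"
        using \<open>p \<in> cbox ?c ?d\<close> w mem_tz_box[of "fst p" "snd p"]
        by (auto simp: avg_weight_def mem_cube tz_box_def)
      then have "x - s (fst p) *\<^sub>R snd p \<notin> cube r" using x by (intro not_mem_cube_shift) (simp_all add: mem_cube)
      then show ?thesis using r by (simp add: h_def)
    qed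
    then have "integral (cube (r + 1)) (\<lambda>x. h x p) = integral UNIV (\<lambda>x. h x p)"
      using integral_UNIV_cube[OF ch2, of "r + 1" p] by simp
    also have "\<dots> = integral UNIV (\<lambda>x. (f x)\<^sup>2)"
      using integral_translate[OF cont_supp_power2[OF f], of "- s (fst p) *\<^sub>R snd p"]
      by (simp add: h_def)
    finally show ?thesis by (simp add: cube_def)
  qed
  have "integral UNIV (\<lambda>x. (avg w s f x)\<^sup>2) = integral (cube (r + 1)) (\<lambda>x. (avg w s f x)\<^sup>2)"
    using avg_outside[OF w r] avg_continuous[OF w cf]
    by (intro integral_UNIV_cube) (auto intro!: continuous_intros)
  also have "\<dots> \<le> integral (cube (r + 1)) (\<lambda>x. ?k * B\<^sup>2 * integral (cbox ?c ?d) (h x))"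
  proof (rule integral_le)
    show "(\<lambda>x. (avg w s f x)\<^sup>2) integrable_on cube (r + 1)"
      using avg_continuous[OF w cf] by (intro integrable_on_cube) (auto intro!: continuous_intros)
    have "continuous_on UNIV (\<lambda>x. integral (cbox ?c ?d) (h x))"
      by (rule integral_continuous_on_param) (rule ch)
    then show "(\<lambda>x. ?k * B\<^sup>2 * integral (cbox ?c ?d) (h x)) integrable_on cube (r + 1)"
      by (intro integrable_on_cube) (auto intro!: continuous_intros)
  qed (rule pt)
  also have "\<dots> = ?k * B\<^sup>2 * integral (cbox ?a ?b) (\<lambda>x. integral (cbox ?c ?d) (h x))"
    by (simp add: cube_def)
  also have "integral (cbox ?a ?b) (\<lambda>x. integral (cbox ?c ?d) (h x))
      = integral (cbox ?c ?d) (\<lambda>p. integral (cbox ?a ?b) (\<lambda>x. h x p))"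
    by (rule integral_swap_continuous) (rule ch)
  also have "\<dots> = integral (cbox ?c ?d) (\<lambda>p. integral UNIV (\<lambda>x. (f x)\<^sup>2))"
    by (intro integral_cong inner)
  also have "\<dots> = ?k * integral UNIV (\<lambda>x. (f x)\<^sup>2)" by (simp add: tz_box_def)
  finally show ?thesis by (simp add: power2_eq_square mult_ac)
qed

text \<open>The z-derivative of \<open>f (x - c z)\<close> carries the factor \<open>- c\<close>,
  which is why \<open>c\<close> stays on the left. The kernel vanishes off the cube, so there are no
  boundary terms.\<close>

lemma kernel_integration_by_parts:
  assumes k: "C_class 1 \<kappa>" "\<And>z. z \<notin> cube 1 \<Longrightarrow> \<kappa> z = 0" and f: "C_class 1 f"
  shows "c * integral (cube 1) (\<lambda>z. \<kappa> z * \<D> l f (x - c *\<^sub>R z))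
       = integral (cube 1) (\<lambda>z. \<D> l \<kappa> z * f (x - c *\<^sub>R z))"
proof -
  let ?g = "\<lambda>z. f (x - c *\<^sub>R z)"
  have cs: "cont_supp \<kappa>" using C_class_continuous[OF k(1)] k(2) by (rule cont_suppI)
  have g: "C_class 1 ?g" using C_class_affine[OF f, of x "-c"] by simp
  have dg: "\<D> l ?g z = - c * \<D> l f (x - c *\<^sub>R z)" for z
    using partial_deriv_affine[of f x "-c" z l] f by simp
  have ck: "continuous_on UNIV \<kappa>" "continuous_on UNIV (\<D> l \<kappa>)"
     "continuous_on UNIV ?g" "continuous_on UNIV (\<D> l ?g)"
    using k(1) g C_class_continuous[OF k(1)] C_class_continuous[OF g] by auto
  have dk: "\<D> l \<kappa> z = 0" if "z \<notin> cube 1" for z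
    by (rule partial_deriv_eq_0[where S="- cube 1" and c=0])
      (use that k(2) in \<open>auto simp: cube_def open_Compl\<close>)
  have "integral UNIV (\<lambda>z. \<kappa> z * \<D> l ?g z) = - integral UNIV (\<lambda>z. \<D> l \<kappa> z * ?g z)"
    by (rule integration_by_parts[OF k(1) g cs])
  moreover have "integral UNIV (\<lambda>z. \<kappa> z * \<D> l ?g z) = integral (cube 1) (\<lambda>z. \<kappa> z * \<D> l ?g z)"
    using k(2) ck by (intro integral_UNIV_cube) (auto intro!: continuous_intros)
  moreover have "integral UNIV (\<lambda>z. \<D> l \<kappa> z * ?g z) = integral (cube 1) (\<lambda>z. \<D> l \<kappa> z * ?g z)"
    using dk ck by (intro integral_UNIV_cube) (auto intro!: continuous_intros)
  moreover have "integral (cube 1) (\<lambda>z. \<kappa> z * \<D> l ?g z)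
      = - c * integral (cube 1) (\<lambda>z. \<kappa> z * \<D> l f (x - c *\<^sub>R z))"
    unfolding dg by (subst integral_mult_right[symmetric]) (simp add: mult_ac)
  ultimately show ?thesis by simp
qed

lemma avg_Fubini:
  assumes "avg_weight w s" "continuous_on UNIV f"
  shows "avg w s f x = integral {0..1} (\<lambda>t. integral (cube 1) (\<lambda>z. w t z * f (x - s t *\<^sub>R z)))"
  unfolding avg_def tz_box_def
  by (subst integral_prod_continuous[OF avg_arg_continuous1[OF assms]]) (simp add: cube_def)

text \<open>A derivative moves from \<open>f\<close> to the kernel at the price of a factor
  \<open>s t\<close>. The free weight \<open>\<alpha>\<close> is there to compensate this factor
  when \<open>s t = t\<close>, as in \<open>partial_deriv_riesz_far\<close>.\<close>

lemma avg_integration_by_parts: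
  assumes k: "C_class 1 \<kappa>" "\<And>z. z \<notin> cube 1 \<Longrightarrow> \<kappa> z = 0" and f: "C_class 1 f"
    and s: "continuous_on UNIV s" "\<forall>t\<in>{0..1}. \<bar>s t\<bar> \<le> 1" and a: "continuous_on UNIV \<alpha>"
  shows "avg (\<lambda>t z. \<alpha> t * s t * \<kappa> z) s (\<D> l f) x
    = avg (\<lambda>t z. \<alpha> t * \<D> l \<kappa> z) s f x"
proof -
  have ck: "continuous_on UNIV \<kappa>" "continuous_on UNIV (\<D> l \<kappa>)"
     "continuous_on UNIV f" "continuous_on UNIV (\<D> l f)"
    using k(1) f C_class_continuous[OF k(1)] C_class_continuous[OF f] by auto
  have w: "avg_weight (\<lambda>t z. \<alpha> t * s t * \<kappa> z) s" "avg_weight (\<lambda>t z. \<alpha> t * \<D> l \<kappa> z) s"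
    unfolding avg_weight_def using s
    by (auto intro!: continuous_intros continuous_on_compose2[OF a] continuous_on_compose2[OF s(1)]
        continuous_on_compose2[OF ck(1)] continuous_on_compose2[OF ck(2)])
  have "integral (cube 1) (\<lambda>z. \<alpha> t * s t * \<kappa> z * \<D> l f (x - s t *\<^sub>R z))
    = integral (cube 1) (\<lambda>z. \<alpha> t * \<D> l \<kappa> z * f (x - s t *\<^sub>R z))" for t
  proof -
    have "integral (cube 1) (\<lambda>z. \<alpha> t * s t * \<kappa> z * \<D> l f (x - s t *\<^sub>R z))
       = \<alpha> t * (s t * integral (cube 1) (\<lambda>z. \<kappa> z * \<D> l f (x - s t *\<^sub>R z)))"
      by (simp flip: integral_mult_right add: mult_ac)
    also have "\<dots> = \<alpha> t * integral (cube 1) (\<lambda>z. \<D> l \<kappa> z * f (x - s t *\<^sub>R z))"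
      using kernel_integration_by_parts[OF k f, of "s t" l x] by simp
    also have "\<dots> = integral (cube 1) (\<lambda>z. \<alpha> t * \<D> l \<kappa> z * f (x - s t *\<^sub>R z))"
      by (simp flip: integral_mult_right add: mult_ac)
    finally show ?thesis .
  qed
  then show ?thesis by (simp add: avg_Fubini[OF w(1) ck(4)] avg_Fubini[OF w(2) ck(3)])
qed

section \<open>Riesz-type operators\<close>

text \<open>Squaring removes the kink: at 0 the difference quotient is \<open>max 0 h\<close>
  itself.\<close>

lemma DERIV_max_0_power2:
  "((\<lambda>u::real. (max 0 u)\<^sup>2) has_field_derivative 2 * max 0 u) (at u)"
proof -
  consider "u > 0" | "u < 0" | "u = 0" by linarith
  then show ?thesis
  proof cases
    case 1
    have "((\<lambda>u::real. u\<^sup>2) has_field_derivative 2 * u) (at u)"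
      by (auto intro!: derivative_eq_intros)
    then show ?thesis
      by (rule has_field_derivative_transform_within_open[of _ _ _ "{0<..}", THEN DERIV_cong])
        (use 1 in auto)
  next
    case 2
    have "((\<lambda>u::real. 0) has_field_derivative 0) (at u)" by simp
    then show ?thesis
      by (rule has_field_derivative_transform_within_open[of _ _ _ "{..<0}", THEN DERIV_cong])
        (use 2 in auto)
  next
    case 3
    have "((\<lambda>h::real. max 0 h) \<longlongrightarrow> 0) (at 0)"
      using tendsto_max[OF tendsto_const[of 0] tendsto_ident_at[of 0 UNIV]] by simp
    moreover have "eventually (\<lambda>h::real. max 0 h = ((max 0 (0 + h))\<^sup>2 - (max 0 0)\<^sup>2) / h) (at 0)"
    proof -
      have "max 0 h = ((max 0 (0 + h))\<^sup>2 - (max 0 0)\<^sup>2) / h" if "h \<noteq> 0" for h :: real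
        using that by (cases "h > 0") (simp_all add: power2_eq_square)
      then show ?thesis by (simp only: eventually_at_filter) (rule always_eventually, blast)
    qed
    ultimately have "((\<lambda>h::real. ((max 0 (0 + h))\<^sup>2 - (max 0 0)\<^sup>2) / h) \<longlongrightarrow> 0) (at 0)"
      by (rule Lim_transform_eventually)
    then show ?thesis using 3 by (simp add: DERIV_def)
  qed
qed

text \<open>The square makes it C^1; its support is the unit ball. Since it is radial, its gradient
  is a scalar function times \<open>z\<close>, so the Jacobian of the field \<open>z\<close> times
  \<open>bump z\<close> is symmetric.\<close>

definition bump :: "real^3 \<Rightarrow> real" where
  "bump z = (max 0 (1 - z \<bullet> z))\<^sup>2"

lemma bump_has_derivative:
  "(bump has_derivative (\<lambda>h. - 4 * max 0 (1 - z \<bullet> z) * (z \<bullet> h))) (at z)"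
proof -
  have "((\<lambda>z::real^3. 1 - z \<bullet> z) has_derivative (\<lambda>h. - (z \<bullet> h + h \<bullet> z))) (at z)"
    by (auto intro!: derivative_eq_intros)
  from has_derivative_compose[OF this DERIV_max_0_power2[unfolded has_field_derivative_def]]
  show ?thesis by (simp add: bump_def[abs_def] inner_commute mult_ac)
qed

lemma partial_deriv_bump: "\<D> i bump = (\<lambda>z. - 4 * max 0 (1 - z \<bullet> z) * z $ i)"
  by (rule ext) (simp add: partial_derivI[OF bump_has_derivative] inner_axis)

lemma C_class_bump: "C_class 1 bump"
proof -
  have "continuous_on UNIV (\<D> i bump)" for i
    unfolding partial_deriv_bump by (intro continuous_intros)
  then show ?thesis using bump_has_derivative by (auto simp: differentiable_def)
qed

lemma C_class_component: "C_class 2 (\<lambda>x. x $ i)"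
  and partial_deriv_component: "\<D> j (\<lambda>x. x $ i) x = (if j = i then 1 else 0)"
proof -
  show "C_class 2 (\<lambda>x. x $ i)"
    using C_class_coord(1)[of "\<lambda>s. s" "\<lambda>s. 1" "\<lambda>s. 0" i] by auto
  show "\<D> j (\<lambda>x. x $ i) x = (if j = i then 1 else 0)"
    using C_class_coord(2)[of "\<lambda>s. s" "\<lambda>s. 1" "\<lambda>s. 0" j i x] by auto
qed

lemma bump_outside: "z \<notin> cube 1 \<Longrightarrow> bump z = 0"
proof -
  assume "z \<notin> cube 1"
  then obtain i where "1 < \<bar>z $ i\<bar>" by (auto simp: mem_cube not_le)
  then have "1 < norm z" using component_le_norm_cart[of z i] by linarith
  then have "1 < z \<bullet> z" by (simp add: dot_square_norm one_less_power)
  then show ?thesis by (simp add: bump_def)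
qed

definition riesz_kernel :: "3 \<Rightarrow> real^3 \<Rightarrow> real" where
  "riesz_kernel i z = z $ i * bump z"

lemma C_class_riesz_kernel: "C_class 1 (riesz_kernel i)"
  unfolding riesz_kernel_def[abs_def]
  by (intro C_class_mult C_class_bump C_class_mono[OF C_class_component]) simp

text \<open>The symmetry of the right side in \<open>i\<close> and \<open>l\<close> is what
  \<open>riesz_commute\<close> rests on.\<close>

lemma partial_deriv_riesz_kernel:
  "\<D> l (riesz_kernel i) z =
    (if l = i then bump z else 0) - 4 * max 0 (1 - z \<bullet> z) * (z $ i * z $ l)"
proof -
  have "\<D> l (\<lambda>z. z $ i * bump z) z
     = \<D> l (\<lambda>z. z $ i) z * bump z + z $ i * \<D> l bump z"
    using C_class_mono[OF C_class_component, of 1 i] C_class_bump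
    by (intro partial_deriv_mult) auto
  then show ?thesis
    by (simp add: riesz_kernel_def[abs_def] partial_deriv_component partial_deriv_bump)
qed

lemma riesz_kernel_outside: "z \<notin> cube 1 \<Longrightarrow> riesz_kernel i z = 0"
  by (simp add: riesz_kernel_def bump_outside)

lemma bump_bounds: "0 \<le> bump z" "bump z \<le> 1"
  by (auto simp: bump_def power_le_one_iff)

text \<open>The common constant 5 is dictated by the last bound: 1 for the bump and 4 for the term
  from its gradient.\<close>

lemma kernel_bounds:
  assumes "z \<in> cube 1"
  shows "\<bar>bump z\<bar> \<le> 5" "\<bar>riesz_kernel i z\<bar> \<le> 5" "\<bar>\<D> l bump z\<bar> \<le> 5"
    "\<bar>\<D> l (riesz_kernel i) z\<bar> \<le> 5"
proof -
  have z: "\<bar>z $ i\<bar> \<le> 1" for i using assms by (simp add: mem_cube)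
  have m: "0 \<le> max 0 (1 - z \<bullet> z)" "max 0 (1 - z \<bullet> z) \<le> 1" by auto
  have p: "\<bar>a * b\<bar> \<le> 1" if "\<bar>a\<bar> \<le> 1" "\<bar>b\<bar> \<le> 1" for a b :: real
    using mult_mono[OF that] by (simp add: abs_mult)
  show "\<bar>bump z\<bar> \<le> 5" using bump_bounds[of z] by simp
  show "\<bar>riesz_kernel i z\<bar> \<le> 5"
    using p[OF z, of "bump z" i] bump_bounds[of z] by (simp add: riesz_kernel_def)
  have "\<bar>max 0 (1 - z \<bullet> z) * z $ l\<bar> \<le> 1" using m by (intro p z) simp
  then show "\<bar>\<D> l bump z\<bar> \<le> 5"
    by (simp add: partial_deriv_bump abs_mult)
  have "\<bar>max 0 (1 - z \<bullet> z) * (z $ i * z $ l)\<bar> \<le> 1" using m by (intro p z) simp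
  show "\<bar>\<D> l (riesz_kernel i) z\<bar> \<le> 5"
  proof -
    have "\<bar>if l = i then bump z else 0\<bar> \<le> 1" using bump_bounds[of z] by simp
    then show ?thesis
      using \<open>\<bar>max 0 (1 - z \<bullet> z) * (z $ i * z $ l)\<bar> \<le> 1\<close>
      unfolding partial_deriv_riesz_kernel mult.assoc by linarith
  qed
qed

section \<open>Averaging operators built from the bump\<close>

definition bump_mass :: real where "bump_mass = integral (cube 1) bump"

lemma bump_mass_pos: "bump_mass > 0"
proof -
  have cb: "continuous_on A bump" for A by (rule C_class_continuous[OF C_class_bump])
  \<comment> \<open>On this cube, which has volume 1, \<open>z \<bullet> z\<close> is at most 3/4,
    so the bump is at least the square of 1/4.\<close>
  have "integral (cube (1/2)) (\<lambda>z. 1/16) \<le> integral (cube (1/2)) bump"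
  proof (rule integral_le)
    show "bump integrable_on cube (1/2)" by (rule integrable_on_cube) (rule cb)
    show "(\<lambda>z. 1/16::real) integrable_on cube (1/2)" by (rule integrable_on_cube) auto
    fix z assume z: "z \<in> cube (1/2)"
    have "(z $ i)\<^sup>2 \<le> 1/4" for i
      using power_mono[of "\<bar>z $ i\<bar>" "1/2" 2] z by (simp add: mem_cube power2_eq_square)
    from this[of 1] this[of 2] this[of 3] have "z \<bullet> z \<le> 3/4"
      by (simp add: inner_vec_def sum_3 power2_eq_square)
    then have "1/4 \<le> max 0 (1 - z \<bullet> z)" by simp
    from power_mono[OF this, of 2] show "1/16 \<le> bump z"
      by (simp add: bump_def power2_eq_square)
  qed
  also have "\<dots> \<le> integral (cube 1) bump"
    using bump_bounds(1) by (intro integral_subset_le integrable_on_cube cb cube_mono) auto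
  also have "integral (cube (1/2)) (\<lambda>z. 1/16) = measure lborel (cube (1/2)) * (1/16)"
    by (simp add: cube_def)
  finally have "measure lborel (cube (1/2)) / 16 \<le> bump_mass" by (simp add: bump_mass_def)
  moreover have "measure lborel (cube (1/2)) = 1"
    unfolding cube_def by (subst content_cbox_cart) (auto simp: interval_ne_empty_cart)
  ultimately show ?thesis by simp
qed

text \<open>Substituting \<open>y = t z\<close> exhibits a convolution with the kernel
  \<open>y $ i / |y|^3\<close> times the integral of \<open>\<sigma>^2 m(\<sigma>)\<close> over
  \<open>\<sigma> \<ge> |y|\<close>, where \<open>m\<close> is the radial profile of the bump. Near
  0 it behaves like \<open>bump_mass\<close> times minus the gradient of the Newton potential, and
  it vanishes for \<open>|y| \<ge> 1\<close>. Integrating over \<open>(t, z)\<close> keeps the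
  integrand continuous.\<close>

definition riesz :: "3 \<Rightarrow> (real^3 \<Rightarrow> real) \<Rightarrow> real^3 \<Rightarrow> real" where
  "riesz i = avg (\<lambda>t. riesz_kernel i) (\<lambda>t. t)"

definition bump_avg :: "(real^3 \<Rightarrow> real) \<Rightarrow> real^3 \<Rightarrow> real" where
  "bump_avg = avg (\<lambda>t. bump) (\<lambda>t. 1)"

lemma avg_weightI:
  assumes "continuous_on UNIV \<alpha>" "continuous_on UNIV \<kappa>" "continuous_on UNIV s"
    "\<And>t. t \<in> {0..1} \<Longrightarrow> \<bar>s t\<bar> \<le> 1"
  shows "avg_weight (\<lambda>t z. \<alpha> t * \<kappa> z) s"
proof -
  have "continuous_on UNIV (\<lambda>p::real \<times> (real^3). \<alpha> (fst p) * \<kappa> (snd p))"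
    by (intro continuous_intros continuous_on_compose2[OF assms(1)] continuous_on_compose2[OF assms(2)]) auto
  then show ?thesis unfolding avg_weight_def using assms(3,4) by simp
qed

lemma continuous_kernels:
  "continuous_on A bump" "continuous_on A (riesz_kernel i)"
  "continuous_on A (\<D> l bump)" "continuous_on A (\<D> l (riesz_kernel i))"
  by (rule C_class_continuous[OF C_class_bump] C_class_continuous[OF C_class_riesz_kernel]
    C_class_continuous[OF C_class_partial_deriv[OF C_class_bump[unfolded One_nat_def]]]
    C_class_continuous[OF C_class_partial_deriv[OF C_class_riesz_kernel[unfolded One_nat_def]]])+

lemma avg_weight_riesz: "avg_weight (\<lambda>t. riesz_kernel i) (\<lambda>t. t)"
  using avg_weightI[of "\<lambda>t. 1" "riesz_kernel i" "\<lambda>t. t"] continuous_kernels(2) by auto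

lemma avg_weight_bump: "avg_weight (\<lambda>t. bump) (\<lambda>t. 1)"
  using avg_weightI[of "\<lambda>t. 1" bump "\<lambda>t. 1"] continuous_kernels(1) by auto

lemma avg_weight_partial_bump: "avg_weight (\<lambda>t. \<D> l bump) (\<lambda>t. 1)"
  using avg_weightI[of "\<lambda>t. 1" "\<D> l bump" "\<lambda>t. 1"] continuous_kernels(3) by auto

lemmas C_class_riesz = C_class_avg[OF avg_weight_riesz, folded riesz_def]
lemmas C_class_bump_avg = C_class_avg[OF avg_weight_bump, folded bump_avg_def]
lemmas partial_deriv_riesz = partial_deriv_avg[OF avg_weight_riesz, folded riesz_def]
lemmas cont_supp_riesz = cont_supp_avg[OF avg_weight_riesz, folded riesz_def]
lemmas cont_supp_bump_avg = cont_supp_avg[OF avg_weight_bump, folded bump_avg_def]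

text \<open>For \<open>s t = 1\<close> integration by parts costs nothing, so the derivative can sit
  on the kernel and the L2 bound involves \<open>f\<close> alone.\<close>

lemma partial_deriv_bump_avg:
  assumes "C_class 1 f"
  shows "\<D> l (bump_avg f) = avg (\<lambda>t. \<D> l bump) (\<lambda>t. 1) f"
proof
  fix x
  have "avg (\<lambda>t z. 1 * 1 * bump z) (\<lambda>t. 1) (\<D> l f) x
    = avg (\<lambda>t z. 1 * \<D> l bump z) (\<lambda>t. 1) f x"
    by (rule avg_integration_by_parts[OF C_class_bump bump_outside assms]) auto
  then show "\<D> l (bump_avg f) x = avg (\<lambda>t. \<D> l bump) (\<lambda>t. 1) f x"
    using partial_deriv_avg[OF avg_weight_bump assms] by (simp add: bump_avg_def)
qed

lemma bump_avg_eq: 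
  assumes "continuous_on UNIV f"
  shows "bump_avg f x = integral (cube 1) (\<lambda>z. bump z * f (x - z))"
  unfolding bump_avg_def by (simp add: avg_Fubini[OF avg_weight_bump assms])

text \<open>Along the segment from \<open>x\<close> to \<open>x - z\<close> the integrand is, up to the factor \<open>bump z\<close>,
  the derivative of \<open>t \<mapsto> - f (x - t z)\<close>.\<close>

lemma riesz_divergence:
  assumes "C_class 1 f"
  shows "(\<Sum>i\<in>UNIV. riesz i (\<D> i f) x) = bump_mass * f x - bump_avg f x"
proof -
  have cf: "continuous_on UNIV f" and cd: "\<And>i. continuous_on UNIV (\<D> i f)"
    using assms C_class_continuous[OF assms] by auto
  let ?G = "\<lambda>t z. bump z * (\<Sum>i\<in>UNIV. z $ i * \<D> i f (x - t *\<^sub>R z))"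
  have ftc: "integral {0..1} (\<lambda>t. ?G t z) = bump z * (f x - f (x - z))" for z
  proof -
    have "((\<lambda>t. - f (x + t *\<^sub>R (- z))) has_real_derivative
       - (\<Sum>i\<in>UNIV. (- z) $ i * \<D> i f (x + t *\<^sub>R (- z)))) (at t)" for t
      by (rule DERIV_minus) (rule has_derivative_line, use assms in simp)
    then have "((\<lambda>t. - (\<Sum>i\<in>UNIV. (- z) $ i * \<D> i f (x + t *\<^sub>R (- z)))) has_integral
        (- f (x + 1 *\<^sub>R (- z))) - (- f (x + 0 *\<^sub>R (- z)))) {0..1}"
      by (intro fundamental_theorem_of_calculus)
       (auto simp: has_real_derivative_iff_has_vector_derivative[symmetric] intro: has_field_derivative_at_within)
    then have "((\<lambda>t. \<Sum>i\<in>UNIV. z $ i * \<D> i f (x - t *\<^sub>R z)) has_integral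
        f x - f (x - z)) {0..1}"
      by (simp add: sum_negf)
    from has_integral_mult_right[OF this, of "bump z"] show ?thesis by (rule integral_unique)
  qed
  have cont: "continuous_on A (\<lambda>p. ?G (fst p) (snd p))" for A
    by (intro continuous_intros continuous_on_compose2[OF cd]
        continuous_on_compose2[OF continuous_kernels(1)[of UNIV]]) auto
  have "(\<Sum>i\<in>UNIV. riesz i (\<D> i f) x)
      = integral tz_box (\<lambda>p. \<Sum>i\<in>UNIV. (case p of (t, z) \<Rightarrow> riesz_kernel i z * \<D> i f (x - t *\<^sub>R z)))"
    unfolding riesz_def avg_def
    by (rule integral_sum[symmetric]) (auto intro: avg_arg_integrable[OF avg_weight_riesz cd])
  also have "\<dots> = integral tz_box (\<lambda>(t, z). ?G t z)"
    by (intro arg_cong[of _ _ "integral tz_box"] ext)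
      (auto simp: riesz_kernel_def sum_distrib_left mult_ac)
  also have "\<dots> = integral (cbox 0 1) (\<lambda>t. integral (cube 1) (?G t))"
    unfolding tz_box_def cube_def
    by (subst integral_prod_continuous) (use cont in \<open>auto simp: case_prod_unfold\<close>)
  \<comment> \<open>This order of integration lets the fundamental theorem of calculus act in
    \<open>t\<close> for fixed \<open>z\<close>.\<close>
  also have "\<dots> = integral (cube 1) (\<lambda>z. integral (cbox 0 1) (\<lambda>t. ?G t z))"
    unfolding cube_def by (rule integral_swap_continuous) (use cont in \<open>simp add: case_prod_unfold\<close>)
  also have "\<dots> = integral (cube 1) (\<lambda>z. bump z * f x - bump z * f (x - z))"
    using ftc by (simp add: right_diff_distrib)
  also have "\<dots> = integral (cube 1) (\<lambda>z. bump z * f x) - integral (cube 1) (\<lambda>z. bump z * f (x - z))"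
    by (intro integral_diff integrable_on_cube continuous_intros continuous_kernels
        continuous_on_compose2[OF cf]) auto
  also have "\<dots> = bump_mass * f x - bump_avg f x"
    by (simp add: bump_avg_eq[OF cf] bump_mass_def)
  finally show ?thesis .
qed

text \<open>For \<open>t \<noteq> 0\<close>, integration by parts in \<open>z\<close> turns both
  inner integrals into \<open>1 / t\<close> times the integral of \<open>f\<close> against a
  derivative of the kernel, and these derivatives agree by symmetry. The point \<open>t = 0\<close>
  is negligible.\<close>

lemma riesz_commute:
  assumes "C_class 1 f"
  shows "riesz i (\<D> l f) x = riesz l (\<D> i f) x"
proof -
  have cd: "\<And>i. continuous_on UNIV (\<D> i f)"
    using assms by auto
  have *: "integral (cube 1) (\<lambda>z. riesz_kernel i z * \<D> l f (x - t *\<^sub>R z))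
     = integral (cube 1) (\<lambda>z. riesz_kernel l z * \<D> i f (x - t *\<^sub>R z))" if "t \<noteq> 0" for t
  proof -
    have "\<D> l (riesz_kernel i) = \<D> i (riesz_kernel l)"
      by (auto simp: partial_deriv_riesz_kernel mult_ac)
    then have "t * integral (cube 1) (\<lambda>z. riesz_kernel i z * \<D> l f (x - t *\<^sub>R z))
       = t * integral (cube 1) (\<lambda>z. riesz_kernel l z * \<D> i f (x - t *\<^sub>R z))"
      using kernel_integration_by_parts[OF C_class_riesz_kernel riesz_kernel_outside assms, of t]
      by metis
    then show ?thesis using that by simp
  qed
  have "negligible {0::real}" by simp
  then show ?thesis
    unfolding riesz_def avg_Fubini[OF avg_weight_riesz cd]
    by (rule integral_spike) (use * in auto)
qed

text \<open>The factor of \<open>avg_L2_bound\<close> for weights bounded by 5.\<close>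

definition avg_const :: real where "avg_const = (5 * measure lborel tz_box)\<^sup>2"

lemma riesz_L2: "cont_supp f \<Longrightarrow>
    integral UNIV (\<lambda>x. (riesz i f x)\<^sup>2) \<le> avg_const * integral UNIV (\<lambda>x. (f x)\<^sup>2)"
  unfolding avg_const_def riesz_def
  by (rule avg_L2_bound[OF avg_weight_riesz]) (auto simp: kernel_bounds)

lemma bump_avg_L2: "cont_supp f \<Longrightarrow>
    integral UNIV (\<lambda>x. (bump_avg f x)\<^sup>2) \<le> avg_const * integral UNIV (\<lambda>x. (f x)\<^sup>2)"
  unfolding avg_const_def bump_avg_def
  by (rule avg_L2_bound[OF avg_weight_bump]) (auto simp: kernel_bounds)

lemma partial_bump_avg_L2: "C_class 1 f \<Longrightarrow> cont_supp f \<Longrightarrow>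
    integral UNIV (\<lambda>x. (\<D> l (bump_avg f) x)\<^sup>2) \<le> avg_const * integral UNIV (\<lambda>x. (f x)\<^sup>2)"
  unfolding avg_const_def partial_deriv_bump_avg
  by (rule avg_L2_bound[OF avg_weight_partial_bump]) (auto simp: kernel_bounds)

lemma continuous_inverse_max: "0 < d \<Longrightarrow> continuous_on A (\<lambda>t::real. 1 / max t d)"
  by (intro continuous_intros) auto

lemma avg_weight_far:
  "0 < d \<Longrightarrow> avg_weight (\<lambda>t z. 1 / max t d * \<D> l (riesz_kernel i) z) (\<lambda>t. t)"
  by (rule avg_weightI) (auto simp: continuous_kernels intro!: continuous_inverse_max)

text \<open>Away from the support of \<open>f\<close> only \<open>t \<ge> d\<close> contributes, so the singular factor \<open>1 / t\<close>
  may be truncated.\<close>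

lemma partial_deriv_riesz_far:
  assumes f: "C_class 1 f" and d: "0 < d"
    and far: "\<And>t z. 0 \<le> t \<Longrightarrow> t < d \<Longrightarrow> z \<in> cube 1 \<Longrightarrow> \<D> l f (x - t *\<^sub>R z) = 0"
  shows "\<D> l (riesz i f) x =
    avg (\<lambda>t z. 1 / max t d * \<D> l (riesz_kernel i) z) (\<lambda>t. t) f x"
proof -
  have "avg (\<lambda>t z. 1 / max t d * t * riesz_kernel i z) (\<lambda>t. t) (\<D> l f) x =
    avg (\<lambda>t z. 1 / max t d * \<D> l (riesz_kernel i) z) (\<lambda>t. t) f x"
    by (rule avg_integration_by_parts[OF C_class_riesz_kernel riesz_kernel_outside f])
      (auto intro!: continuous_inverse_max d)
  moreover have "avg (\<lambda>t z. 1 / max t d * t * riesz_kernel i z) (\<lambda>t. t) (\<D> l f) x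
     = avg (\<lambda>t. riesz_kernel i) (\<lambda>t. t) (\<D> l f) x"
    unfolding avg_def
  proof (rule integral_cong)
    fix p assume p: "p \<in> tz_box"
    obtain t z where tz: "p = (t, z)" by fastforce
    have "1 / max t d * t = 1" if "d \<le> t" using that d by simp
    then have "1 / max t d * t * riesz_kernel i z * \<D> l f (x - t *\<^sub>R z) =
       riesz_kernel i z * \<D> l f (x - t *\<^sub>R z)"
      using far[of t z] p unfolding tz mem_tz_box by (cases "d \<le> t") auto
    then show "(case p of (t, z) \<Rightarrow> 1 / max t d * t * riesz_kernel i z * \<D> l f (x - t *\<^sub>R z)) =
       (case p of (t, z) \<Rightarrow> riesz_kernel i z * \<D> l f (x - t *\<^sub>R z))"
      by (simp add: tz)
  qed
  ultimately have "riesz i (\<D> l f) x =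
      avg (\<lambda>t z. 1 / max t d * \<D> l (riesz_kernel i) z) (\<lambda>t. t) f x"
    unfolding riesz_def by simp
  then show ?thesis by (simp only: partial_deriv_riesz[OF f])
qed

text \<open>The truncated weight is at most \<open>5 / d\<close>, which costs
  \<open>1 / d\<^sup>2\<close> in squared norms.\<close>

lemma far_L2:
  assumes "cont_supp f" "0 < d"
  shows "integral UNIV (\<lambda>x. (avg (\<lambda>t z. 1 / max t d * \<D> l (riesz_kernel i) z) (\<lambda>t. t) f x)\<^sup>2)
     \<le> avg_const / d\<^sup>2 * integral UNIV (\<lambda>x. (f x)\<^sup>2)"
proof -
  have "integral UNIV (\<lambda>x. (avg (\<lambda>t z. 1 / max t d * \<D> l (riesz_kernel i) z) (\<lambda>t. t) f x)\<^sup>2)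
     \<le> (5 / d * measure lborel tz_box)\<^sup>2 * integral UNIV (\<lambda>x. (f x)\<^sup>2)"
  proof (rule avg_L2_bound[OF avg_weight_far[OF assms(2)] assms(1)])
    fix t :: real and z assume "t \<in> {0..1}" "z \<in> cube 1"
    then have "\<bar>1 / max t d\<bar> \<le> 1 / d" "\<bar>\<D> l (riesz_kernel i) z\<bar> \<le> 5"
      using assms(2) by (auto simp: kernel_bounds frac_le)
    then have "\<bar>1 / max t d\<bar> * \<bar>\<D> l (riesz_kernel i) z\<bar> \<le> (1 / d) * 5"
      using assms(2) by (intro mult_mono) auto
    then show "\<bar>1 / max t d * \<D> l (riesz_kernel i) z\<bar> \<le> 5 / d"
      by (simp only: abs_mult)
  qed
  then show ?thesis by (simp add: avg_const_def power_divide power_mult_distrib)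
qed

lemma square_diff_le: "(a - b)\<^sup>2 \<le> 2 * a\<^sup>2 + 2 * b\<^sup>2" for a b :: real
  using sum_squares_ge_zero[of "a + b" 0] by (simp add: power2_eq_square algebra_simps)

text \<open>The fields \<open>riesz i f\<close> form a gradient, so two integrations by parts reduce the full
  matrix of derivatives to its trace.\<close>

lemma partial_deriv_riesz_L2:
  assumes f: "C_class 2 f" "cont_supp f"
  shows "integral UNIV (\<lambda>x. (\<D> l (riesz i f) x)\<^sup>2)
    \<le> (2 * bump_mass\<^sup>2 + 2 * avg_const) * integral UNIV (\<lambda>x. (f x)\<^sup>2)"
proof -
  let ?W = "\<lambda>i. riesz i f"
  have f1: "C_class 1 f" using C_class_mono[OF f(1), of 1] by simp
  have W2: "C_class 2 (?W i)" for i by (rule C_class_riesz[OF f(1)])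
  have W1: "C_class 1 (?W i)" and dW1: "C_class 1 (\<D> l (?W i))" for i l
    using C_class_mono[OF W2, of 1] W2 by (auto simp: numeral_2_eq_2)
  have cW: "cont_supp (?W i)" for i by (rule cont_supp_riesz[OF f(2)])
  have cdW: "cont_supp (\<D> l (?W i))" for i l by (rule cont_supp_partial_deriv[OF W1 cW])
  have cdd: "cont_supp (\<lambda>x. \<D> l (?W i) x * \<D> k (?W j) x)" for l i k j
    by (intro cont_supp_multL cdW cont_supp_cont)
  have comm: "\<D> l (?W i) = \<D> i (?W l)" for i l
    unfolding partial_deriv_riesz[OF f1] using riesz_commute[OF f1] by auto
  have swap: "integral UNIV (\<lambda>x. (\<D> l (?W i) x)\<^sup>2)
     = integral UNIV (\<lambda>x. \<D> i (?W i) x * \<D> l (?W l) x)" for i l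
  proof -
    have "integral UNIV (\<lambda>x. (\<D> l (?W i) x)\<^sup>2)
       = integral UNIV (\<lambda>x. \<D> l (?W i) x * \<D> i (?W l) x)"
      using comm by (simp add: power2_eq_square)
    also have "\<dots> = - integral UNIV (\<lambda>x. ?W i x * \<D> l (\<D> i (?W l)) x)"
      using integration_by_parts[OF W1 dW1 cW] by simp
    also have "\<dots> = - integral UNIV (\<lambda>x. ?W i x * \<D> i (\<D> l (?W l)) x)"
      using partial_deriv_commute[OF W2] by presburger
    also have "\<dots> = integral UNIV (\<lambda>x. \<D> i (?W i) x * \<D> l (?W l) x)"
      using integration_by_parts[OF W1 dW1 cW] by simp
    finally show ?thesis .
  qed
  have int: "(\<lambda>x. (\<D> l (?W i) x)\<^sup>2) integrable_on UNIV" for i l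
    by (intro cont_supp_integrable cont_supp_power2 cdW)
  have nonneg: "0 \<le> integral UNIV (\<lambda>x. (\<D> l (?W i) x)\<^sup>2)" for i l
    by (intro integral_nonneg int) simp
  have "integral UNIV (\<lambda>x. (\<D> l (?W i) x)\<^sup>2)
      \<le> (\<Sum>i\<in>UNIV. \<Sum>l\<in>UNIV. integral UNIV (\<lambda>x. (\<D> l (?W i) x)\<^sup>2))"
    using nonneg
    by (intro order_trans[OF member_le_sum[of l UNIV "\<lambda>l. integral UNIV (\<lambda>x. (\<D> l (?W i) x)\<^sup>2)"]
      member_le_sum[of i UNIV "\<lambda>i. \<Sum>l\<in>UNIV. integral UNIV (\<lambda>x. (\<D> l (?W i) x)\<^sup>2)"]])
      (auto intro: sum_nonneg)
  also have "\<dots> = (\<Sum>i\<in>UNIV. \<Sum>l\<in>UNIV. integral UNIV (\<lambda>x. \<D> i (?W i) x * \<D> l (?W l) x))"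
    by (simp only: swap)
  also have "\<dots> = integral UNIV (\<lambda>x. \<Sum>i\<in>UNIV. \<Sum>l\<in>UNIV. \<D> i (?W i) x * \<D> l (?W l) x)"
    by (subst integral_sum, simp, intro cont_supp_integrable cont_supp_sum cdd, simp)
      (subst integral_sum, auto intro!: cont_supp_integrable cdd)
  \<comment> \<open>The double sum is the square of the divergence of \<open>?W\<close>, which
    \<open>riesz_divergence\<close> expresses through \<open>f\<close> without derivatives.\<close>
  also have "(\<lambda>x. \<Sum>i\<in>UNIV. \<Sum>l\<in>UNIV. \<D> i (?W i) x * \<D> l (?W l) x)
      = (\<lambda>x. (bump_mass * f x - bump_avg f x)\<^sup>2)"
    by (simp add: riesz_divergence[OF f1, symmetric] partial_deriv_riesz[OF f1] power2_eq_square sum_product)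
  also have "integral UNIV \<dots> \<le> integral UNIV (\<lambda>x. 2 * bump_mass\<^sup>2 * (f x)\<^sup>2 + 2 * (bump_avg f x)\<^sup>2)"
    using f cont_supp_bump_avg[OF f(2)]
    by (intro integral_le cont_supp_integrable cont_supp_add cont_supp_diff cont_supp_cmult cont_supp_power2)
      (auto intro: order_trans[OF square_diff_le] simp: power_mult_distrib)
  also have "\<dots> = 2 * bump_mass\<^sup>2 * integral UNIV (\<lambda>x. (f x)\<^sup>2) + 2 * integral UNIV (\<lambda>x. (bump_avg f x)\<^sup>2)"
    using f cont_supp_bump_avg[OF f(2)]
    by (subst integral_add) (auto intro!: cont_supp_integrable cont_supp_cmult cont_supp_power2)
  finally show ?thesis using bump_avg_L2[OF f(2)] by (simp add: algebra_simps)
qed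

section \<open>Cutoff functions and square-integrable bounds\<close>

definition bounded_C2 :: "real \<Rightarrow> real \<Rightarrow> (real^3 \<Rightarrow> real) \<Rightarrow> bool" where
  "bounded_C2 A B f \<longleftrightarrow> C_class 2 f \<and> (\<forall>x. 0 \<le> f x \<and> f x \<le> 1) \<and>
     (\<forall>i x. \<bar>\<D> i f x\<bar> \<le> A) \<and>
     (\<forall>i j x. \<bar>\<D> i (\<D> j f) x\<bar> \<le> B)"

lemma bounded_C2_mult:
  assumes f: "bounded_C2 A B f" and g: "bounded_C2 A B g"
  shows "bounded_C2 (2 * A) (2 * B + 2 * A\<^sup>2) (\<lambda>x. f x * g x)"
proof -
  have C2: "C_class 2 f" "C_class 2 g" using f g by (auto simp: bounded_C2_def)
  have df: "f differentiable (at x)" "g differentiable (at x)" 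
    "\<D> i f differentiable (at x)" "\<D> i g differentiable (at x)" for x i
    using C2 by (auto simp: numeral_2_eq_2)
  have b: "\<bar>f x\<bar> \<le> 1" "\<bar>g x\<bar> \<le> 1" "\<bar>\<D> i f x\<bar> \<le> A" "\<bar>\<D> i g x\<bar> \<le> A"
    "\<bar>\<D> i (\<D> j f) x\<bar> \<le> B" "\<bar>\<D> i (\<D> j g) x\<bar> \<le> B" for i j x
    using f g by (auto simp: bounded_C2_def abs_le_iff intro: order_trans[of _ 0])
  have m: "\<bar>a * b\<bar> \<le> c * d" if "\<bar>a\<bar> \<le> c" "\<bar>b\<bar> \<le> d" for a b c d :: real
    using mult_mono[OF that] that by (simp add: abs_mult)
  have d1: "\<D> i (\<lambda>x. f x * g x) = (\<lambda>x. \<D> i f x * g x + f x * \<D> i g x)" for i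
    using df by (auto simp: partial_deriv_mult)
  have d2: "\<D> i (\<D> j (\<lambda>x. f x * g x)) x =
      \<D> i (\<D> j f) x * g x + \<D> j f x * \<D> i g x +
      (\<D> i f x * \<D> j g x + f x * \<D> i (\<D> j g) x)" for i j x
    unfolding d1 using df by (subst partial_deriv_add) (auto simp: partial_deriv_mult)
  have "\<bar>\<D> i (\<lambda>x. f x * g x) x\<bar> \<le> 2 * A" for i x
    using m[OF b(3)[of i x] b(2)[of x]] m[OF b(1)[of x] b(4)[of i x]] unfolding d1 by linarith
  moreover have "\<bar>\<D> i (\<D> j (\<lambda>x. f x * g x)) x\<bar> \<le> 2 * B + 2 * A\<^sup>2" for i j x
    using m[OF b(5)[of i j x] b(2)[of x]] m[OF b(1)[of x] b(6)[of i j x]]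
      m[OF b(3)[of j x] b(4)[of i x]] m[OF b(3)[of i x] b(4)[of j x]]
    unfolding d2 power2_eq_square by linarith
  moreover have "0 \<le> f x * g x \<and> f x * g x \<le> 1" for x
    using f g by (auto simp: bounded_C2_def mult_le_one)
  ultimately show ?thesis using C_class_mult[OF C2] by (simp add: bounded_C2_def)
qed

text \<open>A piecewise polynomial transition from 1 on \<open>u \<le> 0\<close> to 0 on
  \<open>u \<ge> 1\<close>. Cubes of positive parts are C^2, the regularity demanded of the cutoffs.
  \<open>smooth_step1\<close> and \<open>smooth_step2\<close> are its first two derivatives.\<close>

definition smooth_step :: "real \<Rightarrow> real" where
  "smooth_step u = (max 0 (1 - (max 0 u) ^ 3)) ^ 3"

definition smooth_step1 :: "real \<Rightarrow> real" where
  "smooth_step1 u = - (3 * (max 0 (1 - (max 0 u) ^ 3))\<^sup>2 * (3 * (max 0 u)\<^sup>2))"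

definition smooth_step2 :: "real \<Rightarrow> real" where
  "smooth_step2 u = 6 * max 0 (1 - (max 0 u) ^ 3) * (3 * (max 0 u)\<^sup>2)\<^sup>2
     - 3 * (max 0 (1 - (max 0 u) ^ 3))\<^sup>2 * (6 * max 0 u)"

lemma DERIV_max_0_power3:
  "((\<lambda>u::real. (max 0 u) ^ 3) has_field_derivative 3 * (max 0 u)\<^sup>2) (at u)"
proof -
  have "(\<lambda>u::real. (max 0 u) ^ 3) = (\<lambda>u. u * (max 0 u)\<^sup>2)"
    by (auto simp: max_def power3_eq_cube power2_eq_square)
  moreover have "((\<lambda>u. u * (max 0 u)\<^sup>2) has_field_derivative
      1 * (max 0 u)\<^sup>2 + 2 * max 0 u * u) (at u)"
    by (rule DERIV_mult[OF DERIV_ident DERIV_max_0_power2])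
  moreover have "1 * (max 0 u)\<^sup>2 + 2 * max 0 u * u = 3 * (max 0 u)\<^sup>2"
    by (auto simp: max_def power2_eq_square)
  ultimately show ?thesis by metis
qed

lemma DERIV_smooth_step:
  "(smooth_step has_field_derivative smooth_step1 u) (at u)"
  "(smooth_step1 has_field_derivative smooth_step2 u) (at u)"
proof -
  have in1: "((\<lambda>u::real. 1 - (max 0 u) ^ 3) has_field_derivative 0 - 3 * (max 0 u)\<^sup>2) (at u)"
    by (rule DERIV_diff[OF DERIV_const DERIV_max_0_power3])
  have "((\<lambda>u. (max 0 (1 - (max 0 u) ^ 3)) ^ 3) has_field_derivative
     3 * (max 0 (1 - (max 0 u) ^ 3))\<^sup>2 * (0 - 3 * (max 0 u)\<^sup>2)) (at u)"
    by (rule DERIV_chain2[OF DERIV_max_0_power3 in1])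
  then show "(smooth_step has_field_derivative smooth_step1 u) (at u)"
    by (simp add: smooth_step_def[abs_def] smooth_step1_def)
  have "((\<lambda>u. (max 0 (1 - (max 0 u) ^ 3))\<^sup>2) has_field_derivative
     2 * max 0 (1 - (max 0 u) ^ 3) * (0 - 3 * (max 0 u)\<^sup>2)) (at u)"
    by (rule DERIV_chain2[OF DERIV_max_0_power2 in1])
  from DERIV_mult[OF this DERIV_max_0_power2]
  have "((\<lambda>u. -9 * ((max 0 (1 - (max 0 u) ^ 3))\<^sup>2 * (max 0 u)\<^sup>2)) has_field_derivative
     -9 * (2 * max 0 (1 - (max 0 u) ^ 3) * (0 - 3 * (max 0 u)\<^sup>2) * (max 0 u)\<^sup>2 +
      2 * max 0 u * (max 0 (1 - (max 0 u) ^ 3))\<^sup>2)) (at u)"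
    by (rule DERIV_cmult)
  moreover have "-9 * (2 * max 0 (1 - (max 0 u) ^ 3) * (0 - 3 * (max 0 u)\<^sup>2) * (max 0 u)\<^sup>2 +
      2 * max 0 u * (max 0 (1 - (max 0 u) ^ 3))\<^sup>2) = smooth_step2 u"
    by (simp add: smooth_step2_def power2_eq_square algebra_simps)
  moreover have "(\<lambda>u. -9 * ((max 0 (1 - (max 0 u) ^ 3))\<^sup>2 * (max 0 u)\<^sup>2)) = smooth_step1"
    by (auto simp: smooth_step1_def)
  ultimately show "(smooth_step1 has_field_derivative smooth_step2 u) (at u)" by metis
qed

lemma smooth_step_values:
  "u \<le> 0 \<Longrightarrow> smooth_step u = 1" "1 \<le> u \<Longrightarrow> smooth_step u = 0"
  "0 \<le> smooth_step u" "smooth_step u \<le> 1"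
proof -
  show "u \<le> 0 \<Longrightarrow> smooth_step u = 1" by (simp add: smooth_step_def)
  show "smooth_step u = 0" if "1 \<le> u"
  proof -
    have "1 \<le> (max 0 u) ^ 3" using that by (intro one_le_power) simp
    then show ?thesis by (simp add: smooth_step_def max_def)
  qed
qed (auto simp: smooth_step_def intro!: power_le_one)

text \<open>With \<open>a\<close> and \<open>b\<close> the outer positive parts, \<open>b\<close> is
  0 once \<open>a\<close> exceeds 1, so every monomial containing both lies in [0, 1]. The
  coefficients give 9 and 72 = 54 + 18.\<close>

lemma smooth_step_bounds: "\<bar>smooth_step1 u\<bar> \<le> 9" "\<bar>smooth_step2 u\<bar> \<le> 72"
proof -
  define a b where "a = max 0 u" and "b = max 0 (1 - (max 0 u) ^ 3)"
  have s: "smooth_step1 u = - (9 * (b\<^sup>2 * a\<^sup>2))" "smooth_step2 u = 54 * (b * a ^ 4) - 18 * (b\<^sup>2 * a)"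
    by (simp_all add: smooth_step1_def smooth_step2_def a_def b_def algebra_simps
        flip: power_mult)
  have ab: "0 \<le> a" "0 \<le> b" "b \<le> 1" by (auto simp: a_def b_def)
  have "a \<le> 1 \<or> b = 0"
  proof (cases "u \<le> 1")
    case False
    then have "1 \<le> (max 0 u) ^ 3" by (intro one_le_power) simp
    then show ?thesis by (simp add: b_def)
  qed (auto simp: a_def)
  then have "0 \<le> b\<^sup>2 * a\<^sup>2 \<and> b\<^sup>2 * a\<^sup>2 \<le> 1 \<and> 0 \<le> b * a ^ 4 \<and> b * a ^ 4 \<le> 1
     \<and> 0 \<le> b\<^sup>2 * a \<and> b\<^sup>2 * a \<le> 1"
  proof
    assume "a \<le> 1"
    then show ?thesis using ab by (intro conjI mult_le_one power_le_one mult_nonneg_nonneg) auto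
  next
    assume "b = 0"
    then show ?thesis by simp
  qed
  then show "\<bar>smooth_step1 u\<bar> \<le> 9" "\<bar>smooth_step2 u\<bar> \<le> 72"
    unfolding s by linarith+
qed

text \<open>The sign \<open>e\<close> selects one of the two faces orthogonal to the i-th axis; the
  step falls from 1 to 0 across a layer of width \<open>d\<close>.\<close>

lemma bounded_C2_step:
  fixes d :: real
  assumes d: "0 < d" and e: "e = 1 \<or> e = -1"
  shows "bounded_C2 (9 / d) (72 / d\<^sup>2) (\<lambda>x. smooth_step ((e * x $ i - r) / d))"
proof -
  define k where "k = e / d"
  have k: "\<bar>k\<bar> = 1 / d" "k\<^sup>2 = 1 / d\<^sup>2" using d e by (auto simp: k_def power_divide)
  have lin: "((\<lambda>s. (e * s - r) / d) has_field_derivative k) (at s)" for s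
    using d by (auto intro!: derivative_eq_intros simp: k_def)
  let ?c = "\<lambda>s. smooth_step ((e * s - r) / d)"
  let ?c1 = "\<lambda>s. smooth_step1 ((e * s - r) / d) * k"
  let ?c2 = "\<lambda>s. smooth_step2 ((e * s - r) / d) * k * k"
  have D1: "(?c has_field_derivative ?c1 s) (at s)" for s
    by (rule DERIV_chain2[OF DERIV_smooth_step(1) lin])
  have D2: "(?c1 has_field_derivative ?c2 s) (at s)" for s
    by (rule DERIV_cmult_right[OF DERIV_chain2[OF DERIV_smooth_step(2) lin]])
  have "continuous_on UNIV ?c2"
    unfolding smooth_step2_def using d by (intro continuous_intros) auto
  note c = C_class_coord[OF D1 D2 this, where i=i]
  have pd: "\<D> j (\<lambda>x. ?c (x $ i)) = (\<lambda>x. if j = i then ?c1 (x $ i) else 0)" for j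
    using c(2) by blast
  have pd2: "\<D> l (\<lambda>x. if j = i then ?c1 (x $ i) else 0) x =
      (if j = i \<and> l = i then ?c2 (x $ i) else 0)" for l j x
    using c(3)[of l x] by (cases "j = i") auto
  have "\<bar>?c1 s\<bar> \<le> 9 / d" for s
    using smooth_step_bounds(1)[of "(e * s - r) / d"] d
    by (simp add: abs_mult k divide_right_mono)
  moreover have "\<bar>?c2 s\<bar> \<le> 72 / d\<^sup>2" for s
    using smooth_step_bounds(2)[of "(e * s - r) / d"] d
    by (simp add: abs_mult k mult.assoc flip: power2_eq_square) (simp add: divide_right_mono)
  ultimately show ?thesis
    unfolding bounded_C2_def using c(1) smooth_step_values(3,4) d
    by (auto simp: pd pd2)
qed

text \<open>One constant for all radii and all widths, so that the dependence on the width
  \<open>d\<close> is explicit; the iteration over nested cubes needs exactly this.\<close>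

definition cutoff_bound :: "real \<Rightarrow> bool" where
  "cutoff_bound K \<longleftrightarrow> 1 \<le> K \<and> (\<forall>r d. 0 < d \<longrightarrow> (\<exists>\<eta>. bounded_C2 (K / d) (K / d\<^sup>2) \<eta> \<and>
     (\<forall>x\<in>cube r. \<eta> x = 1) \<and> (\<forall>x. x \<notin> cube (r + d) \<longrightarrow> \<eta> x = 0)))"

lemma cutoff_boundE:
  assumes "cutoff_bound K" "0 < d"
  obtains \<eta> where "bounded_C2 (K / d) (K / d\<^sup>2) \<eta>" "\<And>x. x \<in> cube r \<Longrightarrow> \<eta> x = 1"
    "\<And>x. x \<notin> cube (r + d) \<Longrightarrow> \<eta> x = 0"
  using assms unfolding cutoff_bound_def by metis

text \<open>The cutoff is a product of six one-sided steps.\<close>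

lemma cutoff_bound_exists: "cutoff_bound (10 ^ 6)"
  unfolding cutoff_bound_def
proof (intro conjI allI impI)
  show "(1::real) \<le> 10 ^ 6" by simp
  fix r d :: real assume d: "0 < d"
  have mono: "bounded_C2 A' B' f" if "bounded_C2 A B f" "A \<le> A'" "B \<le> B'" for A B A' B' f
    using that unfolding bounded_C2_def by (meson order_trans)
  define p where "p i = (\<lambda>x::real^3. smooth_step ((1 * x $ i - r) / d) * smooth_step ((- 1 * x $ i - r) / d))" for i
  \<comment> \<open>Three doublings by \<open>bounded_C2_mult\<close>: 306 = 2 * 72 + 2 * 81, 1260 =
    2 * 306 + 2 * 324, 5112 = 2 * 1260 + 2 * 1296. The bounds of \<open>p 3\<close> are relaxed
    because that lemma takes equal bounds for both factors; the final constant is a round number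
    above all of these.\<close>
  have p: "bounded_C2 (18 / d) (306 / d\<^sup>2) (p i)" for i
    using bounded_C2_mult[OF bounded_C2_step[OF d, of 1 i r] bounded_C2_step[OF d, of "-1" i r]]
    unfolding p_def by (simp add: power_divide) 
  have "bounded_C2 (36 / d) (1260 / d\<^sup>2) (\<lambda>x. p 1 x * p 2 x)"
    using bounded_C2_mult[OF p p, of 1 2] by (simp add: power_divide)
  moreover have "bounded_C2 (36 / d) (1260 / d\<^sup>2) (p 3)"
    by (rule mono[OF p]) (use d in \<open>auto simp: divide_right_mono\<close>)
  ultimately have "bounded_C2 (72 / d) (5112 / d\<^sup>2) (\<lambda>x. p 1 x * p 2 x * p 3 x)"
    using bounded_C2_mult[of "36 / d" "1260 / d\<^sup>2"] by (fastforce simp: power_divide)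
  then have "bounded_C2 (10 ^ 6 / d) (10 ^ 6 / d\<^sup>2) (\<lambda>x. p 1 x * p 2 x * p 3 x)"
    by (rule mono) (use d in \<open>auto simp: divide_right_mono\<close>)
  moreover have "p 1 x * p 2 x * p 3 x = 1" if "x \<in> cube r" for x
  proof -
    have "p i x = 1" for i
    proof -
      have "\<bar>x $ i\<bar> \<le> r" using that by (simp add: mem_cube)
      then show ?thesis using d by (simp add: p_def smooth_step_values(1) divide_nonpos_pos)
    qed
    then show ?thesis by simp
  qed
  moreover have "p 1 x * p 2 x * p 3 x = 0" if x: "x \<notin> cube (r + d)" for x
  proof -
    obtain i where i: "r + d < \<bar>x $ i\<bar>" using x by (auto simp: mem_cube not_le)
    have "1 \<le> (1 * x $ i - r) / d \<or> 1 \<le> (- 1 * x $ i - r) / d"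
      using i d by (auto simp: field_simps abs_if split: if_splits)
    then have "p i x = 0" using smooth_step_values(2) by (auto simp: p_def)
    then show ?thesis using exhaust_3[of i] by auto
  qed
  ultimately show "\<exists>\<eta>. bounded_C2 (10 ^ 6 / d) (10 ^ 6 / d\<^sup>2) \<eta> \<and>
        (\<forall>x\<in>cube r. \<eta> x = 1) \<and> (\<forall>x. x \<notin> cube (r + d) \<longrightarrow> \<eta> x = 0)" by blast
qed

section \<open>Cauchy-Schwarz inequalities and bounds for integrals of squares\<close>

lemma Cauchy_Schwarz_set_integral:
  fixes f g :: "'a::euclidean_space \<Rightarrow> real"
  assumes int: "(\<lambda>x. (f x)\<^sup>2) integrable_on S" "(\<lambda>x. (g x)\<^sup>2) integrable_on S" "(\<lambda>x. f x * g x) integrable_on S"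
  shows "\<bar>integral S (\<lambda>x. f x * g x)\<bar> \<le> sqrt (integral S (\<lambda>x. (f x)\<^sup>2)) * sqrt (integral S (\<lambda>x. (g x)\<^sup>2))"
proof -
  let ?a = "integral S (\<lambda>x. (f x)\<^sup>2)" and ?b = "integral S (\<lambda>x. f x * g x)"
    and ?c = "integral S (\<lambda>x. (g x)\<^sup>2)"
  \<comment> \<open>The form is the integral of the square of
    \<open>s * f x + t * g x\<close>.\<close>
  have q: "0 \<le> ?a * s\<^sup>2 + 2 * s * t * ?b + t\<^sup>2 * ?c" for s t :: real
  proof -
    have "((\<lambda>x. s\<^sup>2 * (f x)\<^sup>2 + (2 * s * t) * (f x * g x) + t\<^sup>2 * (g x)\<^sup>2) has_integral
       s\<^sup>2 * ?a + (2 * s * t) * ?b + t\<^sup>2 * ?c) S"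
      by (intro has_integral_add has_integral_mult_right integrable_integral int)
    moreover have "0 \<le> s\<^sup>2 * (f x)\<^sup>2 + (2 * s * t) * (f x * g x) + t\<^sup>2 * (g x)\<^sup>2" for x
    proof -
      have "s\<^sup>2 * (f x)\<^sup>2 + (2 * s * t) * (f x * g x) + t\<^sup>2 * (g x)\<^sup>2 = (s * f x + t * g x)\<^sup>2"
        by (simp add: power2_eq_square algebra_simps)
      then show ?thesis by simp
    qed
    ultimately have "0 \<le> s\<^sup>2 * ?a + (2 * s * t) * ?b + t\<^sup>2 * ?c"
      by (rule has_integral_nonneg)
    then show ?thesis by (simp add: mult_ac)
  qed
  have pos: "?a \<ge> 0" "?c \<ge> 0" using int by (auto intro: integral_nonneg)
  have "?b\<^sup>2 \<le> ?a * ?c"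
  proof (cases "?c = 0")
    case True
    have "?b = 0"
    proof (rule ccontr)
      assume b: "?b \<noteq> 0"
      \<comment> \<open>With \<open>?c = 0\<close> the form is affine in \<open>t\<close>; this
        choice makes it equal to \<open>- ?a - 2\<close>, which is negative.\<close>
      have "2 * 1 * (- (?a + 1) / ?b) * ?b = - 2 * (?a + 1)" using b by simp
      then show False using q[of 1 "- (?a + 1) / ?b"] True pos by simp
    qed
    then show ?thesis using pos by simp
  next
    case False
    then have "?c > 0" using pos by simp
    \<comment> \<open>Up to scaling, this is the choice of \<open>s\<close> and \<open>t\<close>
      that minimises the form in \<open>t\<close>.\<close>
    moreover have "0 \<le> ?c * (?a * ?c - ?b\<^sup>2)"
      using q[of "?c" "- ?b"] by (simp add: power2_eq_square algebra_simps)
    ultimately show ?thesis by (simp add: zero_le_mult_iff)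
  qed
  then have "sqrt (?b\<^sup>2) \<le> sqrt (?a * ?c)" by (rule real_sqrt_le_mono)
  then show ?thesis by (simp add: real_sqrt_mult)
qed

text \<open>Compact support belongs to \<open>h\<close>; the factor \<open>e\<close> is measured on
  the cube carrying \<open>h\<close>, which keeps the energy estimates local.\<close>

lemma Cauchy_Schwarz_cube:
  assumes e: "continuous_on UNIV e" and h: "cont_supp h" "\<And>x. x \<notin> cube r \<Longrightarrow> h x = 0"
  shows "\<bar>integral UNIV (\<lambda>x. e x * h x)\<bar>
    \<le> sqrt (integral (cube r) (\<lambda>x. (e x)\<^sup>2)) * sqrt (integral UNIV (\<lambda>x. (h x)\<^sup>2))"
proof -
  have ch: "continuous_on UNIV h" using h(1) by (rule cont_supp_cont)
  have 1: "integral UNIV (\<lambda>x. e x * h x) = integral (cube r) (\<lambda>x. e x * h x)"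
    using h(2) by (intro integral_UNIV_cube continuous_intros e ch) auto
  have 2: "integral UNIV (\<lambda>x. (h x)\<^sup>2) = integral (cube r) (\<lambda>x. (h x)\<^sup>2)"
    using h(2) by (intro integral_UNIV_cube continuous_intros ch) auto
  show ?thesis unfolding 1 2
    by (intro Cauchy_Schwarz_set_integral integrable_on_cube continuous_intros e ch)
qed

lemma integral_UNIV_le_cube:
  assumes "cont_supp h" "\<And>x. x \<notin> cube r \<Longrightarrow> h x = 0" "continuous_on UNIV e"
    "\<And>x. x \<in> cube r \<Longrightarrow> h x \<le> e x"
  shows "integral UNIV h \<le> integral (cube r) e"
proof -
  have "integral UNIV h = integral (cube r) h"
    using assms(1,2) by (intro integral_UNIV_cube cont_supp_cont)
  also have "\<dots> \<le> integral (cube r) e"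
    using assms cont_supp_cont[OF assms(1)] by (intro integral_le integrable_on_cube) auto
  finally show ?thesis .
qed

text \<open>\<open>A\<close> bounds the square of the norm, hence the factors 2 in the rules for
  sums and differences.\<close>

definition L2_le :: "real \<Rightarrow> (real^3 \<Rightarrow> real) \<Rightarrow> bool" where
  "L2_le A h \<longleftrightarrow> cont_supp h \<and> integral UNIV (\<lambda>x. (h x)\<^sup>2) \<le> A"

lemma L2_le_mono: "L2_le A h \<Longrightarrow> A \<le> B \<Longrightarrow> L2_le B h"
  by (auto simp: L2_le_def)

lemma L2_le_trans:
  assumes "cont_supp g" "integral UNIV (\<lambda>x. (g x)\<^sup>2) \<le> c * integral UNIV (\<lambda>x. (f x)\<^sup>2)" "0 \<le> c" "L2_le A f"
  shows "L2_le (c * A) g"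
  using assms mult_left_mono[of "integral UNIV (\<lambda>x. (f x)\<^sup>2)" A c] by (simp add: L2_le_def)

lemma L2_le_add:
  assumes "L2_le A f" "L2_le B g" shows "L2_le (2 * A + 2 * B) (\<lambda>x. f x + g x)"
proof -
  have c: "cont_supp f" "cont_supp g" using assms by (auto simp: L2_le_def)
  have "integral UNIV (\<lambda>x. (f x + g x)\<^sup>2) \<le> integral UNIV (\<lambda>x. 2 * (f x)\<^sup>2 + 2 * (g x)\<^sup>2)"
    using c square_diff_le[of _ "- _"]
    by (intro integral_le cont_supp_integrable cont_supp_add cont_supp_cmult cont_supp_power2) fastforce+
  also have "\<dots> = 2 * integral UNIV (\<lambda>x. (f x)\<^sup>2) + 2 * integral UNIV (\<lambda>x. (g x)\<^sup>2)"
    using c by (subst integral_add) (auto intro!: cont_supp_integrable cont_supp_cmult cont_supp_power2)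
  finally show ?thesis using assms cont_supp_add[OF c] by (auto simp: L2_le_def)
qed

lemma L2_le_mult:
  assumes "L2_le A f" "continuous_on UNIV c" "\<And>x. \<bar>c x\<bar> \<le> k"
  shows "L2_le (k\<^sup>2 * A) (\<lambda>x. c x * f x)"
proof -
  have f: "cont_supp f" using assms by (auto simp: L2_le_def)
  have cf: "cont_supp (\<lambda>x. c x * f x)" using assms(2) f by (rule cont_supp_multL)
  have "integral UNIV (\<lambda>x. (c x * f x)\<^sup>2) \<le> integral UNIV (\<lambda>x. k\<^sup>2 * (f x)\<^sup>2)"
  proof (intro integral_le cont_supp_integrable cont_supp_cmult cont_supp_power2 f cf)
    fix x
    have "(c x)\<^sup>2 \<le> k\<^sup>2" using power_mono[OF assms(3)[of x], of 2] by simp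
    then show "(c x * f x)\<^sup>2 \<le> k\<^sup>2 * (f x)\<^sup>2" by (simp add: power_mult_distrib mult_right_mono)
  qed
  also have "\<dots> \<le> k\<^sup>2 * A" using assms(1) by (simp add: L2_le_def mult_left_mono)
  finally show ?thesis using cf by (simp add: L2_le_def)
qed

lemma L2_le_diff:
  assumes "L2_le A f" "L2_le B g" shows "L2_le (2 * A + 2 * B) (\<lambda>x. f x - g x)"
proof -
  have "L2_le B (\<lambda>x. (-1) * g x)" using L2_le_mult[OF assms(2), of "\<lambda>x. -1" 1] by simp
  from L2_le_add[OF assms(1) this] show ?thesis by simp
qed

text \<open>10 = 2 * (2 + 2) + 2, from two applications of \<open>L2_le_add\<close>.\<close>

lemma L2_le_sum3:
  fixes f :: "3 \<Rightarrow> real^3 \<Rightarrow> real"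
  assumes "\<And>i. L2_le A (f i)" shows "L2_le (10 * A) (\<lambda>x. \<Sum>i\<in>UNIV. f i x)"
  using L2_le_add[OF L2_le_add[OF assms assms, of 1 2] assms, of 3]
  by (simp add: sum_3)

section \<open>Weak form of the equations\<close>

definition grad_energy :: "(3 \<Rightarrow> real^3 \<Rightarrow> real) \<Rightarrow> real \<Rightarrow> real" where
  "grad_energy v r = (\<Sum>l\<in>UNIV. \<Sum>j\<in>UNIV. integral (cube r) (\<lambda>x. (\<D> l (v j) x)\<^sup>2))"

text \<open>Powers are taken without absolute values; the orders that occur are 2, 4 and 6.\<close>

definition moment :: "nat \<Rightarrow> (3 \<Rightarrow> real^3 \<Rightarrow> real) \<Rightarrow> real \<Rightarrow> real" where
  "moment n v r = (\<Sum>j\<in>UNIV. integral (cube r) (\<lambda>x. (v j x) ^ n))"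

text \<open>The velocity is a family of scalar components. The kinematic estimates are kept apart
  from the momentum equation, which enters with \<open>steady_flow\<close>.\<close>

locale divergence_free =
  fixes v :: "3 \<Rightarrow> real^3 \<Rightarrow> real"
  assumes v_C2: "\<And>j. C_class 2 (v j)"
    and divergence_0: "\<And>x. (\<Sum>j\<in>UNIV. \<D> j (v j) x) = 0"

locale steady_flow = divergence_free +
  fixes P :: "real^3 \<Rightarrow> real"
  assumes P_C1: "C_class 1 P"
    and momentum: "\<And>j x. - (\<Sum>l\<in>UNIV. \<D> l (\<D> l (v j)) x)
        + (\<Sum>l\<in>UNIV. v l x * \<D> l (v j) x) + \<D> j P x = 0"

lemma C_class_2D:
  assumes "C_class 2 f"
  shows "C_class 1 f" "C_class 1 (\<D> i f)" "continuous_on A f"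
    "continuous_on A (\<D> i f)" "continuous_on A (\<D> j (\<D> i f))"
proof -
  show 1: "C_class 1 f" using C_class_mono[OF assms, of 1] by simp
  show 2: "C_class 1 (\<D> i f)" using assms by (simp add: numeral_2_eq_2)
  show "continuous_on A f" "continuous_on A (\<D> i f)"
    by (rule C_class_continuous[OF 1], rule C_class_continuous[OF 2])
  have "C_class 0 (\<D> j (\<D> i f))" using 2 by simp
  then show "continuous_on A (\<D> j (\<D> i f))" by (rule C_class_continuous)
qed

lemma C_class_1D:
  assumes "C_class 1 f"
  shows "f differentiable (at x)" "continuous_on A f" "continuous_on A (\<D> i f)"
  using assms C_class_continuous[OF assms] C_class_continuous[of 0 "\<D> i f"] by auto

lemma cont_supp_integral_add:
  "cont_supp f \<Longrightarrow> cont_supp g \<Longrightarrow>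
    integral UNIV (\<lambda>x. f x + g x) = integral UNIV f + integral UNIV g"
  by (intro integral_add cont_supp_integrable)

lemma cont_supp_integral_sum:
  "finite I \<Longrightarrow> (\<And>i. i \<in> I \<Longrightarrow> cont_supp (f i)) \<Longrightarrow>
    integral UNIV (\<lambda>x. \<Sum>i\<in>I. f i x) = (\<Sum>i\<in>I. integral UNIV (f i))"
  by (intro integral_sum cont_supp_integrable)

context divergence_free
begin

lemmas v_cont = C_class_2D(3)[OF v_C2] C_class_2D(4)[OF v_C2] C_class_2D(5)[OF v_C2]

text \<open>Each derivative is moved off \<open>w\<close>; the terms in which it falls on
  \<open>v l\<close> add up to the divergence of \<open>v\<close> times \<open>w * \<phi>\<close>
  and vanish.\<close>

lemma transport_antisymmetric:
  assumes \<phi>: "C_class 1 \<phi>" "cont_supp \<phi>" and w: "C_class 1 w"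
  shows "(\<Sum>l\<in>UNIV. integral UNIV (\<lambda>x. v l x * \<D> l w x * \<phi> x))
     = - (\<Sum>l\<in>UNIV. integral UNIV (\<lambda>x. v l x * w x * \<D> l \<phi> x))"
proof -
  note c = C_class_1D(2)[OF w] C_class_1D(3)[OF w] v_cont C_class_1D(2)[OF \<phi>(1)]
  have d\<phi>: "cont_supp (\<D> l \<phi>)" for l by (rule cont_supp_partial_deriv[OF \<phi>])
  have c1: "cont_supp (\<lambda>x. (\<D> l (v l) x * w x) * \<phi> x)" for l
    by (intro cont_supp_multL continuous_intros c \<phi>)
  have c2: "cont_supp (\<lambda>x. (v l x * w x) * \<D> l \<phi> x)" for l
    by (intro cont_supp_multL continuous_intros c d\<phi>)
  have "integral UNIV (\<lambda>x. v l x * \<D> l w x * \<phi> x)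
     = - integral UNIV (\<lambda>x. (\<D> l (v l) x * w x) * \<phi> x)
       - integral UNIV (\<lambda>x. (v l x * w x) * \<D> l \<phi> x)" for l
  proof -
    have "integral UNIV (\<lambda>x. (v l x * \<phi> x) * \<D> l w x) =
       - integral UNIV (\<lambda>x. \<D> l (\<lambda>x. v l x * \<phi> x) x * w x)"
      by (intro integration_by_parts C_class_mult C_class_2D(1)[OF v_C2] \<phi> w cont_supp_multL c)
    also have "(\<lambda>x. \<D> l (\<lambda>x. v l x * \<phi> x) x * w x)
       = (\<lambda>x. (\<D> l (v l) x * w x) * \<phi> x + (v l x * w x) * \<D> l \<phi> x)"
      using C_class_1D(1)[OF C_class_2D(1)[OF v_C2]] C_class_1D(1)[OF \<phi>(1)]
      by (simp add: partial_deriv_mult algebra_simps)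
    also have "integral UNIV \<dots> = integral UNIV (\<lambda>x. (\<D> l (v l) x * w x) * \<phi> x)
       + integral UNIV (\<lambda>x. (v l x * w x) * \<D> l \<phi> x)"
      by (rule cont_supp_integral_add[OF c1 c2])
    finally show ?thesis by (simp add: mult_ac)
  qed
  then have "(\<Sum>l\<in>UNIV. integral UNIV (\<lambda>x. v l x * \<D> l w x * \<phi> x))
     = - (\<Sum>l\<in>UNIV. integral UNIV (\<lambda>x. (\<D> l (v l) x * w x) * \<phi> x))
       - (\<Sum>l\<in>UNIV. integral UNIV (\<lambda>x. (v l x * w x) * \<D> l \<phi> x))"
    by (simp add: sum_negf sum_subtractf)
  also have "(\<Sum>l\<in>UNIV. integral UNIV (\<lambda>x. (\<D> l (v l) x * w x) * \<phi> x))
     = integral UNIV (\<lambda>x. \<Sum>l\<in>UNIV. (\<D> l (v l) x * w x) * \<phi> x)"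
    by (rule cont_supp_integral_sum[symmetric]) (auto intro: c1)
  also have "\<dots> = 0"
    by (simp add: sum_distrib_right[symmetric] divergence_0)
  finally show ?thesis by simp
qed

end

text \<open>One integration by parts puts \<open>\<D> j (\<D> i (G i j))\<close> against
  \<open>P\<close>. The derivatives commute and \<open>G\<close> is antisymmetric, so the double sum
  equals its own negative.\<close>

lemma pressure_orthogonal:
  assumes P: "C_class 1 P" and G: "\<And>i j. C_class 2 (G i j)" "\<And>i j. cont_supp (G i j)"
    and anti: "\<And>i j x. G j i x = - G i j x"
  shows "(\<Sum>j\<in>UNIV. integral UNIV (\<lambda>x. \<D> j P x * (\<Sum>i\<in>UNIV. \<D> i (G i j) x))) = 0"
proof -
  define a where "a i j = integral UNIV (\<lambda>x. \<D> j (\<D> i (G i j)) x * P x)" for i j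
  have cG: "cont_supp (\<D> i (G i j))" for i j
    by (rule cont_supp_partial_deriv[OF C_class_2D(1)[OF G(1)] G(2)])
  have "integral UNIV (\<lambda>x. \<D> j P x * (\<Sum>i\<in>UNIV. \<D> i (G i j) x)) = - (\<Sum>i\<in>UNIV. a i j)" for j
  proof -
    have "integral UNIV (\<lambda>x. \<D> j P x * (\<Sum>i\<in>UNIV. \<D> i (G i j) x))
       = integral UNIV (\<lambda>x. \<Sum>i\<in>UNIV. \<D> i (G i j) x * \<D> j P x)"
      by (simp add: sum_distrib_left mult_ac)
    also have "\<dots> = (\<Sum>i\<in>UNIV. integral UNIV (\<lambda>x. \<D> i (G i j) x * \<D> j P x))"
      by (intro cont_supp_integral_sum cont_supp_multR cG C_class_1D(3)[OF P]) auto
    also have "\<dots> = (\<Sum>i\<in>UNIV. - a i j)"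
      unfolding a_def
      by (intro sum.cong refl integration_by_parts C_class_2D(2)[OF G(1)] P cG)
    finally show ?thesis by (simp add: sum_negf)
  qed
  then have "(\<Sum>j\<in>UNIV. integral UNIV (\<lambda>x. \<D> j P x * (\<Sum>i\<in>UNIV. \<D> i (G i j) x)))
     = - (\<Sum>j\<in>UNIV. \<Sum>i\<in>UNIV. a i j)" by (simp add: sum_negf)
  moreover have anti_a: "a j i = - a i j" for i j
  proof -
    have Gji: "G j i = (\<lambda>x. (-1) * G i j x)" by (rule ext) (subst anti[of i j], simp)
    have "\<D> j (\<lambda>x. (-1) * G i j x) = (\<lambda>x. (-1) * \<D> j (G i j) x)"
      using C_class_1D(1)[OF C_class_2D(1)[OF G(1)[of i j]]] partial_deriv_cmult by blast
    moreover have "\<D> i (\<lambda>x. (-1) * \<D> j (G i j) x)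
        = (\<lambda>x. (-1) * \<D> i (\<D> j (G i j)) x)"
      using C_class_1D(1)[OF C_class_2D(2)[OF G(1)[of i j]]] partial_deriv_cmult by blast
    ultimately have "a j i = integral UNIV (\<lambda>x. - (\<D> j (\<D> i (G i j)) x * P x))"
      unfolding a_def Gji using partial_deriv_commute[OF G(1)[of i j], of i j] by simp
    then show ?thesis by (simp add: a_def)
  qed
  have "(\<Sum>j\<in>UNIV. \<Sum>i\<in>UNIV. a i j) = (\<Sum>j\<in>UNIV. \<Sum>i\<in>UNIV. - a j i)"
    by (intro sum.cong refl anti_a)
  then have "(\<Sum>j\<in>UNIV. \<Sum>i\<in>UNIV. a i j) = - (\<Sum>j\<in>UNIV. \<Sum>i\<in>UNIV. a j i)"
    by (simp only: sum_negf)
  moreover have "(\<Sum>j\<in>UNIV. \<Sum>i\<in>UNIV. a j i) = (\<Sum>j\<in>UNIV. \<Sum>i\<in>UNIV. a i j)"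
    by (rule sum.swap)
  ultimately show ?thesis by linarith
qed

context steady_flow
begin

text \<open>Solenoidality of the test field enters as the vanishing of its pairing with the pressure
  gradient. \<open>transport_antisymmetric\<close> puts the convective term into divergence
  form.\<close>

lemma weak_form:
  assumes \<phi>: "\<And>j. C_class 1 (\<phi> j)" "\<And>j. cont_supp (\<phi> j)"
    and P\<phi>: "(\<Sum>j\<in>UNIV. integral UNIV (\<lambda>x. \<D> j P x * \<phi> j x)) = 0"
  shows "(\<Sum>j\<in>UNIV. \<Sum>l\<in>UNIV. integral UNIV (\<lambda>x. \<D> l (v j) x * \<D> l (\<phi> j) x))
    = (\<Sum>j\<in>UNIV. \<Sum>l\<in>UNIV. integral UNIV (\<lambda>x. (v l x * v j x) * \<D> l (\<phi> j) x))"
proof -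
  have c1: "cont_supp (\<lambda>x. \<D> l (\<D> l (v j)) x * \<phi> j x)" for l j
    by (intro cont_supp_multL v_cont \<phi>)
  have c2: "cont_supp (\<lambda>x. v l x * \<D> l (v j) x * \<phi> j x)" for l j
    by (intro cont_supp_multL v_cont \<phi> continuous_intros)
  have c3: "cont_supp (\<lambda>x. \<D> j P x * \<phi> j x)" for j
    by (intro cont_supp_multL C_class_1D(3)[OF P_C1] \<phi>)
  have "(\<Sum>l\<in>UNIV. integral UNIV (\<lambda>x. \<D> l (v j) x * \<D> l (\<phi> j) x))
     - (\<Sum>l\<in>UNIV. integral UNIV (\<lambda>x. (v l x * v j x) * \<D> l (\<phi> j) x))
     + integral UNIV (\<lambda>x. \<D> j P x * \<phi> j x) = 0" for j
  proof -
    have 1: "integral UNIV (\<lambda>x. \<D> l (v j) x * \<D> l (\<phi> j) x)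
       = - integral UNIV (\<lambda>x. \<D> l (\<D> l (v j)) x * \<phi> j x)" for l
      using integration_by_parts[OF \<phi>(1) C_class_2D(2)[OF v_C2] \<phi>(2), of j l l j] by (simp add: mult_ac)
    have "0 = integral UNIV (\<lambda>x. (- (\<Sum>l\<in>UNIV. \<D> l (\<D> l (v j)) x)
        + (\<Sum>l\<in>UNIV. v l x * \<D> l (v j) x) + \<D> j P x) * \<phi> j x)"
      by (simp only: momentum mult_zero_left integral_0)
    also have "\<dots> = integral UNIV (\<lambda>x. ((-1) * (\<Sum>l\<in>UNIV. \<D> l (\<D> l (v j)) x * \<phi> j x)
        + (\<Sum>l\<in>UNIV. v l x * \<D> l (v j) x * \<phi> j x)) + \<D> j P x * \<phi> j x)"
      by (simp add: distrib_right sum_distrib_right left_diff_distrib)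
    also have "\<dots> = - (\<Sum>l\<in>UNIV. integral UNIV (\<lambda>x. \<D> l (\<D> l (v j)) x * \<phi> j x))
        + (\<Sum>l\<in>UNIV. integral UNIV (\<lambda>x. v l x * \<D> l (v j) x * \<phi> j x))
        + integral UNIV (\<lambda>x. \<D> j P x * \<phi> j x)"
    proof -
      have s1: "cont_supp (\<lambda>x. \<Sum>l\<in>UNIV. \<D> l (\<D> l (v j)) x * \<phi> j x)"
        and s2: "cont_supp (\<lambda>x. \<Sum>l\<in>UNIV. v l x * \<D> l (v j) x * \<phi> j x)"
        by (rule cont_supp_sum, simp, rule c1, rule cont_supp_sum, simp, rule c2)
      have "integral UNIV (\<lambda>x. (-1) * (\<Sum>l\<in>UNIV. \<D> l (\<D> l (v j)) x * \<phi> j x))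
        = - (\<Sum>l\<in>UNIV. integral UNIV (\<lambda>x. \<D> l (\<D> l (v j)) x * \<phi> j x))"
        by (subst integral_mult_right) (simp add: cont_supp_integral_sum c1)
      moreover have "integral UNIV (\<lambda>x. \<Sum>l\<in>UNIV. v l x * \<D> l (v j) x * \<phi> j x) =
         (\<Sum>l\<in>UNIV. integral UNIV (\<lambda>x. v l x * \<D> l (v j) x * \<phi> j x))"
        by (rule cont_supp_integral_sum, simp, rule c2)
      ultimately show ?thesis
        by (simp only: cont_supp_integral_add[OF cont_supp_add[OF cont_supp_cmult[OF s1] s2] c3]
          cont_supp_integral_add[OF cont_supp_cmult[OF s1] s2])
    qed
    also have "(\<Sum>l\<in>UNIV. integral UNIV (\<lambda>x. v l x * \<D> l (v j) x * \<phi> j x))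
       = - (\<Sum>l\<in>UNIV. integral UNIV (\<lambda>x. v l x * v j x * \<D> l (\<phi> j) x))"
      by (rule transport_antisymmetric[OF \<phi> C_class_2D(1)[OF v_C2]])
    finally show ?thesis by (simp add: 1 sum_negf)
  qed
  then have "(\<Sum>j\<in>UNIV. (\<Sum>l\<in>UNIV. integral UNIV (\<lambda>x. \<D> l (v j) x * \<D> l (\<phi> j) x))
     - (\<Sum>l\<in>UNIV. integral UNIV (\<lambda>x. (v l x * v j x) * \<D> l (\<phi> j) x))
     + integral UNIV (\<lambda>x. \<D> j P x * \<phi> j x)) = 0" by simp
  then show ?thesis using P\<phi> by (simp add: sum.distrib sum_subtractf)
qed

end

text \<open>Collects the bounds \<open>T1\<close> to \<open>T6\<close> in the proof of
  \<open>test_field\<close>, weighted as in the rules for \<open>L2_le\<close>: 80 = 2 * 2 * 10 * 2,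
  8 = 2 * 2 * 2 and 4 = 2 * 2.\<close>

definition remainder_const :: "real \<Rightarrow> real" where
  "remainder_const K = 80 * (324 * K\<^sup>2 * avg_const + 36 * K\<^sup>2 * (2 * bump_mass\<^sup>2 + 2 * avg_const))
    + 8 * (9 * K\<^sup>2 * avg_const + avg_const) + 4 * (810 * K ^ 4 * avg_const + 810 * K\<^sup>2 * avg_const)"

lemma avg_sum:
  assumes "avg_weight w s" "finite I" "\<And>i. i \<in> I \<Longrightarrow> continuous_on UNIV (f i)"
  shows "avg w s (\<lambda>x. \<Sum>i\<in>I. f i x) y = (\<Sum>i\<in>I. avg w s (f i) y)"
proof -
  have "(\<Sum>i\<in>I. avg w s (f i) y) = integral tz_box (\<lambda>p. \<Sum>i\<in>I. (case p of (t, z) \<Rightarrow> w t z * f i (y - s t *\<^sub>R z)))"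
    unfolding avg_def
    by (rule integral_sum[symmetric]) (auto intro: avg_arg_integrable[OF assms(1,3)] assms(2))
  also have "\<dots> = avg w s (\<lambda>x. \<Sum>i\<in>I. f i x) y"
    unfolding avg_def by (intro arg_cong[of _ _ "integral tz_box"] ext) (auto simp: sum_distrib_left)
  finally show ?thesis ..
qed

lemma avg_const_nonneg: "0 \<le> avg_const"
  by (simp add: avg_const_def)

section \<open>Solenoidal test fields\<close>

context divergence_free
begin

lemma moment_member:
  "integral (cube r) (\<lambda>x. (v j x) ^ n) \<le> moment n v r" if "even n"
  unfolding moment_def
  by (rule member_le_sum[of j UNIV "\<lambda>j. integral (cube r) (\<lambda>x. (v j x) ^ n)"])
    (auto intro!: integral_nonneg integrable_on_cube continuous_intros v_cont zero_le_even_power that)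

lemma moment_nonneg: "even n \<Longrightarrow> 0 \<le> moment n v r"
  unfolding moment_def
  by (auto intro!: sum_nonneg integral_nonneg integrable_on_cube continuous_intros v_cont)

lemma grad_energy_member:
  "integral (cube r) (\<lambda>x. (\<D> l (v j) x)\<^sup>2) \<le> grad_energy v r"
proof -
  have n: "0 \<le> integral (cube r) (\<lambda>x. (\<D> l (v j) x)\<^sup>2)" for l j
    by (intro integral_nonneg integrable_on_cube continuous_intros v_cont) auto
  have "integral (cube r) (\<lambda>x. (\<D> l (v j) x)\<^sup>2)
     \<le> (\<Sum>j\<in>UNIV. integral (cube r) (\<lambda>x. (\<D> l (v j) x)\<^sup>2))"
    by (rule member_le_sum[of j UNIV "\<lambda>j. integral (cube r) (\<lambda>x. (\<D> l (v j) x)\<^sup>2)"])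
      (auto intro: n)
  also have "\<dots> \<le> grad_energy v r"
    unfolding grad_energy_def
    by (rule member_le_sum[of l UNIV "\<lambda>l. \<Sum>j\<in>UNIV. integral (cube r) (\<lambda>x. (\<D> l (v j) x)\<^sup>2)"])
      (auto intro: sum_nonneg n)
  finally show ?thesis .
qed

lemma grad_energy_nonneg: "0 \<le> grad_energy v r"
  unfolding grad_energy_def
  by (auto intro!: sum_nonneg integral_nonneg integrable_on_cube continuous_intros v_cont)

text \<open>The divergence of the antisymmetric matrix \<open>\<eta> (D\<^sub>i f\<^sub>j - D\<^sub>j f\<^sub>i)\<close>, where \<open>D = riesz\<close> and
  \<open>f = \<zeta> v\<close>, is a solenoidal test field equal to \<open>bump_mass \<eta> v\<close> up to a remainder
  whose gradient is controlled by the \<open>L\<^sup>2\<close> norm of \<open>v\<close>.\<close>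

lemma test_field:
  assumes K: "1 \<le> K" and d: "0 < d" "d \<le> 1"
    and \<eta>: "bounded_C2 (3 * K / d) (9 * K / d\<^sup>2) \<eta>" and \<zeta>: "bounded_C2 (3 * K / d) (9 * K / d\<^sup>2) \<zeta>"
    and \<eta>0: "\<And>x. x \<notin> cube (r + d / 3) \<Longrightarrow> \<eta> x = 0"
    and \<zeta>1: "\<And>x. x \<in> cube (r + 2 * d / 3) \<Longrightarrow> \<zeta> x = 1"
    and \<zeta>0: "\<And>x. x \<notin> cube (r + d) \<Longrightarrow> \<zeta> x = 0"
  obtains \<phi> \<psi> where "\<And>j. C_class 1 (\<phi> j)" "\<And>j. cont_supp (\<phi> j)"
    "\<And>P. C_class 1 P \<Longrightarrow> (\<Sum>j\<in>UNIV. integral UNIV (\<lambda>x. \<D> j P x * \<phi> j x)) = 0"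
    "\<And>j x. \<phi> j x = bump_mass * (\<eta> x * v j x) + \<psi> j x"
    "\<And>j. C_class 1 (\<psi> j)"
    "\<And>j l x. x \<notin> cube (r + d) \<Longrightarrow> \<D> l (\<psi> j) x = 0"
    "\<And>j l. L2_le (remainder_const K * (moment 2 v (r + d) / d ^ 4)) (\<D> l (\<psi> j))"
proof -
  let ?a = avg_const and ?s = "2 * bump_mass\<^sup>2 + 2 * avg_const"
  define X where "X = moment 2 v (r + d)"
  \<comment> \<open>Since \<open>d \<le> 1\<close>, the worst power that occurs,
    \<open>1 / d ^ 4\<close>, dominates all others.\<close>
  define q where "q = X / d ^ 4"
  have X0: "0 \<le> X" by (simp add: X_def moment_nonneg)
  have d4: "d ^ 4 \<le> 1" "d ^ 4 \<le> d\<^sup>2" "0 < d ^ 4" "0 < d\<^sup>2"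
    using d by (auto simp: power_le_one power_decreasing)
  have q1: "X / d\<^sup>2 \<le> q" using X0 d4 by (simp add: q_def frac_le)
  have q2: "X \<le> q"
    using frac_le[of X X "d ^ 4" 1] X0 d4 by (simp add: q_def)
  have \<eta>2: "C_class 2 \<eta>" and \<zeta>2: "C_class 2 \<zeta>" using \<eta> \<zeta> by (auto simp: bounded_C2_def)
  have bd: "\<bar>\<eta> x\<bar> \<le> 1" "\<bar>\<zeta> x\<bar> \<le> 1" "\<bar>\<D> i \<eta> x\<bar> \<le> 3 * K / d" "\<bar>\<D> i \<zeta> x\<bar> \<le> 3 * K / d"
    "\<bar>\<D> i (\<D> j \<eta>) x\<bar> \<le> 9 * K / d\<^sup>2" for i j x
    using \<eta> \<zeta> by (auto simp: bounded_C2_def abs_le_iff intro: order_trans[of _ 0])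
  have c\<zeta>: "cont_supp \<zeta>"
    using C_class_2D(3)[OF \<zeta>2] \<zeta>0 by (rule cont_suppI)
  define f where "f j = (\<lambda>x. \<zeta> x * v j x)" for j
  \<comment> \<open>The divergence of the cut-off field. As \<open>v\<close> is divergence-free it
    reduces to grad \<zeta> . v, so it vanishes where \<open>\<zeta>\<close> is locally
    constant.\<close>
  define g where "g = (\<lambda>x. \<Sum>i\<in>UNIV. \<D> i (f i) x)"
  define W where "W i j = riesz i (f j)" for i j
  define B where "B i j = (\<lambda>x. W i j x - W j i x)" for i j
  \<comment> \<open>\<open>\<mu>\<close> and \<open>R\<close> are the two errors in
    \<open>divB\<close>: the smoothing term of \<open>riesz_divergence\<close>, and the contribution
    of the divergence \<open>g\<close> created by the cutoff \<open>\<zeta>\<close>.\<close>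
  define \<mu> where "\<mu> j = bump_avg (f j)" for j
  define R where "R j = riesz j g" for j
  define \<phi> where "\<phi> j = (\<lambda>x. \<Sum>i\<in>UNIV. \<D> i (\<lambda>x. \<eta> x * B i j x) x)" for j
  define \<psi> where "\<psi> j = (\<lambda>x. ((\<Sum>i\<in>UNIV. \<D> i \<eta> x * B i j x) - \<eta> x * \<mu> j x) - \<eta> x * R j x)" for j

  have f2: "C_class 2 (f j)" for j unfolding f_def by (intro C_class_mult \<zeta>2 v_C2)
  have f1: "C_class 1 (f j)" for j by (rule C_class_2D(1)[OF f2])
  have cf: "cont_supp (f j)" for j unfolding f_def by (intro cont_supp_multR c\<zeta> v_cont)
  have df: "\<D> i (f j) x = \<D> i \<zeta> x * v j x + \<zeta> x * \<D> i (v j) x" for i j x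
    unfolding f_def
    by (rule partial_deriv_mult[OF C_class_1D(1)[OF C_class_2D(1)[OF \<zeta>2]] C_class_1D(1)[OF C_class_2D(1)[OF v_C2]]])
  have g_eq: "g = (\<lambda>x. \<Sum>i\<in>UNIV. \<D> i \<zeta> x * v i x)"
  proof
    fix x
    show "g x = (\<Sum>i\<in>UNIV. \<D> i \<zeta> x * v i x)"
      unfolding g_def df sum.distrib sum_distrib_left[symmetric] divergence_0 by simp
  qed
  have g1: "C_class 1 g" unfolding g_def by (intro C_class_sum C_class_2D(2)[OF f2]) auto
  have cg: "cont_supp g"
    unfolding g_def by (intro cont_supp_sum cont_supp_partial_deriv f1 cf) auto
  \<comment> \<open>The interior of the cube where \<open>\<zeta> = 1\<close>, on which
    \<open>g\<close> and its derivatives vanish. It reaches \<open>d / 3\<close> beyond the cube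
    carrying \<open>\<eta>\<close>.\<close>
  define S where "S = box (\<chi> i. - (r + 2 * d / 3)) ((\<chi> i. r + 2 * d / 3) :: real^3)"
  have S: "y \<in> S \<longleftrightarrow> (\<forall>i. \<bar>y $ i\<bar> < r + 2 * d / 3)" for y
  proof -
    have "(- c < a \<and> a < c) \<longleftrightarrow> \<bar>a\<bar> < c" for a c :: real by auto
    then show ?thesis by (simp only: S_def mem_box_cart vec_lambda_beta)
  qed
  have oS: "open S" by (simp add: S_def open_box)
  have g0: "g y = 0" if "y \<in> S" for y
  proof -
    have "\<D> i \<zeta> y = 0" for i
    proof (rule partial_deriv_eq_0[OF oS that])
      fix y assume "y \<in> S"
      then show "\<zeta> y = 1" by (intro \<zeta>1) (auto simp: S mem_cube less_imp_le)
    qed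
    then show ?thesis by (simp add: g_eq)
  qed
  have dg0: "\<D> l g y = 0" if "y \<in> S" for y l
    by (rule partial_deriv_eq_0[OF oS that g0])

  have L2f: "L2_le X (f j)" for j
  proof -
    have "integral UNIV (\<lambda>x. (f j x)\<^sup>2) \<le> integral (cube (r + d)) (\<lambda>x. (v j x)\<^sup>2)"
    proof (rule integral_UNIV_le_cube)
      show "cont_supp (\<lambda>x. (f j x)\<^sup>2)" by (rule cont_supp_power2[OF cf])
      show "continuous_on UNIV (\<lambda>x. (v j x)\<^sup>2)" by (intro continuous_intros v_cont)
      show "(f j x)\<^sup>2 = 0" if "x \<notin> cube (r + d)" for x using \<zeta>0[OF that] by (simp add: f_def)
      fix x
      have "(\<zeta> x)\<^sup>2 \<le> 1" using power_mono[OF bd(2)[of x], of 2] by simp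
      then show "(f j x)\<^sup>2 \<le> (v j x)\<^sup>2"
        using mult_right_mono[of "(\<zeta> x)\<^sup>2" 1 "(v j x)\<^sup>2"] by (simp add: f_def power_mult_distrib)
    qed
    then show ?thesis using moment_member[of 2 "r + d" j] cf by (simp add: L2_le_def X_def)
  qed
  have L2g: "L2_le (90 * K\<^sup>2 / d\<^sup>2 * X) g"
  proof -
    have "L2_le ((3 * K / d)\<^sup>2 * X) (\<lambda>x. \<D> i \<zeta> x * v i x)" for i
    proof -
      have cs: "cont_supp (\<lambda>x. \<D> i \<zeta> x * v i x)"
        by (intro cont_supp_multR cont_supp_partial_deriv[OF C_class_2D(1)[OF \<zeta>2] c\<zeta>] v_cont)
      have "integral UNIV (\<lambda>x. (\<D> i \<zeta> x * v i x)\<^sup>2)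
          \<le> integral (cube (r + d)) (\<lambda>x. (3 * K / d)\<^sup>2 * (v i x)\<^sup>2)"
      proof (rule integral_UNIV_le_cube)
        show "cont_supp (\<lambda>x. (\<D> i \<zeta> x * v i x)\<^sup>2)" by (rule cont_supp_power2[OF cs])
        show "continuous_on UNIV (\<lambda>x. (3 * K / d)\<^sup>2 * (v i x)\<^sup>2)" by (intro continuous_intros v_cont)
        show "(\<D> i \<zeta> x * v i x)\<^sup>2 = 0" if "x \<notin> cube (r + d)" for x
          using partial_deriv_eq_0[of "- cube (r + d)" x \<zeta> 0 i] that \<zeta>0
          by (auto simp: cube_def open_Compl)
        fix x
        have "(\<D> i \<zeta> x)\<^sup>2 \<le> (3 * K / d)\<^sup>2" using power_mono[OF bd(4)[of i x], of 2] by simp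
        then show "(\<D> i \<zeta> x * v i x)\<^sup>2 \<le> (3 * K / d)\<^sup>2 * (v i x)\<^sup>2"
          by (simp only: power_mult_distrib mult_right_mono zero_le_power2)
      qed
      also have "\<dots> = (3 * K / d)\<^sup>2 * integral (cube (r + d)) (\<lambda>x. (v i x)\<^sup>2)" by simp
      also have "\<dots> \<le> (3 * K / d)\<^sup>2 * X"
        using moment_member[of 2 "r + d" i] by (intro mult_left_mono) (auto simp: X_def)
      finally show ?thesis using cs by (simp add: L2_le_def)
    qed
    from L2_le_sum3[OF this] show ?thesis unfolding g_eq
      by (rule L2_le_mono) (simp add: power_mult_distrib power_divide)
  qed

  have W2: "C_class 2 (W i j)" for i j unfolding W_def by (rule C_class_riesz[OF f2])
  have B2: "C_class 2 (B i j)" for i j unfolding B_def by (intro C_class_diff W2)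
  have cB: "cont_supp (B i j)" for i j
    unfolding B_def W_def by (intro cont_supp_diff cont_supp_riesz cf)
  have dB: "\<D> l (B i j) = (\<lambda>x. \<D> l (W i j) x - \<D> l (W j i) x)" for l i j
    unfolding B_def using partial_deriv_diff C_class_1D(1)[OF C_class_2D(1)[OF W2]] by blast
  have \<mu>1: "C_class 1 (\<mu> j)" for j unfolding \<mu>_def by (rule C_class_bump_avg[OF f1])
  have R1: "C_class 1 (R j)" for j unfolding R_def by (rule C_class_riesz[OF g1])
  have \<eta>B2: "C_class 2 (\<lambda>x. \<eta> x * B i j x)" for i j by (intro C_class_mult \<eta>2 B2)
  have c\<eta>B: "cont_supp (\<lambda>x. \<eta> x * B i j x)" for i j
    by (intro cont_supp_multL C_class_2D(3)[OF \<eta>2] cB)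
  \<comment> \<open>The first half of \<open>B\<close> is handled by
    \<open>riesz_divergence\<close>; in the second half the derivatives assemble to
    \<open>riesz j\<close> of the divergence of \<open>f\<close>.\<close>
  have divB: "(\<Sum>i\<in>UNIV. \<D> i (B i j) x) = bump_mass * f j x - \<mu> j x - R j x" for j x
  proof -
    have "(\<Sum>i\<in>UNIV. \<D> i (B i j) x)
       = (\<Sum>i\<in>UNIV. riesz i (\<D> i (f j)) x) - (\<Sum>i\<in>UNIV. riesz j (\<D> i (f i)) x)"
      unfolding dB W_def by (simp add: sum_subtractf partial_deriv_riesz[OF f1])
    also have "(\<Sum>i\<in>UNIV. riesz j (\<D> i (f i)) x) = R j x"
      unfolding R_def g_def riesz_def
      by (rule avg_sum[symmetric, OF avg_weight_riesz]) (auto intro: C_class_2D(4)[OF f2])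
    finally show ?thesis by (simp add: riesz_divergence[OF f1] \<mu>_def)
  qed
  have \<eta>f: "\<eta> x * f j x = \<eta> x * v j x" for j x
  proof (cases "x \<in> cube (r + d / 3)")
    case True
    have "cube (r + d / 3) \<subseteq> cube (r + 2 * d / 3)" using d by (intro cube_mono) simp
    then show ?thesis using True \<zeta>1 by (auto simp: f_def)
  qed (simp add: \<eta>0)
  have \<phi>\<psi>: "\<phi> j x = bump_mass * (\<eta> x * v j x) + \<psi> j x" for j x
  proof -
    have "\<phi> j x = (\<Sum>i\<in>UNIV. \<D> i \<eta> x * B i j x + \<eta> x * \<D> i (B i j) x)"
      unfolding \<phi>_def
      by (intro sum.cong refl partial_deriv_mult C_class_1D(1)[OF C_class_2D(1)] \<eta>2 B2)
    also have "\<dots> = (\<Sum>i\<in>UNIV. \<D> i \<eta> x * B i j x) + \<eta> x * (bump_mass * f j x - \<mu> j x - R j x)"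
      by (simp add: sum.distrib divB flip: sum_distrib_left)
    also have "\<dots> = bump_mass * (\<eta> x * f j x) + \<psi> j x"
      by (simp add: \<psi>_def algebra_simps)
    finally show ?thesis by (simp add: \<eta>f)
  qed

  have \<psi>1: "C_class 1 (\<psi> j)" for j
    unfolding \<psi>_def
    by (intro C_class_diff C_class_sum C_class_mult C_class_2D(2)[OF \<eta>2] C_class_2D(1)[OF B2]
       C_class_2D(1)[OF \<eta>2] \<mu>1 R1) auto
  have d\<psi>: "\<D> l (\<psi> j) x =
     ((\<Sum>i\<in>UNIV. \<D> l (\<D> i \<eta>) x * B i j x + \<D> i \<eta> x * \<D> l (B i j) x)
      - (\<D> l \<eta> x * \<mu> j x + \<eta> x * \<D> l (\<mu> j) x))
      - (\<D> l \<eta> x * R j x + \<eta> x * \<D> l (R j) x)" for l j x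
  proof -
    note D = C_class_1D(1)[where x=x]
    note D\<eta> = D[OF C_class_2D(1)[OF \<eta>2]]
    have A1: "C_class 1 (\<lambda>x. \<D> i \<eta> x * B i j x)" for i
      by (intro C_class_mult C_class_2D(2)[OF \<eta>2] C_class_2D(1)[OF B2])
    have A2: "C_class 1 (\<lambda>x. \<eta> x * \<mu> j x)" "C_class 1 (\<lambda>x. \<eta> x * R j x)"
      by (intro C_class_mult C_class_2D(1)[OF \<eta>2] \<mu>1 R1)+
    have A3: "C_class 1 (\<lambda>x. \<Sum>i\<in>UNIV. \<D> i \<eta> x * B i j x)"
      by (intro C_class_sum A1) auto
    have "\<D> l (\<psi> j) x = \<D> l (\<lambda>x. \<Sum>i\<in>UNIV. \<D> i \<eta> x * B i j x) x
        - \<D> l (\<lambda>x. \<eta> x * \<mu> j x) x - \<D> l (\<lambda>x. \<eta> x * R j x) x"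
      unfolding \<psi>_def
      by (subst partial_deriv_diff[OF D[OF C_class_diff[OF A3 A2(1)]] D[OF A2(2)]])
        (subst partial_deriv_diff[OF D[OF A3] D[OF A2(1)]], simp)
    also have "\<D> l (\<lambda>x. \<Sum>i\<in>UNIV. \<D> i \<eta> x * B i j x) x
      = (\<Sum>i\<in>UNIV. \<D> l (\<lambda>x. \<D> i \<eta> x * B i j x) x)"
      by (rule partial_deriv_sum) (rule D[OF A1])
    finally show ?thesis
      by (simp add: partial_deriv_mult[OF D\<eta> D[OF \<mu>1]] partial_deriv_mult[OF D\<eta> D[OF R1]]
         partial_deriv_mult[OF D[OF C_class_2D(2)[OF \<eta>2]] D[OF C_class_2D(1)[OF B2]]])
  qed
  have \<psi>0: "\<D> l (\<psi> j) x = 0" if "x \<notin> cube (r + d)" for l j x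
  proof -
    have sub: "cube (r + d / 3) \<subseteq> cube (r + d)" using d by (intro cube_mono) simp
    have d\<eta>0: "\<D> i \<eta> y = 0" if "y \<notin> cube (r + d / 3)" for i y
      by (rule partial_deriv_eq_0[of "- cube (r + d / 3)" _ _ 0])
        (use that \<eta>0 in \<open>auto simp: cube_def open_Compl\<close>)
    show ?thesis
      by (rule partial_deriv_eq_0[of "- cube (r + d / 3)" _ _ 0])
        (use that sub \<eta>0 d\<eta>0 in \<open>auto simp: \<psi>_def, auto simp: cube_def open_Compl\<close>)
  qed

  note a0 = avg_const_nonneg
  have L2W: "L2_le (?a * X) (W i j)" for i j
    unfolding W_def by (rule L2_le_trans[OF cont_supp_riesz[OF cf] riesz_L2[OF cf] a0 L2f])
  have L2dW: "L2_le (?s * X) (\<D> l (W i j))" for l i j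
    using W2 a0 unfolding W_def
    by (intro L2_le_trans[OF cont_supp_partial_deriv[OF C_class_2D(1) cont_supp_riesz[OF cf]]
        partial_deriv_riesz_L2[OF f2 cf] _ L2f]) auto
  have L2\<mu>: "L2_le (?a * X) (\<mu> j)" for j
    unfolding \<mu>_def by (rule L2_le_trans[OF cont_supp_bump_avg[OF cf] bump_avg_L2[OF cf] a0 L2f])
  have L2d\<mu>: "L2_le (?a * X) (\<D> l (\<mu> j))" for l j
    using \<mu>1 unfolding \<mu>_def
    by (intro L2_le_trans[OF cont_supp_partial_deriv[OF _ cont_supp_bump_avg[OF cf]]
        partial_bump_avg_L2[OF f1 cf] a0 L2f])
  have L2R: "L2_le (?a * (90 * K\<^sup>2 / d\<^sup>2 * X)) (R j)" for j
    unfolding R_def by (rule L2_le_trans[OF cont_supp_riesz[OF cg] riesz_L2[OF cg] a0 L2g])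
  \<comment> \<open>The gradient of \<open>R\<close> has to be bounded without derivatives of
    \<open>g\<close>, since those contain derivatives of \<open>v\<close>. On the support of
    \<open>\<eta>\<close> the gap of width \<open>d / 3\<close> permits the truncated
    kernel.\<close>
  define F where "F l j = avg (\<lambda>t z. 1 / max t (d / 3) * \<D> l (riesz_kernel j) z) (\<lambda>t. t) g" for l j
  have L2F: "L2_le (?a / (d / 3)\<^sup>2 * (90 * K\<^sup>2 / d\<^sup>2 * X)) (F l j)" for l j
    unfolding F_def using d a0
    by (intro L2_le_trans[OF cont_supp_avg[OF avg_weight_far cg] far_L2[OF cg] _ L2g]) auto
  have \<eta>R: "\<eta> x * \<D> l (R j) x = \<eta> x * F l j x" for l j x
  proof (cases "x \<in> cube (r + d / 3)")
    case True
    have "\<D> l (R j) x = F l j x"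
      unfolding R_def F_def
    proof (rule partial_deriv_riesz_far[OF g1])
      fix t :: real and z :: "real^3" assume t: "0 \<le> t" "t < d / 3" and z: "z \<in> cube 1"
      have "\<bar>(x - t *\<^sub>R z) $ i\<bar> < r + 2 * d / 3" for i
      proof -
        have "\<bar>t * z $ i\<bar> \<le> t" using t z mult_left_mono[of "\<bar>z $ i\<bar>" 1 t] by (simp add: abs_mult mem_cube)
        moreover have "\<bar>x $ i\<bar> \<le> r + d / 3" using True by (simp add: mem_cube)
        ultimately show ?thesis using t by simp
      qed
      then show "\<D> l g (x - t *\<^sub>R z) = 0" by (intro dg0) (simp only: S, blast)
    qed (use d in simp)
    then show ?thesis by simp
  qed (simp add: \<eta>0)

  note c\<eta>s = C_class_2D(3)[OF \<eta>2] C_class_2D(4)[OF \<eta>2] C_class_2D(5)[OF \<eta>2]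
  \<comment> \<open>Constants: 324 = 81 * 4 and 36 = 9 * 4, the 4 coming from the difference in
    \<open>B\<close>. In 810 = 9 * 90 the 90 is from \<open>L2g\<close>, and the 9 is from the
    gradient of \<open>\<eta>\<close> in \<open>T5\<close> and from the gap \<open>d / 3\<close> in
    \<open>T6\<close>.\<close>
  have T1: "L2_le (324 * K\<^sup>2 * ?a * q) (\<lambda>x. \<D> l (\<D> i \<eta>) x * B i j x)" for l i j
    unfolding B_def
    by (rule L2_le_mono[OF L2_le_mult[OF L2_le_diff[OF L2W L2W] c\<eta>s(3) bd(5)]])
      (simp add: q_def power_divide power_mult_distrib field_simps flip: power_mult)
  have T2: "L2_le (36 * K\<^sup>2 * ?s * q) (\<lambda>x. \<D> i \<eta> x * \<D> l (B i j) x)" for l i j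
  proof -
    have "(3 * K / d)\<^sup>2 * (2 * (?s * X) + 2 * (?s * X)) = 36 * K\<^sup>2 * ?s * (X / d\<^sup>2)"
      by (simp add: power_divide power_mult_distrib field_simps)
    also have "\<dots> \<le> 36 * K\<^sup>2 * ?s * q" using q1 a0 by (intro mult_left_mono) auto
    finally show ?thesis
      unfolding dB by (rule L2_le_mono[OF L2_le_mult[OF L2_le_diff[OF L2dW L2dW] c\<eta>s(2) bd(3)]])
  qed
  have T3: "L2_le (9 * K\<^sup>2 * ?a * q) (\<lambda>x. \<D> l \<eta> x * \<mu> j x)" for l j
  proof -
    have "(3 * K / d)\<^sup>2 * (?a * X) = 9 * K\<^sup>2 * ?a * (X / d\<^sup>2)"
      by (simp add: power_divide power_mult_distrib field_simps)
    also have "\<dots> \<le> 9 * K\<^sup>2 * ?a * q" using q1 a0 by (intro mult_left_mono) auto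
    finally show ?thesis by (rule L2_le_mono[OF L2_le_mult[OF L2\<mu> c\<eta>s(2) bd(3)]])
  qed
  have T4: "L2_le (?a * q) (\<lambda>x. \<eta> x * \<D> l (\<mu> j) x)" for l j
    by (rule L2_le_mono[OF L2_le_mult[OF L2d\<mu> c\<eta>s(1) bd(1)]]) (use q2 a0 in \<open>simp add: mult_left_mono\<close>)
  have T5: "L2_le (810 * K ^ 4 * ?a * q) (\<lambda>x. \<D> l \<eta> x * R j x)" for l j
    by (rule L2_le_mono[OF L2_le_mult[OF L2R c\<eta>s(2) bd(3)]])
      (simp add: q_def power_divide power_mult_distrib field_simps power2_eq_square power4_eq_xxxx)
  have T6: "L2_le (810 * K\<^sup>2 * ?a * q) (\<lambda>x. \<eta> x * \<D> l (R j) x)" for l j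
    unfolding \<eta>R
    by (rule L2_le_mono[OF L2_le_mult[OF L2F c\<eta>s(1) bd(1)]])
      (simp add: q_def power_divide power_mult_distrib field_simps power2_eq_square power4_eq_xxxx)
  have L2\<psi>: "L2_le (remainder_const K * (X / d ^ 4)) (\<D> l (\<psi> j))" for l j
  proof -
    have "\<D> l (\<psi> j) = (\<lambda>x.
     ((\<Sum>i\<in>UNIV. \<D> l (\<D> i \<eta>) x * B i j x + \<D> i \<eta> x * \<D> l (B i j) x)
      - (\<D> l \<eta> x * \<mu> j x + \<eta> x * \<D> l (\<mu> j) x))
      - (\<D> l \<eta> x * R j x + \<eta> x * \<D> l (R j) x))"
      using d\<psi> by blast
    moreover have "L2_le (2 * (2 * (10 * (2 * (324 * K\<^sup>2 * ?a * q) + 2 * (36 * K\<^sup>2 * ?s * q)))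
       + 2 * (2 * (9 * K\<^sup>2 * ?a * q) + 2 * (?a * q)))
       + 2 * (2 * (810 * K ^ 4 * ?a * q) + 2 * (810 * K\<^sup>2 * ?a * q))) \<dots>"
      by (intro L2_le_diff L2_le_add L2_le_sum3 T1 T2 T3 T4 T5 T6)
    ultimately show ?thesis
      by (simp add: remainder_const_def q_def[symmetric] algebra_simps)
  qed
  show ?thesis
  proof (rule that[of \<phi> \<psi>])
    show "C_class 1 (\<phi> j)" for j
      unfolding \<phi>_def by (intro C_class_sum C_class_2D(2)[OF \<eta>B2]) auto
    show "cont_supp (\<phi> j)" for j
      unfolding \<phi>_def by (intro cont_supp_sum cont_supp_partial_deriv C_class_2D(1)[OF \<eta>B2] c\<eta>B) auto
    show "(\<Sum>j\<in>UNIV. integral UNIV (\<lambda>x. \<D> j P x * \<phi> j x)) = 0" if "C_class 1 P" for P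
      unfolding \<phi>_def by (rule pressure_orthogonal[OF that \<eta>B2 c\<eta>B]) (simp add: B_def algebra_simps)
  qed (use \<phi>\<psi> \<psi>1 \<psi>0 L2\<psi> in \<open>auto simp: X_def\<close>)
qed

end

section \<open>Local energy inequality\<close>

text \<open>9 counts the index pairs. \<open>3 * K\<close> comes from the gradient of the inner
  cutoff, the other summand from the remainder \<open>\<psi>\<close>, divided by the factor
  \<open>bump_mass\<close> in front of \<eta> v.\<close>

definition energy_const :: "real \<Rightarrow> real" where
  "energy_const K = 9 * (3 * K + sqrt (remainder_const K) / bump_mass)"

lemma remainder_const_nonneg: "0 \<le> remainder_const K"
  by (simp add: remainder_const_def avg_const_nonneg)

text \<open>A Caccioppoli-type estimate. Testing with the field of \<open>test_field\<close>
  produces the energy weighted by \<open>\<eta>\<close>. Each term left on the other side pairs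
  \<open>\<D> l (v j)\<close> or \<open>v l * v j\<close>, measured on the larger cube, with a
  factor whose L2 norm is controlled by that of \<open>v\<close> divided by
  \<open>d\<^sup>2\<close>; hence the product of square roots.\<close>

lemma (in steady_flow) local_energy:
  assumes cutoff: "cutoff_bound K" and d: "0 < d" "d \<le> 1"
  shows "grad_energy v r \<le> energy_const K / d\<^sup>2 * sqrt (moment 2 v (r + d)) *
    (sqrt (grad_energy v (r + d)) + sqrt (moment 4 v (r + d)))"
proof -
  let ?M = bump_mass
  have K: "1 \<le> K" using cutoff by (simp add: cutoff_bound_def)
  have M: "0 < ?M" by (rule bump_mass_pos)
  have d3: "0 < d / 3" using d by simp
  have Kd: "K / (d / 3) = 3 * K / d" "K / (d / 3)\<^sup>2 = 9 * K / d\<^sup>2"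
    using d by (simp_all add: field_simps power2_eq_square)
  obtain \<eta> where \<eta>: "bounded_C2 (3 * K / d) (9 * K / d\<^sup>2) \<eta>"
    and \<eta>1: "\<And>x. x \<in> cube r \<Longrightarrow> \<eta> x = 1" and \<eta>0: "\<And>x. x \<notin> cube (r + d / 3) \<Longrightarrow> \<eta> x = 0"
    using cutoff_boundE[OF cutoff d3, of r] unfolding Kd by blast
  \<comment> \<open>The layer is split in three: \<open>\<eta>\<close> decays in the first third,
    \<open>\<zeta>\<close> in the last, and the middle third is the gap used in
    \<open>test_field\<close>.\<close>
  have rd: "r + 2 * d / 3 + d / 3 = r + d" by simp
  obtain \<zeta> where \<zeta>: "bounded_C2 (3 * K / d) (9 * K / d\<^sup>2) \<zeta>"
    and \<zeta>1: "\<And>x. x \<in> cube (r + 2 * d / 3) \<Longrightarrow> \<zeta> x = 1" and \<zeta>0: "\<And>x. x \<notin> cube (r + d) \<Longrightarrow> \<zeta> x = 0"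
    using cutoff_boundE[OF cutoff d3, of "r + 2 * d / 3"] unfolding Kd rd by blast
  obtain \<phi> \<psi> where \<phi>: "\<And>j. C_class 1 (\<phi> j)" "\<And>j. cont_supp (\<phi> j)"
    and P\<phi>: "\<And>P. C_class 1 P \<Longrightarrow> (\<Sum>j\<in>UNIV. integral UNIV (\<lambda>x. \<D> j P x * \<phi> j x)) = 0"
    and \<phi>\<psi>: "\<And>j x. \<phi> j x = ?M * (\<eta> x * v j x) + \<psi> j x"
    and \<psi>: "\<And>j. C_class 1 (\<psi> j)"
    and \<psi>0: "\<And>j l x. x \<notin> cube (r + d) \<Longrightarrow> \<D> l (\<psi> j) x = 0"
    and L2\<psi>: "\<And>j l. L2_le (remainder_const K * (moment 2 v (r + d) / d ^ 4)) (\<D> l (\<psi> j))"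
    by (rule test_field[OF K d \<eta> \<zeta>, where r=r])
      (erule \<eta>0, erule \<zeta>1, erule \<zeta>0, rule that, assumption+)
  define X where "X = moment 2 v (r + d)"
  define q where "q = X / d ^ 4"
  define sE where "sE = sqrt (grad_energy v (r + d))"
  define sY where "sY = sqrt (moment 4 v (r + d))"
  have X0: "0 \<le> X" by (simp add: X_def moment_nonneg)
  have q0: "0 \<le> q" by (simp add: q_def X0)
  have pos: "0 \<le> sE" "0 \<le> sY" by (simp_all add: sE_def sY_def grad_energy_nonneg moment_nonneg)
  have d4: "d ^ 4 \<le> d\<^sup>2" "0 < d ^ 4" "0 < d\<^sup>2"
    using d by (auto simp: power_decreasing)
  have q1: "X / d\<^sup>2 \<le> q" using X0 d4 by (simp add: q_def frac_le)
  have \<eta>2: "C_class 2 \<eta>" using \<eta> by (simp add: bounded_C2_def)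
  have bd: "\<bar>\<eta> x\<bar> \<le> 1" "\<bar>\<D> i \<eta> x\<bar> \<le> 3 * K / d" "0 \<le> \<eta> x" for i x
    using \<eta> by (auto simp: bounded_C2_def)
  have sub: "cube (r + d / 3) \<subseteq> cube (r + d)" using d by (intro cube_mono) simp
  have c\<eta>: "cont_supp \<eta>" using C_class_2D(3)[OF \<eta>2] \<eta>0 by (rule cont_suppI)
  have c\<eta>s: "continuous_on A \<eta>" "continuous_on A (\<D> i \<eta>)" for A i
    using C_class_2D(3)[OF \<eta>2] C_class_2D(4)[OF \<eta>2] by auto
  have d\<eta>0: "\<D> i \<eta> y = 0" if "y \<notin> cube (r + d)" for i y
    by (rule partial_deriv_eq_0[of "- cube (r + d)" _ _ 0])
      (use that \<eta>0 sub in \<open>auto simp: cube_def open_Compl\<close>)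
  have cd\<eta>: "cont_supp (\<D> i \<eta>)" for i
    by (rule cont_supp_partial_deriv[OF C_class_2D(1)[OF \<eta>2] c\<eta>])
  have cd\<psi>: "cont_supp (\<D> l (\<psi> j))" for l j using L2\<psi> by (simp add: L2_le_def)

  \<comment> \<open>\<open>a\<close>, \<open>b\<close>, \<open>c\<close> are the viscous terms
    against the three parts of the gradient of the test field: grad \<eta> times v, \<eta> times
    grad v, and grad \<psi>. \<open>e\<close>, \<open>h\<close>, \<open>k\<close> are the convective
    terms in the same order.\<close>
  define a where "a j l = integral UNIV (\<lambda>x. \<D> l (v j) x * (\<D> l \<eta> x * v j x))" for j l
  define b where "b j l = integral UNIV (\<lambda>x. \<eta> x * (\<D> l (v j) x)\<^sup>2)" for j l
  define c where "c j l = integral UNIV (\<lambda>x. \<D> l (v j) x * \<D> l (\<psi> j) x)" for j l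
  define e where "e j l = integral UNIV (\<lambda>x. (v l x * v j x) * (\<D> l \<eta> x * v j x))" for j l
  define h where "h j l = integral UNIV (\<lambda>x. (v l x * v j x) * (\<eta> x * \<D> l (v j) x))" for j l
  define k where "k j l = integral UNIV (\<lambda>x. (v l x * v j x) * \<D> l (\<psi> j) x)" for j l

  have d\<eta>v: "\<D> l (\<lambda>x. \<eta> x * v j x) x
      = \<D> l \<eta> x * v j x + \<eta> x * \<D> l (v j) x" for l j x
    by (intro partial_deriv_mult C_class_1D(1)[OF C_class_2D(1)] \<eta>2 v_C2)
  have \<eta>v1: "C_class 1 (\<lambda>x. \<eta> x * v j x)" for j
    by (intro C_class_mult C_class_2D(1) \<eta>2 v_C2)
  have \<phi>_eq: "\<phi> j = (\<lambda>x. ?M * (\<eta> x * v j x) + \<psi> j x)" for j using \<phi>\<psi> by blast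
  have d\<phi>: "\<D> l (\<phi> j) x = ?M * (\<D> l \<eta> x * v j x)
      + ?M * (\<eta> x * \<D> l (v j) x) + \<D> l (\<psi> j) x" for l j x
  proof -
    have "\<D> l (\<phi> j) x = \<D> l (\<lambda>x. ?M * (\<eta> x * v j x)) x + \<D> l (\<psi> j) x"
      unfolding \<phi>_eq
      by (rule partial_deriv_add[OF C_class_1D(1)[OF C_class_cmult[OF \<eta>v1]] C_class_1D(1)[OF \<psi>]])
    then show ?thesis
      by (simp add: partial_deriv_cmult[OF C_class_1D(1)[OF \<eta>v1]] d\<eta>v distrib_left)
  qed
  have cdv: "cont_supp (\<lambda>x. \<D> l \<eta> x * v j x)" "cont_supp (\<lambda>x. \<eta> x * \<D> l (v j) x)" for l j
    by (intro cont_supp_multR cd\<eta> c\<eta> v_cont)+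
  have expand: "integral UNIV (\<lambda>x. w x * \<D> l (\<phi> j) x)
      = ?M * integral UNIV (\<lambda>x. w x * (\<D> l \<eta> x * v j x))
      + ?M * integral UNIV (\<lambda>x. w x * (\<eta> x * \<D> l (v j) x))
      + integral UNIV (\<lambda>x. w x * \<D> l (\<psi> j) x)" if w: "continuous_on UNIV w" for w l j
  proof -
    have cs: "cont_supp (\<lambda>x. w x * (\<D> l \<eta> x * v j x))"
      "cont_supp (\<lambda>x. w x * (\<eta> x * \<D> l (v j) x))"
      "cont_supp (\<lambda>x. w x * \<D> l (\<psi> j) x)"
      by (intro cont_supp_multL w cdv cd\<psi>)+
    have "(\<lambda>x. w x * \<D> l (\<phi> j) x) = (\<lambda>x. (?M * (w x * (\<D> l \<eta> x * v j x))
        + ?M * (w x * (\<eta> x * \<D> l (v j) x))) + w x * \<D> l (\<psi> j) x)"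
      by (simp add: d\<phi> algebra_simps)
    then show ?thesis
      by (simp only: cont_supp_integral_add[OF cont_supp_add[OF cont_supp_cmult[OF cs(1)] cont_supp_cmult[OF cs(2)]] cs(3)]
         cont_supp_integral_add[OF cont_supp_cmult[OF cs(1)] cont_supp_cmult[OF cs(2)]] integral_mult_right)
  qed
  have I1: "integral UNIV (\<lambda>x. \<D> l (v j) x * \<D> l (\<phi> j) x) = ?M * a j l + ?M * b j l + c j l" for j l
    unfolding expand[OF v_cont(2)] a_def b_def c_def by (simp add: power2_eq_square mult_ac)
  have I2: "integral UNIV (\<lambda>x. (v l x * v j x) * \<D> l (\<phi> j) x) = ?M * e j l + ?M * h j l + k j l" for j l
    unfolding e_def h_def k_def by (rule expand) (intro continuous_intros v_cont)
  \<comment> \<open>Transport of \<open>v j\<close> tested with \<open>\<eta> * v j\<close> gives h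
    = - (e + h) after summation over \<open>l\<close>. This removes the one cubic term that contains
    a derivative of \<open>v\<close>.\<close>
  have he: "(\<Sum>l\<in>UNIV. h j l) = - (\<Sum>l\<in>UNIV. e j l) / 2" for j
  proof -
    have "(\<Sum>l\<in>UNIV. integral UNIV (\<lambda>x. v l x * \<D> l (v j) x * (\<eta> x * v j x)))
       = - (\<Sum>l\<in>UNIV. integral UNIV (\<lambda>x. v l x * v j x * \<D> l (\<lambda>x. \<eta> x * v j x) x))"
      by (rule transport_antisymmetric[OF \<eta>v1 _ C_class_2D(1)[OF v_C2]])
        (intro cont_supp_multR c\<eta> v_cont)
    moreover have "integral UNIV (\<lambda>x. v l x * \<D> l (v j) x * (\<eta> x * v j x)) = h j l" for l
      unfolding h_def by (simp add: mult_ac)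
    moreover have "integral UNIV (\<lambda>x. v l x * v j x * \<D> l (\<lambda>x. \<eta> x * v j x) x) = e j l + h j l" for l
    proof -
      have "cont_supp (\<lambda>x. (v l x * v j x) * (\<D> l \<eta> x * v j x))"
        "cont_supp (\<lambda>x. (v l x * v j x) * (\<eta> x * \<D> l (v j) x))"
        by (intro cont_supp_multL cdv continuous_intros v_cont)+
      from cont_supp_integral_add[OF this] show ?thesis
        unfolding e_def h_def d\<eta>v by (simp add: distrib_left)
    qed
    ultimately show ?thesis by (simp add: sum.distrib)
  qed
  have "(\<Sum>j\<in>UNIV. \<Sum>l\<in>UNIV. ?M * a j l + ?M * b j l + c j l)
      = (\<Sum>j\<in>UNIV. \<Sum>l\<in>UNIV. ?M * e j l + ?M * h j l + k j l)"
    using weak_form[OF \<phi> P\<phi>[OF P_C1]] by (simp only: I1 I2)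
  then have "?M * (\<Sum>j\<in>UNIV. \<Sum>l\<in>UNIV. a j l) + ?M * (\<Sum>j\<in>UNIV. \<Sum>l\<in>UNIV. b j l) + (\<Sum>j\<in>UNIV. \<Sum>l\<in>UNIV. c j l)
     = ?M * (\<Sum>j\<in>UNIV. \<Sum>l\<in>UNIV. e j l) + ?M * (\<Sum>j\<in>UNIV. \<Sum>l\<in>UNIV. h j l) + (\<Sum>j\<in>UNIV. \<Sum>l\<in>UNIV. k j l)"
    by (simp add: sum.distrib sum_distrib_left)
  moreover have "(\<Sum>j\<in>UNIV. \<Sum>l\<in>UNIV. h j l) = - (\<Sum>j\<in>UNIV. \<Sum>l\<in>UNIV. e j l) / 2"
    unfolding he by (simp add: sum_negf sum_divide_distrib)
  ultimately have id: "?M * (\<Sum>j\<in>UNIV. \<Sum>l\<in>UNIV. b j l) = ?M / 2 * (\<Sum>j\<in>UNIV. \<Sum>l\<in>UNIV. e j l)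
      - ?M * (\<Sum>j\<in>UNIV. \<Sum>l\<in>UNIV. a j l) + (\<Sum>j\<in>UNIV. \<Sum>l\<in>UNIV. k j l) - (\<Sum>j\<in>UNIV. \<Sum>l\<in>UNIV. c j l)"
    by (simp add: field_simps)

  define s1 where "s1 = 3 * K * sqrt q"
  define s2 where "s2 = sqrt (remainder_const K * q)"
  have L1: "sqrt (integral UNIV (\<lambda>x. (\<D> l \<eta> x * v j x)\<^sup>2)) \<le> s1" for l j
  proof -
    have "integral UNIV (\<lambda>x. (\<D> l \<eta> x * v j x)\<^sup>2) \<le> integral (cube (r + d)) (\<lambda>x. (3 * K / d)\<^sup>2 * (v j x)\<^sup>2)"
    proof (rule integral_UNIV_le_cube)
      show "cont_supp (\<lambda>x. (\<D> l \<eta> x * v j x)\<^sup>2)" by (rule cont_supp_power2[OF cdv(1)])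
      show "continuous_on UNIV (\<lambda>x. (3 * K / d)\<^sup>2 * (v j x)\<^sup>2)" by (intro continuous_intros v_cont)
      show "(\<D> l \<eta> x * v j x)\<^sup>2 = 0" if "x \<notin> cube (r + d)" for x
        using d\<eta>0[OF that] by simp
      fix x
      have "(\<D> l \<eta> x)\<^sup>2 \<le> (3 * K / d)\<^sup>2" using power_mono[OF bd(2)[of l x], of 2] by simp
      then show "(\<D> l \<eta> x * v j x)\<^sup>2 \<le> (3 * K / d)\<^sup>2 * (v j x)\<^sup>2"
        by (simp only: power_mult_distrib mult_right_mono zero_le_power2)
    qed
    also have "\<dots> = (3 * K / d)\<^sup>2 * integral (cube (r + d)) (\<lambda>x. (v j x)\<^sup>2)" by simp
    also have "\<dots> \<le> (3 * K / d)\<^sup>2 * X"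
      using moment_member[of 2 "r + d" j] by (intro mult_left_mono) (auto simp: X_def)
    also have "\<dots> = 9 * K\<^sup>2 * (X / d\<^sup>2)" by (simp add: power_divide power_mult_distrib)
    also have "\<dots> \<le> 9 * K\<^sup>2 * q" using q1 by (intro mult_left_mono) auto
    also have "\<dots> = (3 * K)\<^sup>2 * q" by (simp add: power_mult_distrib)
    finally have "sqrt (integral UNIV (\<lambda>x. (\<D> l \<eta> x * v j x)\<^sup>2)) \<le> sqrt ((3 * K)\<^sup>2 * q)"
      by (rule real_sqrt_le_mono)
    then show ?thesis using K by (simp add: s1_def real_sqrt_mult)
  qed
  have L2: "sqrt (integral UNIV (\<lambda>x. (\<D> l (\<psi> j) x)\<^sup>2)) \<le> s2" for l j
    unfolding s2_def q_def X_def using L2\<psi> by (intro real_sqrt_le_mono) (simp add: L2_le_def)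
  have LE: "sqrt (integral (cube (r + d)) (\<lambda>x. (\<D> l (v j) x)\<^sup>2)) \<le> sE" for l j
    unfolding sE_def by (intro real_sqrt_le_mono grad_energy_member)
  \<comment> \<open>The square of a product is at most half the sum of the fourth powers.\<close>
  have LY: "sqrt (integral (cube (r + d)) (\<lambda>x. (v l x * v j x)\<^sup>2)) \<le> sY" for l j
  proof -
    have "integral (cube (r + d)) (\<lambda>x. (v l x * v j x)\<^sup>2)
       \<le> integral (cube (r + d)) (\<lambda>x. (1/2) * (v l x) ^ 4 + (1/2) * (v j x) ^ 4)"
    proof (intro integral_le integrable_on_cube continuous_intros v_cont)
      fix x
      have "0 \<le> ((v l x)\<^sup>2 - (v j x)\<^sup>2)\<^sup>2" by simp
      then show "(v l x * v j x)\<^sup>2 \<le> (1/2) * (v l x) ^ 4 + (1/2) * (v j x) ^ 4"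
        by (simp add: power2_eq_square power4_eq_xxxx algebra_simps)
    qed
    also have "\<dots> = (1/2) * integral (cube (r + d)) (\<lambda>x. (v l x) ^ 4) + (1/2) * integral (cube (r + d)) (\<lambda>x. (v j x) ^ 4)"
    proof -
      have "(\<lambda>x. (1/2) * (v l x) ^ 4) integrable_on cube (r + d)" "(\<lambda>x. (1/2) * (v j x) ^ 4) integrable_on cube (r + d)"
        by (intro integrable_on_cube continuous_intros v_cont)+
      from integral_add[OF this] show ?thesis by simp
    qed
    also have "\<dots> \<le> moment 4 v (r + d)"
      using moment_member[of 4 "r + d" l] moment_member[of 4 "r + d" j] by simp
    finally show ?thesis unfolding sY_def by (rule real_sqrt_le_mono)
  qed
  have v2c: "continuous_on UNIV (\<lambda>x. v l x * v j x)" for l j by (intro continuous_intros v_cont)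
  have out1: "\<D> l \<eta> x * v j x = 0" if "x \<notin> cube (r + d)" for x l j
    using d\<eta>0[OF that] by simp
  have s0: "0 \<le> s1" "0 \<le> s2" using K q0 by (auto simp: s1_def s2_def remainder_const_nonneg)
  have ba: "\<bar>a j l\<bar> \<le> sE * s1" and be: "\<bar>e j l\<bar> \<le> sY * s1"
    and bc: "\<bar>c j l\<bar> \<le> sE * s2" and bk: "\<bar>k j l\<bar> \<le> sY * s2" for j l
    unfolding a_def e_def c_def k_def
    by (rule order_trans[OF Cauchy_Schwarz_cube[OF v_cont(2) cdv(1) out1] mult_mono[OF LE L1]],
        (use pos in \<open>auto intro!: integral_nonneg cont_supp_integrable cont_supp_power2 cdv\<close>)[3])
      (rule order_trans[OF Cauchy_Schwarz_cube[OF v2c cdv(1) out1] mult_mono[OF LY L1]],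
        (use pos in \<open>auto intro!: integral_nonneg cont_supp_integrable cont_supp_power2 cdv\<close>)[3],
       rule order_trans[OF Cauchy_Schwarz_cube[OF v_cont(2) cd\<psi> \<psi>0] mult_mono[OF LE L2]],
        (use pos in \<open>auto intro!: integral_nonneg cont_supp_integrable cont_supp_power2 cd\<psi>\<close>)[3],
       rule order_trans[OF Cauchy_Schwarz_cube[OF v2c cd\<psi> \<psi>0] mult_mono[OF LY L2]],
        (use pos in \<open>auto intro!: integral_nonneg cont_supp_integrable cont_supp_power2 cd\<psi>\<close>)[3])
  have sum9: "\<bar>\<Sum>j\<in>UNIV. \<Sum>l\<in>UNIV. F j l\<bar> \<le> 9 * B" if "\<And>j l. \<bar>F j l\<bar> \<le> B" for F :: "3 \<Rightarrow> 3 \<Rightarrow> real" and B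
  proof -
    have "\<bar>\<Sum>j\<in>UNIV. \<Sum>l\<in>UNIV. F j l\<bar> \<le> (\<Sum>j\<in>(UNIV::3 set). \<Sum>l\<in>(UNIV::3 set). B)"
      by (rule order_trans[OF sum_abs] sum_mono that)+
    then show ?thesis by simp
  qed
  have "?M * (\<Sum>j\<in>UNIV. \<Sum>l\<in>UNIV. b j l) \<le> ?M / 2 * (9 * (sY * s1)) + ?M * (9 * (sE * s1)) + 9 * (sY * s2) + 9 * (sE * s2)"
  proof -
    have "?M / 2 * (\<Sum>j\<in>UNIV. \<Sum>l\<in>UNIV. e j l) \<le> ?M / 2 * (9 * (sY * s1))"
      using sum9[of e, OF be] M by (intro mult_left_mono) auto
    moreover have "?M * - (\<Sum>j\<in>UNIV. \<Sum>l\<in>UNIV. a j l) \<le> ?M * (9 * (sE * s1))"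
      using sum9[of a, OF ba] M by (intro mult_left_mono) auto
    ultimately show ?thesis using id sum9[of k, OF bk] sum9[of c, OF bc] by simp
  qed
  \<comment> \<open>Enlarging the factor 1/2 to 1 lets the four terms factor into a product of
    sums.\<close>
  also have "\<dots> \<le> ?M * (9 * (sY * s1)) + ?M * (9 * (sE * s1)) + 9 * (sY * s2) + 9 * (sE * s2)"
    using M s0 pos by simp
  also have "\<dots> = ?M * (9 * (s1 + s2 / ?M) * (sE + sY))"
    using M by (simp add: field_simps)
  finally have "(\<Sum>j\<in>UNIV. \<Sum>l\<in>UNIV. b j l) \<le> 9 * (s1 + s2 / ?M) * (sE + sY)"
    using M by (simp only: mult_le_cancel_left_pos)
  moreover have "grad_energy v r \<le> (\<Sum>j\<in>UNIV. \<Sum>l\<in>UNIV. b j l)"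
  proof -
    have "integral (cube r) (\<lambda>x. (\<D> l (v j) x)\<^sup>2) \<le> b j l" for j l
    proof -
      have "integral (cube r) (\<lambda>x. (\<D> l (v j) x)\<^sup>2) = integral (cube r) (\<lambda>x. \<eta> x * (\<D> l (v j) x)\<^sup>2)"
        by (intro integral_cong) (simp add: \<eta>1)
      also have "\<dots> \<le> b j l"
        unfolding b_def
        by (intro integral_subset_le integrable_on_cube cont_supp_integrable cont_supp_multR c\<eta>
            continuous_intros v_cont c\<eta>s) (use bd(3) in auto)
      finally show ?thesis .
    qed
    then have "grad_energy v r \<le> (\<Sum>l\<in>UNIV. \<Sum>j\<in>UNIV. b j l)"
      unfolding grad_energy_def by (intro sum_mono)
    then show ?thesis using sum.swap[of b UNIV UNIV] by simp
  qed
  moreover have "9 * (s1 + s2 / ?M) = energy_const K / d\<^sup>2 * sqrt X"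
  proof -
    have "sqrt q = sqrt X / d\<^sup>2"
      using d by (simp add: q_def real_sqrt_divide power4_eq_xxxx power2_eq_square real_sqrt_mult)
    then show ?thesis
      by (simp add: s1_def s2_def energy_const_def real_sqrt_mult algebra_simps add_divide_distrib)
  qed
  ultimately show ?thesis by (simp add: X_def sE_def sY_def mult.assoc)
qed

section \<open>The Sobolev inequality\<close>

text \<open>Iterated integrals live on nested pairs; this linear map takes boxes to boxes of equal
  content and so transfers them to \<open>real^3\<close>.\<close>

definition vec3 :: "real \<times> real \<times> real \<Rightarrow> real^3" where
  "vec3 p = fst p *\<^sub>R axis 1 1 + fst (snd p) *\<^sub>R axis 2 1 + snd (snd p) *\<^sub>R axis 3 1"

lemma vec3_nth [simp]: "vec3 p $ 1 = fst p" "vec3 p $ 2 = fst (snd p)" "vec3 p $ 3 = snd (snd p)"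
  by (simp_all add: vec3_def axis_def)

lemma continuous_vec3: "continuous_on A vec3"
  unfolding vec3_def[abs_def] by (intro continuous_intros)

lemma vec3_components: "vec3 (x $ 1, x $ 2, x $ 3) = x"
  by (simp add: vec_eq_iff forall_3)

lemma vec3_image_cbox: "vec3 ` cbox a b = cbox (vec3 a) (vec3 b)"
proof -
  obtain a1 a2 a3 b1 b2 b3 where ab: "a = (a1, a2, a3)" "b = (b1, b2, b3)"
    by (metis prod.exhaust)
  show ?thesis
  proof (intro equalityI subsetI)
    fix x assume "x \<in> vec3 ` cbox a b"
    then show "x \<in> cbox (vec3 a) (vec3 b)"
      by (auto simp: ab cbox_Pair_eq mem_box_cart forall_3)
  next
    fix x assume "x \<in> cbox (vec3 a) (vec3 b)"
    then have "(x $ 1, x $ 2, x $ 3) \<in> cbox a b"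
      by (auto simp: ab cbox_Pair_eq mem_box_cart forall_3)
    then show "x \<in> vec3 ` cbox a b"
      by (metis vec3_components imageI)
  qed
qed

lemma content_vec3_cbox:
  "measure lborel (cbox (vec3 a) (vec3 b)) = measure lborel (cbox a b)"
proof -
  obtain a1 a2 a3 b1 b2 b3 where ab: "a = (a1, a2, a3)" "b = (b1, b2, b3)"
    by (metis prod.exhaust)
  show ?thesis
  proof (cases "cbox (vec3 a) (vec3 b) = {}")
    case True
    then have "cbox a b = {}" using vec3_image_cbox[of a b] by simp
    then show ?thesis using True by simp
  next
    case False
    then have "a1 \<le> b1" "a2 \<le> b2" "a3 \<le> b3"
      by (auto simp: ab interval_ne_empty_cart forall_3)
    moreover have "measure lborel (cbox (vec3 a) (vec3 b)) = (b1 - a1) * ((b2 - a2) * (b3 - a3))"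
      unfolding content_cbox_cart[OF False] UNIV_3 by (simp add: ab)
    ultimately show ?thesis by (simp add: ab content_Pair)
  qed
qed

text \<open>A change of variables by \<open>vec3\<close>, with volume factor 1, followed by Fubini
  on nested pairs twice.\<close>

lemma integral_cube_iterated:
  fixes h :: "real^3 \<Rightarrow> real"
  assumes "continuous_on UNIV h"
  shows "integral (cube L) h = integral {-L..L} (\<lambda>x. integral {-L..L} (\<lambda>y. integral {-L..L} (\<lambda>z. h (vec3 (x, y, z)))))"
proof -
  let ?a = "(-L, -L, -L) :: real \<times> real \<times> real" and ?b = "(L, L, L) :: real \<times> real \<times> real"
  define k where "k = (\<lambda>x::real^3. (x $ 1, x $ 2, x $ 3))"
  have kv: "k (vec3 p) = p" for p by (simp add: k_def)
  have vk: "vec3 (k x) = x" for x by (simp add: k_def vec3_components)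
  have kimg: "k ` cbox u w = cbox (k u) (k w)" for u w
  proof -
    have "cbox u w = vec3 ` cbox (k u) (k w)" by (simp add: vec3_image_cbox vk)
    then show ?thesis by (simp add: image_image kv)
  qed
  have cube: "cube L = cbox (vec3 ?a) (vec3 ?b)"
    by (auto simp: cube_def mem_box_cart forall_3)
  have "(h has_integral integral (cube L) h) (cbox (vec3 ?a) (vec3 ?b))"
    using integrable_integral[OF integrable_on_cube[OF assms, of L]] by (simp add: cube)
  then have "((\<lambda>p. h (vec3 p)) has_integral (1 / 1) *\<^sub>R integral (cube L) h) (k ` cbox (vec3 ?a) (vec3 ?b))"
  proof (rule has_integral_twiddle[rotated -1])
    show "continuous (at x) vec3" for x
      using continuous_vec3[of UNIV] by (metis UNIV_I continuous_on_eq_continuous_at open_UNIV)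
    show "\<exists>w z. vec3 ` cbox u v = cbox w z" for u v using vec3_image_cbox by blast
    show "\<exists>w z. k ` cbox u v = cbox w z" for u v using kimg by blast
    show "measure lborel (vec3 ` cbox u v) = 1 * measure lborel (cbox u v)" for u v
      by (simp add: vec3_image_cbox content_vec3_cbox)
  qed (auto simp: kv vk)
  then have "integral (cube L) h = integral (cbox ?a ?b) (\<lambda>p. h (vec3 p))"
    by (simp add: kimg kv integral_unique)
  also have "\<dots> = integral (cbox (-L) L) (\<lambda>x. integral (cbox (-L, -L) (L, L)) (\<lambda>p. h (vec3 (x, p))))"
    by (intro integral_prod_continuous continuous_on_compose2[OF assms continuous_vec3]) auto
  also have "\<dots> = integral (cbox (-L) L) (\<lambda>x. integral (cbox (-L) L) (\<lambda>y. integral (cbox (-L) L) (\<lambda>z. h (vec3 (x, y, z)))))"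
    by (intro integral_cong integral_prod_continuous continuous_on_compose2[OF assms]
        continuous_on_compose2[OF continuous_vec3[of UNIV]] continuous_intros) auto
  finally show ?thesis by simp
qed

section \<open>Continuity of line integrals and order of integration\<close>

context
  fixes L :: real and H :: "real^3 \<Rightarrow> real"
  assumes H: "continuous_on UNIV H"
begin

lemma continuous_line_integrals:
  "continuous_on UNIV (\<lambda>p. integral {-L..L} (\<lambda>x. H (vec3 (x, fst p, snd p))))"
  "continuous_on UNIV (\<lambda>p. integral {-L..L} (\<lambda>y. H (vec3 (fst p, y, snd p))))"
  "continuous_on UNIV (\<lambda>p. integral {-L..L} (\<lambda>z. H (vec3 (fst p, snd p, z))))"
proof -
  note c = continuous_on_compose2[OF H] continuous_on_compose2[OF continuous_vec3[of UNIV]] continuous_intros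
  show "continuous_on UNIV (\<lambda>p. integral {-L..L} (\<lambda>x. H (vec3 (x, fst p, snd p))))"
    unfolding cbox_interval[symmetric]
    by (rule integral_continuous_on_param) (unfold split_beta, (intro c; simp))
  show "continuous_on UNIV (\<lambda>p. integral {-L..L} (\<lambda>y. H (vec3 (fst p, y, snd p))))"
    unfolding cbox_interval[symmetric]
    by (rule integral_continuous_on_param) (unfold split_beta, (intro c; simp))
  show "continuous_on UNIV (\<lambda>p. integral {-L..L} (\<lambda>z. H (vec3 (fst p, snd p, z))))"
    unfolding cbox_interval[symmetric]
    by (rule integral_continuous_on_param) (unfold split_beta, (intro c; simp))
qed

text \<open>In the Sobolev proof the line integrals in the first and second coordinate are
  innermost; these orders are reduced to the one of \<open>integral_cube_iterated\<close>.\<close>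

lemma iterated_integral_permute:
  "integral {-L..L} (\<lambda>y. integral {-L..L} (\<lambda>z. integral {-L..L} (\<lambda>x. H (vec3 (x, y, z))))) = integral (cube L) H"
  "integral {-L..L} (\<lambda>x. integral {-L..L} (\<lambda>z. integral {-L..L} (\<lambda>y. H (vec3 (x, y, z))))) = integral (cube L) H"
proof -
  note c = continuous_on_compose2[OF H] continuous_on_compose2[OF continuous_vec3[of UNIV]] continuous_intros
  have sw: "integral {-L..L} (\<lambda>u. integral {-L..L} (\<lambda>w. F u w)) = integral {-L..L} (\<lambda>w. integral {-L..L} (\<lambda>u. F u w))"
    if "continuous_on UNIV (\<lambda>p. F (fst p) (snd p))" for F :: "real \<Rightarrow> real \<Rightarrow> real"
    unfolding cbox_interval[symmetric]
    by (rule integral_swap_continuous) (use continuous_on_subset[OF that] in \<open>simp add: case_prod_unfold\<close>)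
  have 1: "integral {-L..L} (\<lambda>z. integral {-L..L} (\<lambda>x. H (vec3 (x, y, z))))
     = integral {-L..L} (\<lambda>x. integral {-L..L} (\<lambda>z. H (vec3 (x, y, z))))" for y
    by (rule sw) (intro c; simp)
  have 2: "integral {-L..L} (\<lambda>z. integral {-L..L} (\<lambda>y. H (vec3 (x, y, z))))
     = integral {-L..L} (\<lambda>y. integral {-L..L} (\<lambda>z. H (vec3 (x, y, z))))" for x
    by (rule sw) (intro c; simp)
  have 3: "integral {-L..L} (\<lambda>y. integral {-L..L} (\<lambda>x. integral {-L..L} (\<lambda>z. H (vec3 (x, y, z)))))
    = integral {-L..L} (\<lambda>x. integral {-L..L} (\<lambda>y. integral {-L..L} (\<lambda>z. H (vec3 (x, y, z)))))"
    by (rule sw) (rule continuous_on_compose2[OF continuous_line_integrals(3), of _ "\<lambda>p. (snd p, fst p)", simplified];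
        intro continuous_intros)
  show "integral {-L..L} (\<lambda>y. integral {-L..L} (\<lambda>z. integral {-L..L} (\<lambda>x. H (vec3 (x, y, z))))) = integral (cube L) H"
    unfolding 1 3 by (rule integral_cube_iterated[OF H, symmetric])
  show "integral {-L..L} (\<lambda>x. integral {-L..L} (\<lambda>z. integral {-L..L} (\<lambda>y. H (vec3 (x, y, z))))) = integral (cube L) H"
    unfolding 2 by (rule integral_cube_iterated[OF H, symmetric])
qed

end

section \<open>The Loomis-Whitney inequality and bounds along lines\<close>

lemma Cauchy_Schwarz_interval:
  fixes f g :: "real \<Rightarrow> real"
  assumes "continuous_on UNIV f" "continuous_on UNIV g"
  shows "integral {a..b} (\<lambda>x. f x * g x) \<le> sqrt (integral {a..b} (\<lambda>x. (f x)\<^sup>2)) * sqrt (integral {a..b} (\<lambda>x. (g x)\<^sup>2))"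
proof -
  have "continuous_on {a..b} f" "continuous_on {a..b} g" using assms by (auto intro: continuous_on_subset)
  then have "\<bar>integral {a..b} (\<lambda>x. f x * g x)\<bar> \<le> sqrt (integral {a..b} (\<lambda>x. (f x)\<^sup>2)) * sqrt (integral {a..b} (\<lambda>x. (g x)\<^sup>2))"
    by (intro Cauchy_Schwarz_set_integral integrable_continuous_interval continuous_intros)
  then show ?thesis by simp
qed

text \<open>Cauchy-Schwarz once in each variable: in \<open>z\<close>, where the factor with
  \<open>C\<close> is constant, then in \<open>y\<close>, then in \<open>x\<close>. Each function
  depends on two variables and is used up by the two steps in which it varies.\<close>

lemma Loomis_Whitney:
  fixes A B C :: "real \<times> real \<Rightarrow> real"
  assumes c: "continuous_on UNIV A" "continuous_on UNIV B" "continuous_on UNIV C"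
    and nn: "\<And>p. 0 \<le> A p" "\<And>p. 0 \<le> B p" "\<And>p. 0 \<le> C p"
  shows "integral {-L..L} (\<lambda>x. integral {-L..L} (\<lambda>y. integral {-L..L} (\<lambda>z. sqrt (A (y, z)) * sqrt (B (x, z)) * sqrt (C (x, y)))))
    \<le> sqrt (integral {-L..L} (\<lambda>y. integral {-L..L} (\<lambda>z. A (y, z)))) *
      sqrt (integral {-L..L} (\<lambda>x. integral {-L..L} (\<lambda>z. B (x, z)))) *
      sqrt (integral {-L..L} (\<lambda>x. integral {-L..L} (\<lambda>y. C (x, y))))"
proof -
  let ?J = "\<lambda>f::real \<Rightarrow> real. integral {-L..L} f"
  define \<alpha> \<beta> \<gamma> where "\<alpha> y = sqrt (?J (\<lambda>z. A (y, z)))" and "\<beta> x = sqrt (?J (\<lambda>z. B (x, z)))"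
    and "\<gamma> x = sqrt (?J (\<lambda>y. C (x, y)))" for x y :: real
  have cc: "continuous_on S (\<lambda>x. F (f x, g x))" if "continuous_on UNIV F" "continuous_on S f" "continuous_on S g"
    for F :: "real \<times> real \<Rightarrow> real" and f g :: "'b::topological_space \<Rightarrow> real" and S
    by (rule continuous_on_compose2[OF that(1)]) (use that(2,3) in \<open>auto intro!: continuous_intros\<close>)
  note cABC = cc[OF c(1)] cc[OF c(2)] cc[OF c(3)]
  have cJ: "continuous_on UNIV (\<lambda>x. ?J (\<lambda>y. F (x, y)))" if "continuous_on UNIV F" for F :: "real \<times> real \<Rightarrow> real"
    unfolding cbox_interval[symmetric]
    by (rule integral_continuous_on_param) (use continuous_on_subset[OF that] in \<open>simp add: case_prod_unfold\<close>)
  have J0: "0 \<le> ?J f" if "continuous_on UNIV f" "\<And>x. 0 \<le> f x" for f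
    using that by (intro integral_nonneg integrable_continuous_interval continuous_on_subset[OF that(1)]) auto
  have Jmono: "?J f \<le> ?J g" if "continuous_on UNIV f" "continuous_on UNIV g" "\<And>x. f x \<le> g x" for f g
    using that by (intro integral_le integrable_continuous_interval continuous_on_subset[OF that(1)]
       continuous_on_subset[OF that(2)]) auto
  have cA: "continuous_on UNIV (\<lambda>z. A (y, z))" "continuous_on UNIV (\<lambda>z. B (y, z))" "continuous_on UNIV (\<lambda>z. C (y, z))" for y
    by (intro cABC continuous_intros)+
  have c\<alpha>: "continuous_on UNIV \<alpha>" "continuous_on UNIV \<beta>" "continuous_on UNIV \<gamma>"
    unfolding \<alpha>_def[abs_def] \<beta>_def[abs_def] \<gamma>_def[abs_def] by (intro continuous_intros cJ c)+
  have sq: "(\<alpha> y)\<^sup>2 = ?J (\<lambda>z. A (y, z))" "(\<beta> y)\<^sup>2 = ?J (\<lambda>z. B (y, z))" "(\<gamma> y)\<^sup>2 = ?J (\<lambda>z. C (y, z))" for y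
    by (auto simp: \<alpha>_def \<beta>_def \<gamma>_def intro!: real_sqrt_pow2 J0 cA nn)
  have s0: "0 \<le> \<alpha> y" "0 \<le> \<beta> y" "0 \<le> \<gamma> y" for y
    by (auto simp: \<alpha>_def \<beta>_def \<gamma>_def intro!: J0 cA nn)
  have in1: "?J (\<lambda>z. sqrt (A (y, z)) * sqrt (B (x, z)) * sqrt (C (x, y))) \<le> \<beta> x * (sqrt (C (x, y)) * \<alpha> y)" for x y
  proof -
    have "?J (\<lambda>z. sqrt (A (y, z)) * sqrt (B (x, z)) * sqrt (C (x, y)))
       = ?J (\<lambda>z. sqrt (A (y, z)) * sqrt (B (x, z))) * sqrt (C (x, y))" by simp
    also have "?J (\<lambda>z. sqrt (A (y, z)) * sqrt (B (x, z))) \<le> \<alpha> y * \<beta> x"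
      using Cauchy_Schwarz_interval[of "\<lambda>z. sqrt (A (y, z))" "\<lambda>z. sqrt (B (x, z))" "-L" L] cA nn
      by (simp add: \<alpha>_def \<beta>_def continuous_intros)
    finally show ?thesis using nn(3)[of "(x, y)"] by (simp add: mult_right_mono mult_ac)
  qed
  have in2: "?J (\<lambda>y. \<beta> x * (sqrt (C (x, y)) * \<alpha> y)) \<le> \<beta> x * (\<gamma> x * sqrt (?J (\<lambda>y. ?J (\<lambda>z. A (y, z)))))" for x
  proof -
    have "?J (\<lambda>y. sqrt (C (x, y)) * \<alpha> y) \<le> \<gamma> x * sqrt (?J (\<lambda>y. ?J (\<lambda>z. A (y, z))))"
      using Cauchy_Schwarz_interval[of "\<lambda>y. sqrt (C (x, y))" \<alpha> "-L" L] cA c\<alpha> nn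
      by (simp add: \<gamma>_def sq continuous_intros)
    then show ?thesis using s0 by (simp add: mult_left_mono)
  qed
  have c3: "continuous_on UNIV (\<lambda>p. ?J (\<lambda>z. sqrt (A (snd p, z)) * sqrt (B (fst p, z)) * sqrt (C (fst p, snd p))))"
    unfolding cbox_interval[symmetric]
    by (rule integral_continuous_on_param)
      (unfold split_beta, intro continuous_intros cABC)
  have "?J (\<lambda>x. ?J (\<lambda>y. ?J (\<lambda>z. sqrt (A (y, z)) * sqrt (B (x, z)) * sqrt (C (x, y)))))
     \<le> ?J (\<lambda>x. \<beta> x * (\<gamma> x * sqrt (?J (\<lambda>y. ?J (\<lambda>z. A (y, z))))))"
  proof (rule Jmono)
    show "continuous_on UNIV (\<lambda>x. ?J (\<lambda>y. ?J (\<lambda>z. sqrt (A (y, z)) * sqrt (B (x, z)) * sqrt (C (x, y)))))"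
      using cJ[OF c3] by simp
    show "continuous_on UNIV (\<lambda>x. \<beta> x * (\<gamma> x * sqrt (?J (\<lambda>y. ?J (\<lambda>z. A (y, z))))))"
      by (intro continuous_intros c\<alpha>)
    fix x
    have "continuous_on UNIV (\<lambda>y. ?J (\<lambda>z. sqrt (A (y, z)) * sqrt (B (x, z)) * sqrt (C (x, y))))"
      using cc[OF c3, of UNIV "\<lambda>y. x" "\<lambda>y. y"] by (simp add: continuous_intros)
    then have "?J (\<lambda>y. ?J (\<lambda>z. sqrt (A (y, z)) * sqrt (B (x, z)) * sqrt (C (x, y))))
       \<le> ?J (\<lambda>y. \<beta> x * (sqrt (C (x, y)) * \<alpha> y))"
      by (rule Jmono[OF _ _ in1]) (intro continuous_intros cA c\<alpha>)
    then show "?J (\<lambda>y. ?J (\<lambda>z. sqrt (A (y, z)) * sqrt (B (x, z)) * sqrt (C (x, y))))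
       \<le> \<beta> x * (\<gamma> x * sqrt (?J (\<lambda>y. ?J (\<lambda>z. A (y, z)))))" using in2[of x] by simp
  qed
  also have "\<dots> = ?J (\<lambda>x. \<beta> x * \<gamma> x) * sqrt (?J (\<lambda>y. ?J (\<lambda>z. A (y, z))))"
    by (simp flip: mult.assoc)
  also have "\<dots> \<le> (sqrt (?J (\<lambda>x. ?J (\<lambda>z. B (x, z)))) * sqrt (?J (\<lambda>x. ?J (\<lambda>y. C (x, y))))) * sqrt (?J (\<lambda>y. ?J (\<lambda>z. A (y, z))))"
    using Cauchy_Schwarz_interval[OF c\<alpha>(2,3), of "-L" L]
    by (intro mult_right_mono) (auto simp: sq intro!: J0 cJ c cA nn)
  finally show ?thesis by (simp add: mult_ac)
qed

text \<open>The fundamental theorem of calculus from the left endpoint, where \<open>F\<close>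
  vanishes.\<close>

lemma line_integral_bound:
  fixes F F' :: "real \<Rightarrow> real"
  assumes d: "\<And>s. (F has_real_derivative F' s) (at s)" and c: "continuous_on UNIV F'"
    and F0: "F (-L) = 0" and s: "s \<in> {-L..L}"
  shows "\<bar>F s\<bar> \<le> integral {-L..L} (\<lambda>s. \<bar>F' s\<bar>)"
proof -
  have i: "(\<lambda>s. \<bar>F' s\<bar>) integrable_on {a..b}" "F' integrable_on {a..b}" for a b
    by (intro integrable_continuous_interval continuous_intros continuous_on_subset[OF c] subset_UNIV)+
  have "(F' has_integral F s - F (-L)) {-L..s}"
    using d s by (intro fundamental_theorem_of_calculus)
      (auto simp: has_real_derivative_iff_has_vector_derivative[symmetric] intro: has_field_derivative_at_within)
  then have "F s = integral {-L..s} F'" using F0 by (simp add: integral_unique)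
  also have "\<bar>\<dots>\<bar> \<le> integral {-L..s} (\<lambda>s. \<bar>F' s\<bar>)"
    using integral_norm_bound_integral[OF i(2) i(1), of "-L" s] by simp
  also have "\<dots> \<le> integral {-L..L} (\<lambda>s. \<bar>F' s\<bar>)"
    using s by (intro integral_subset_le i) auto
  finally show ?thesis .
qed

text \<open>The Gagliardo-Nirenberg argument: Loomis-Whitney applied to \<open>f\<^sup>4\<close>.\<close>

lemma Sobolev:
  assumes f: "C_class 1 f" "cont_supp f"
  shows "integral UNIV (\<lambda>x. (f x) ^ 6)
    \<le> 4096 * (\<Sum>i\<in>UNIV. integral UNIV (\<lambda>x. (\<D> i f x)\<^sup>2)) ^ 3"
proof -
  obtain r where r: "\<And>x. x \<notin> cube r \<Longrightarrow> f x = 0" using f(2) unfolding cont_supp_def by blast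
  \<comment> \<open>Strictly larger than \<open>r\<close>, so that \<open>f\<close> vanishes on the
    faces \<open>x $ i = - L\<close>, where the lines start.\<close>
  define L where "L = \<bar>r\<bar> + 1"
  have rL: "cube r \<subseteq> cube L" by (intro cube_mono) (simp add: L_def)
  have fL: "f x = 0" if "x \<notin> cube L" for x using that rL r by blast
  have f0: "f x = 0" if "x $ i = - L" for x i
  proof (rule r)
    have "\<not> \<bar>x $ i\<bar> \<le> r" using that by (simp add: L_def)
    then show "x \<notin> cube r" by (auto simp: mem_cube)
  qed
  have cf: "continuous_on A f" and cd: "continuous_on A (\<D> i f)" for A i
    using C_class_1D(2,3)[OF f(1)] by auto
  \<comment> \<open>The absolute value of the i-th derivative of \<open>f ^ 4\<close>; its integral
    along a line in direction \<open>i\<close> bounds \<open>f ^ 4\<close> on that line.\<close>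
  define H where "H i = (\<lambda>x. \<bar>4 * f x ^ 3 * \<D> i f x\<bar>)" for i
  have cH: "continuous_on UNIV (H i)" for i unfolding H_def by (intro continuous_intros cf cd)
  define A where "A p = integral {-L..L} (\<lambda>x. H 1 (vec3 (x, fst p, snd p)))" for p
  define B where "B p = integral {-L..L} (\<lambda>y. H 2 (vec3 (fst p, y, snd p)))" for p
  define C where "C p = integral {-L..L} (\<lambda>z. H 3 (vec3 (fst p, snd p, z)))" for p
  have cABC: "continuous_on UNIV A" "continuous_on UNIV B" "continuous_on UNIV C"
    unfolding A_def B_def C_def by (intro continuous_line_integrals cH)+
  have line: "((\<lambda>s. f (p + s *\<^sub>R axis i 1) ^ 4) has_real_derivative
      4 * f (p + s *\<^sub>R axis i 1) ^ 3 * \<D> i f (p + s *\<^sub>R axis i 1)) (at s)" for p i s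
  proof -
    have "(\<Sum>j\<in>UNIV. (axis i 1 :: real^3) $ j * g j) = g i" for g :: "3 \<Rightarrow> real"
      by (simp add: axis_def if_distrib[of "\<lambda>x. x * _"] cong: if_cong)
    then have "((\<lambda>s. f (p + s *\<^sub>R axis i 1)) has_real_derivative \<D> i f (p + s *\<^sub>R axis i 1)) (at s)"
      using has_derivative_line[OF C_class_1D(1)[OF f(1)], of p "axis i 1" s] by simp
    from DERIV_power[OF this, of 4] show ?thesis by (simp add: mult_ac)
  qed
  have b: "f (p + s *\<^sub>R axis i 1) ^ 4 \<le> integral {-L..L} (\<lambda>s. H i (p + s *\<^sub>R axis i 1))"
    if "p $ i = 0" "s \<in> {-L..L}" for p i s
  proof -
    have "\<bar>f (p + s *\<^sub>R axis i 1) ^ 4\<bar> \<le> integral {-L..L} (\<lambda>s. H i (p + s *\<^sub>R axis i 1))"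
      unfolding H_def
    proof (rule line_integral_bound[OF line _ _ that(2)])
      show "continuous_on UNIV (\<lambda>s. 4 * f (p + s *\<^sub>R axis i 1) ^ 3 * \<D> i f (p + s *\<^sub>R axis i 1))"
        by (intro continuous_intros continuous_on_compose2[OF cf[of UNIV]] continuous_on_compose2[OF cd[of UNIV]]) auto
      show "f (p + (- L) *\<^sub>R axis i 1) ^ 4 = 0" using that(1) by (subst f0[of _ i]) auto
    qed
    then show ?thesis by simp
  qed
  have v: "vec3 (x, y, z) = vec3 (0, y, z) + x *\<^sub>R axis 1 1" "vec3 (x, y, z) = vec3 (x, 0, z) + y *\<^sub>R axis 2 1"
    "vec3 (x, y, z) = vec3 (x, y, 0) + z *\<^sub>R axis 3 1" for x y z
    by (simp_all add: vec3_def)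
  have bA: "f (vec3 (x, y, z)) ^ 4 \<le> A (y, z)" if "x \<in> {-L..L}" for x y z
    using b[of "vec3 (0, y, z)" 1 x] that by (simp add: A_def flip: v)
  have bB: "f (vec3 (x, y, z)) ^ 4 \<le> B (x, z)" if "y \<in> {-L..L}" for x y z
    using b[of "vec3 (x, 0, z)" 2 y] that by (simp add: B_def flip: v)
  have bC: "f (vec3 (x, y, z)) ^ 4 \<le> C (x, y)" if "z \<in> {-L..L}" for x y z
    using b[of "vec3 (x, y, 0)" 3 z] that by (simp add: C_def flip: v)
  have nn: "0 \<le> A p" "0 \<le> B p" "0 \<le> C p" for p
    unfolding A_def B_def C_def
    by (intro integral_nonneg integrable_continuous_interval continuous_on_compose2[OF cH]
        continuous_on_compose2[OF continuous_vec3[of UNIV]] continuous_intros; simp add: H_def)+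
  define Z where "Z = integral UNIV (\<lambda>x. (f x) ^ 6)"
  define D where "D = (\<Sum>i\<in>UNIV. integral UNIV (\<lambda>x. (\<D> i f x)\<^sup>2))"
  have cdf: "cont_supp (\<D> i f)" for i by (rule cont_supp_partial_deriv[OF f])
  have D0: "0 \<le> integral UNIV (\<lambda>x. (\<D> i f x)\<^sup>2)" for i
    by (intro integral_nonneg cont_supp_integrable cont_supp_power2 cdf) simp
  have Dp: "0 \<le> D" unfolding D_def by (intro sum_nonneg D0)
  have cf3: "cont_supp (\<lambda>x. f x ^ 3)"
    using cont_supp_multL[of "\<lambda>x. f x ^ 2" f] f(2) cf
    by (simp add: power3_eq_cube power2_eq_square mult.assoc continuous_intros)
  have Z_eq: "Z = integral UNIV (\<lambda>x. (f x ^ 3)\<^sup>2)" by (simp add: Z_def flip: power_mult)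
  have Z0: "0 \<le> Z" unfolding Z_eq by (intro integral_nonneg cont_supp_integrable cont_supp_power2 cf3) simp
  have Z_cube: "Z = integral (cube L) (\<lambda>x. (f x) ^ 6)"
    unfolding Z_def using fL by (intro integral_UNIV_cube continuous_intros cf) auto
  let ?I = "\<lambda>i. integral (cube L) (H i)"
  \<comment> \<open>Cauchy-Schwarz separates \<open>f ^ 3\<close> from the derivative. The square of
    \<open>f ^ 3\<close> reproduces \<open>Z\<close>, which is absorbed at the end.\<close>
  have I: "?I i \<le> 4 * sqrt Z * sqrt D" "0 \<le> ?I i" for i
  proof -
    show "0 \<le> ?I i" by (intro integral_nonneg integrable_on_cube cH) (simp add: H_def)
    have "?I i = 4 * integral (cube L) (\<lambda>x. \<bar>f x ^ 3\<bar> * \<bar>\<D> i f x\<bar>)"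
      unfolding H_def by (simp add: abs_mult mult.assoc flip: integral_mult_right)
    also have "integral (cube L) (\<lambda>x. \<bar>f x ^ 3\<bar> * \<bar>\<D> i f x\<bar>)
       \<le> sqrt (integral (cube L) (\<lambda>x. (\<bar>f x ^ 3\<bar>)\<^sup>2)) * sqrt (integral (cube L) (\<lambda>x. (\<bar>\<D> i f x\<bar>)\<^sup>2))"
      by (intro order_trans[OF abs_ge_self Cauchy_Schwarz_set_integral] integrable_on_cube continuous_intros cf cd)
    also have "integral (cube L) (\<lambda>x. (\<bar>f x ^ 3\<bar>)\<^sup>2) = Z"
      unfolding Z_cube by (simp flip: power_mult)
    also have "integral (cube L) (\<lambda>x. (\<bar>\<D> i f x\<bar>)\<^sup>2) \<le> D"
    proof -
      have "integral (cube L) (\<lambda>x. (\<bar>\<D> i f x\<bar>)\<^sup>2) \<le> integral UNIV (\<lambda>x. (\<D> i f x)\<^sup>2)"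
        by (simp, intro integral_subset_le integrable_on_cube cont_supp_integrable cont_supp_power2 cdf continuous_intros cd) auto
      also have "\<dots> \<le> D" unfolding D_def
        by (rule member_le_sum[of i UNIV "\<lambda>i. integral UNIV (\<lambda>x. (\<D> i f x)\<^sup>2)"]) (auto intro: D0)
      finally show ?thesis .
    qed
    finally show "?I i \<le> 4 * sqrt Z * sqrt D" using Z0 by (simp add: mult_left_mono)
  qed
  \<comment> \<open>\<open>f ^ 6\<close> is a product of three factors \<open>f ^ 2\<close>, each
    bounded by the square root of one of the line integrals.\<close>
  have ptw: "f (vec3 (x, y, z)) ^ 6 \<le> sqrt (A (y, z)) * sqrt (B (x, z)) * sqrt (C (x, y))"
    if "x \<in> {-L..L}" "y \<in> {-L..L}" "z \<in> {-L..L}" for x y z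
  proof -
    have sq: "f (vec3 (x, y, z)) ^ 2 \<le> sqrt E" if "f (vec3 (x, y, z)) ^ 4 \<le> E" for E
      using that by (intro real_le_rsqrt) (simp flip: power_mult)
    have "f (vec3 (x, y, z)) ^ 6 = (f (vec3 (x, y, z)))\<^sup>2 * (f (vec3 (x, y, z)))\<^sup>2 * (f (vec3 (x, y, z)))\<^sup>2"
      by (simp flip: power_add)
    also have "\<dots> \<le> sqrt (A (y, z)) * sqrt (B (x, z)) * sqrt (C (x, y))"
      using that nn by (intro mult_mono sq bA bB bC) auto
    finally show ?thesis .
  qed
  have "Z = integral {-L..L} (\<lambda>x. integral {-L..L} (\<lambda>y. integral {-L..L} (\<lambda>z. f (vec3 (x, y, z)) ^ 6)))"
    unfolding Z_cube by (rule integral_cube_iterated) (intro continuous_intros cf)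
  also have "\<dots> \<le> integral {-L..L} (\<lambda>x. integral {-L..L} (\<lambda>y. integral {-L..L} (\<lambda>z. sqrt (A (y, z)) * sqrt (B (x, z)) * sqrt (C (x, y)))))"
  proof -
    have c1: "continuous_on UNIV (\<lambda>p. sqrt (A (fst (snd p), snd (snd p))) * sqrt (B (fst p, snd (snd p))) * sqrt (C (fst p, fst (snd p))))"
      by (intro continuous_intros continuous_on_compose2[OF cABC(1)] continuous_on_compose2[OF cABC(2)]
        continuous_on_compose2[OF cABC(3)]) auto
    have c2: "continuous_on UNIV (\<lambda>p. f (vec3 p) ^ 6)"
      by (intro continuous_intros continuous_on_compose2[OF cf[of UNIV] continuous_vec3]) auto
    have inner: "continuous_on UNIV (\<lambda>z. G (x, y, z))"
      "continuous_on UNIV (\<lambda>y. integral {-L..L} (\<lambda>z. G (x, y, z)))"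
      "continuous_on UNIV (\<lambda>x. integral {-L..L} (\<lambda>y. integral {-L..L} (\<lambda>z. G (x, y, z))))"
      if G: "continuous_on UNIV G" for G :: "real \<times> real \<times> real \<Rightarrow> real" and x y
    proof -
      show "continuous_on UNIV (\<lambda>z. G (x, y, z))"
        by (rule continuous_on_compose2[OF G]) (auto intro!: continuous_intros)
      have c3: "continuous_on UNIV (\<lambda>p. integral (cbox (-L) L) (\<lambda>z. G (fst p, snd p, z)))"
        by (rule integral_continuous_on_param, unfold split_beta)
          (rule continuous_on_compose2[OF G], auto intro!: continuous_intros)
      have "continuous_on UNIV (\<lambda>y. (x, y))" by (intro continuous_intros)
      from continuous_on_compose2[OF c3 this]
      show "continuous_on UNIV (\<lambda>y. integral {-L..L} (\<lambda>z. G (x, y, z)))" by simp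
      have "continuous_on UNIV (\<lambda>x. integral (cbox (-L) L) (\<lambda>y. integral (cbox (-L) L) (\<lambda>z. G (x, y, z))))"
        by (rule integral_continuous_on_param) (use continuous_on_subset[OF c3] in \<open>simp add: case_prod_unfold\<close>)
      then show "continuous_on UNIV (\<lambda>x. integral {-L..L} (\<lambda>y. integral {-L..L} (\<lambda>z. G (x, y, z))))" by simp
    qed
    note i1 = inner[OF c1, THEN continuous_on_subset, OF subset_UNIV, unfolded fst_conv snd_conv]
    note i2 = inner[OF c2, THEN continuous_on_subset, OF subset_UNIV]
    show ?thesis
      by (intro integral_le integrable_continuous_interval i1 i2 ptw)
  qed
  also have "\<dots> \<le> sqrt (integral {-L..L} (\<lambda>y. integral {-L..L} (\<lambda>z. A (y, z)))) *
      sqrt (integral {-L..L} (\<lambda>x. integral {-L..L} (\<lambda>z. B (x, z)))) *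
      sqrt (integral {-L..L} (\<lambda>x. integral {-L..L} (\<lambda>y. C (x, y))))"
    by (rule Loomis_Whitney[OF cABC nn])
  also have "\<dots> = sqrt (?I 1) * sqrt (?I 2) * sqrt (?I 3)"
    unfolding A_def B_def C_def
    by (simp add: iterated_integral_permute[OF cH] integral_cube_iterated[OF cH])
  finally have Zle: "Z \<le> sqrt (?I 1) * sqrt (?I 2) * sqrt (?I 3)" .
  have "Z\<^sup>2 \<le> (sqrt (?I 1) * sqrt (?I 2) * sqrt (?I 3))\<^sup>2"
    using Zle Z0 by (rule power_mono)
  also have "\<dots> = ?I 1 * ?I 2 * ?I 3"
    using I(2) by (simp add: power_mult_distrib)
  also have "\<dots> \<le> (4 * sqrt Z * sqrt D) * (4 * sqrt Z * sqrt D) * (4 * sqrt Z * sqrt D)"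
    using I Z0 Dp by (intro mult_mono) auto
  \<comment> \<open>Cancelling \<open>(sqrt Z) ^ 3\<close>, possible if \<open>Z \<noteq> 0\<close>,
    leaves \<open>sqrt Z \<le> 64 * (sqrt D) ^ 3\<close>; squaring gives 4096.\<close>
  finally have main: "Z\<^sup>2 \<le> 64 * (sqrt Z) ^ 3 * (sqrt D) ^ 3"
    by (simp only: power3_eq_cube mult_ac)
  show ?thesis
  proof (cases "Z = 0")
    case True
    then show ?thesis using Dp by (simp add: Z_def D_def)
  next
    case False
    then have Zp: "0 < sqrt Z" using Z0 by simp
    have "Z\<^sup>2 = sqrt Z * (sqrt Z) ^ 3"
      using Z0 by (simp add: power3_eq_cube power2_eq_square)
    with main have "sqrt Z * (sqrt Z) ^ 3 \<le> (64 * (sqrt D) ^ 3) * (sqrt Z) ^ 3" by (simp add: mult_ac)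
    then have "sqrt Z \<le> 64 * (sqrt D) ^ 3" using Zp by (simp only: mult_le_cancel_right) simp
    then have "(sqrt Z)\<^sup>2 \<le> (64 * (sqrt D) ^ 3)\<^sup>2" using Zp by (intro power_mono) auto
    also have "\<dots> = 4096 * ((sqrt D)\<^sup>2) ^ 3" by (simp add: power_mult_distrib flip: power_mult)
    also have "\<dots> = 4096 * D ^ 3" by (simp only: real_sqrt_pow2[OF Dp])
    finally have "Z \<le> 4096 * D ^ 3" using Z0 by (simp only: real_sqrt_pow2)
    then show ?thesis by (simp only: Z_def D_def)
  qed
qed

section \<open>Interpolation and iteration\<close>

text \<open>Splitting at the level \<open>\<kappa>\<close>: below it the surplus power over
  \<open>q\<close> is bounded by \<open>\<kappa>\<close>, above it the deficit to 6 is. Integrated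
  with a suitable \<open>\<kappa>\<close>, this interpolates between L^q and L^6.\<close>

lemma power_interpolation:
  fixes a \<kappa> q :: real
  assumes a: "0 \<le> a" and l: "0 < \<kappa>" and q: "q \<le> real n" "n \<le> 6" "0 < n"
  shows "a ^ n \<le> \<kappa> powr (real n - q) * a powr q + \<kappa> powr (real n - 6) * a ^ 6"
proof (cases "a = 0")
  case True
  then show ?thesis using q by (simp add: zero_power)
next
  case False
  then have a0: "0 < a" using a by simp
  have an: "a ^ n = a powr real n" "a ^ 6 = a powr 6"
    using a0 by (simp_all add: powr_realpow flip: powr_numeral)
  show ?thesis
  proof (cases "a \<le> \<kappa>")
    case True
    have "a ^ n = a powr (real n - q) * a powr q" unfolding an powr_add[symmetric] by simp
    also have "\<dots> \<le> \<kappa> powr (real n - q) * a powr q"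
      using True a0 q by (intro mult_right_mono powr_mono2) auto
    also have "\<dots> \<le> \<kappa> powr (real n - q) * a powr q + \<kappa> powr (real n - 6) * a ^ 6"
      using a0 by simp
    finally show ?thesis .
  next
    case False
    have "a ^ n = a powr (real n - 6) * a ^ 6" unfolding an powr_add[symmetric] by simp
    also have "\<dots> \<le> \<kappa> powr (real n - 6) * a ^ 6"
      using False l q a0 by (intro mult_right_mono powr_mono2') auto
    also have "\<dots> \<le> \<kappa> powr (real n - q) * a powr q + \<kappa> powr (real n - 6) * a ^ 6"
      using a0 by simp
    finally show ?thesis .
  qed
qed

text \<open>With \<open>\<alpha> + \<beta> n = ln A + 2 (n + 1) + \<gamma> (\<alpha> + \<beta> (n + 1))\<close> the excess of \<open>ln (G (2 - 2\<^sup>-\<^sup>n))\<close>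
  over \<open>\<alpha> + \<beta> n\<close> contracts by the factor \<open>\<gamma>\<close> in each step.\<close>

lemma sublinear_iteration:
  fixes G :: "real \<Rightarrow> real"
  assumes G1: "\<And>r. 1 \<le> r \<Longrightarrow> r \<le> 2 \<Longrightarrow> 1 \<le> G r" and GL: "\<And>r. 1 \<le> r \<Longrightarrow> r \<le> 2 \<Longrightarrow> G r \<le> \<Lambda>"
    and step: "\<And>r d. 1 \<le> r \<Longrightarrow> 0 < d \<Longrightarrow> r + d \<le> 2 \<Longrightarrow> G r \<le> A / d\<^sup>2 * G (r + d) powr \<gamma>"
    and A: "1 \<le> A" and \<gamma>: "0 \<le> \<gamma>" "\<gamma> < 1"
  shows "G 1 \<le> exp ((ln A + 2 + \<gamma> * (2 / (1 - \<gamma>))) / (1 - \<gamma>))"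
proof -
  define \<beta> where "\<beta> = 2 / (1 - \<gamma>)"
  define \<alpha> where "\<alpha> = (ln A + 2 + \<gamma> * \<beta>) / (1 - \<gamma>)"
  \<comment> \<open>Radii from 1 towards 2 with gaps \<open>1 / 2 ^ Suc n\<close>: the loss
    \<open>1 / d\<^sup>2\<close> grows like \<open>4 ^ n\<close>, hence linearly in \<open>n\<close>
    after taking logarithms.\<close>
  define \<rho> where "\<rho> n = (2::real) - 1 / 2 ^ n" for n :: nat
  have \<rho>: "1 \<le> \<rho> n" "\<rho> n \<le> 2" for n
    by (simp_all add: \<rho>_def)
  have \<beta>e: "\<beta> = 2 + \<gamma> * \<beta>" and \<alpha>e: "\<alpha> = ln A + 2 + \<gamma> * \<beta> + \<gamma> * \<alpha>"
  proof -
    have "\<beta> * (1 - \<gamma>) = 2" "\<alpha> * (1 - \<gamma>) = ln A + 2 + \<gamma> * \<beta>"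
      unfolding \<beta>_def \<alpha>_def by (rule nonzero_eq_divide_eq[THEN iffD1]; use \<gamma> in simp)+
    then show "\<beta> = 2 + \<gamma> * \<beta>" "\<alpha> = ln A + 2 + \<gamma> * \<beta> + \<gamma> * \<alpha>"
      by (simp_all add: algebra_simps)
  qed
  have \<alpha>0: "0 \<le> \<alpha>" "0 \<le> \<beta>" using \<gamma> A by (simp_all add: \<alpha>_def \<beta>_def)
  define e where "e n = ln (G (\<rho> n)) - (\<alpha> + \<beta> * real n)" for n
  have es: "e n \<le> \<gamma> * e (Suc n)" for n
  proof -
    have sum: "\<rho> n + 1 / 2 ^ Suc n = \<rho> (Suc n)" by (simp add: \<rho>_def field_simps)
    have "G (\<rho> n) \<le> A / (1 / 2 ^ Suc n)\<^sup>2 * G (\<rho> (Suc n)) powr \<gamma>"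
      using step[OF \<rho>(1), of "1 / 2 ^ Suc n" n] \<rho>(2)[of "Suc n"] unfolding sum by simp
    moreover have Gp: "0 < G (\<rho> n)" "0 < G (\<rho> (Suc n))" using G1[OF \<rho>, of n] G1[OF \<rho>, of "Suc n"] by auto
    ultimately have "ln (G (\<rho> n)) \<le> ln (A / (1 / 2 ^ Suc n)\<^sup>2 * G (\<rho> (Suc n)) powr \<gamma>)"
      by (subst ln_le_cancel_iff) (use A in auto)
    also have "\<dots> = ln A + 2 * (real n + 1) * ln 2 + \<gamma> * ln (G (\<rho> (Suc n)))"
    proof -
      have "A / (1 / 2 ^ Suc n)\<^sup>2 = A * (2 ^ Suc n)\<^sup>2" by (simp add: power_divide)
      also have "(2 ^ Suc n)\<^sup>2 = (2::real) ^ (2 * Suc n)" by (simp only: power_mult[symmetric] mult.commute)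
      finally have eq: "A / (1 / 2 ^ Suc n)\<^sup>2 = A * 2 ^ (2 * Suc n)" .
      have "ln (A * 2 ^ (2 * Suc n) * G (\<rho> (Suc n)) powr \<gamma>)
          = ln A + ln (2 ^ (2 * Suc n)) + ln (G (\<rho> (Suc n)) powr \<gamma>)"
        using Gp A by (subst ln_mult, simp, simp, subst ln_mult) auto
      also have "ln (2 ^ (2 * Suc n) :: real) = 2 * (real n + 1) * ln 2"
        by (subst ln_realpow) (simp_all add: algebra_simps)
      also have "ln (G (\<rho> (Suc n)) powr \<gamma>) = \<gamma> * ln (G (\<rho> (Suc n)))"
        using Gp by (simp add: ln_powr)
      finally show ?thesis unfolding eq .
    qed
    also have "\<dots> \<le> ln A + 2 * (real n + 1) + \<gamma> * ln (G (\<rho> (Suc n)))"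
      using mult_left_mono[of "ln 2" 1 "2 * (real n + 1)"] ln_2_less_1 by simp
    finally have "ln (G (\<rho> n)) \<le> ln A + 2 * (real n + 1) + \<gamma> * ln (G (\<rho> (Suc n)))" .
    moreover have "\<alpha> + \<beta> * real n = ln A + 2 * (real n + 1) + \<gamma> * (\<alpha> + \<beta> * real (Suc n))"
    proof -
      have "\<beta> * real n = 2 * real n + \<gamma> * \<beta> * real n" by (metis \<beta>e distrib_right)
      moreover have eq: "\<gamma> * (\<alpha> + \<beta> * real (Suc n)) = \<gamma> * \<alpha> + \<gamma> * \<beta> * real n + \<gamma> * \<beta>"
        by (simp add: algebra_simps)
      ultimately show ?thesis unfolding eq using \<alpha>e by (simp only: distrib_left)
    qed
    ultimately show ?thesis by (simp add: e_def right_diff_distrib)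
  qed
  have "e 0 \<le> \<gamma> ^ n * e n" for n
  proof (induction n)
    case (Suc n)
    then show ?case using mult_left_mono[OF es, of "\<gamma> ^ n" n] \<gamma> by (simp add: mult_ac)
  qed simp
  \<comment> \<open>\<open>\<Lambda>\<close> appears with the factor \<open>\<gamma> ^ n\<close>,
    which tends to 0, so the final bound is independent of it.\<close>
  moreover have "\<gamma> ^ n * e n \<le> \<gamma> ^ n * ln \<Lambda>" for n
  proof -
    have "ln (G (\<rho> n)) \<le> ln \<Lambda>"
      using G1[OF \<rho>, of n] GL[OF \<rho>, of n] by simp
    then have "e n \<le> ln \<Lambda>" using \<alpha>0 by (simp add: e_def add_nonneg_nonneg add_increasing2 diff_le_eq)
    then show ?thesis using \<gamma> by (intro mult_left_mono) auto
  qed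
  ultimately have "e 0 \<le> \<gamma> ^ n * ln \<Lambda>" for n using order_trans by blast
  moreover have "(\<lambda>n. \<gamma> ^ n * ln \<Lambda>) \<longlonglongrightarrow> 0 * ln \<Lambda>"
    using \<gamma> by (intro tendsto_mult LIMSEQ_power_zero tendsto_const) simp
  ultimately have "e 0 \<le> 0"
    by (intro LIMSEQ_le_const[of _ 0]) auto
  then have "ln (G 1) \<le> \<alpha>" by (simp add: e_def \<rho>_def)
  moreover have "G 1 = exp (ln (G 1))" using G1[of 1] by simp
  ultimately have "G 1 \<le> exp \<alpha>" by (metis exp_le_cancel_iff)
  then show ?thesis by (simp add: \<alpha>_def \<beta>_def)
qed

section \<open>Local Sobolev and interpolation estimates on cubes\<close>

context divergence_free
begin

lemma moment_mono: "even n \<Longrightarrow> r \<le> s \<Longrightarrow> moment n v r \<le> moment n v s"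
  unfolding moment_def
  by (intro sum_mono integral_subset_le cube_mono integrable_on_cube continuous_intros v_cont) auto

lemma grad_energy_mono: "r \<le> s \<Longrightarrow> grad_energy v r \<le> grad_energy v s"
  unfolding grad_energy_def
  by (intro sum_mono integral_subset_le cube_mono integrable_on_cube continuous_intros v_cont) auto

text \<open>The Sobolev inequality for each \<open>\<eta> * v j\<close>; the gradient of the cutoff
  accounts for the second moment.\<close>

lemma local_Sobolev:
  assumes cutoff: "cutoff_bound K" and d: "0 < d"
  shows "moment 6 v r \<le> (144 * (K\<^sup>2 / d\<^sup>2 * moment 2 v (r + d) + grad_energy v (r + d))) ^ 3"
proof -
  obtain \<eta> where \<eta>: "bounded_C2 (K / d) (K / d\<^sup>2) \<eta>"
    and \<eta>1: "\<And>x. x \<in> cube r \<Longrightarrow> \<eta> x = 1" and \<eta>0: "\<And>x. x \<notin> cube (r + d) \<Longrightarrow> \<eta> x = 0"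
    using cutoff_boundE[OF cutoff d, of r] by blast
  have \<eta>2: "C_class 2 \<eta>" using \<eta> by (simp add: bounded_C2_def)
  have bd: "\<bar>\<eta> x\<bar> \<le> 1" "\<bar>\<D> i \<eta> x\<bar> \<le> K / d" for i x
    using \<eta> by (auto simp: bounded_C2_def)
  have c\<eta>: "cont_supp \<eta>" using C_class_2D(3)[OF \<eta>2] \<eta>0 by (rule cont_suppI)
  have d\<eta>0: "\<D> i \<eta> y = 0" if "y \<notin> cube (r + d)" for i y
    by (rule partial_deriv_eq_0[of "- cube (r + d)" _ _ 0])
      (use that \<eta>0 in \<open>auto simp: cube_def open_Compl\<close>)
  define T where "T = K\<^sup>2 / d\<^sup>2 * moment 2 v (r + d) + grad_energy v (r + d)"
  have T0: "0 \<le> T" by (simp add: T_def moment_nonneg grad_energy_nonneg)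
  have each: "integral (cube r) (\<lambda>x. (v j x) ^ 6) \<le> 4096 * (6 * T) ^ 3" for j
  proof -
    let ?f = "\<lambda>x. \<eta> x * v j x"
    have f1: "C_class 1 ?f" by (intro C_class_mult C_class_2D(1) \<eta>2 v_C2)
    have fc: "cont_supp ?f" by (intro cont_supp_multR c\<eta> v_cont)
    have df: "\<D> i ?f x = \<D> i \<eta> x * v j x + \<eta> x * \<D> i (v j) x" for i x
      by (intro partial_deriv_mult C_class_1D(1)[OF C_class_2D(1)] \<eta>2 v_C2)
    have cdf: "cont_supp (\<D> i ?f)" for i by (rule cont_supp_partial_deriv[OF f1 fc])
    have f6: "cont_supp (\<lambda>x. ?f x ^ 6)"
      using cont_supp_multL[OF _ fc, of "\<lambda>x. ?f x ^ 5"] cont_supp_cont[OF fc]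
      by (simp add: continuous_intros flip: power_Suc2)
    have "integral (cube r) (\<lambda>x. (v j x) ^ 6) = integral (cube r) (\<lambda>x. ?f x ^ 6)"
      by (intro integral_cong) (simp add: \<eta>1)
    also have "\<dots> \<le> integral UNIV (\<lambda>x. ?f x ^ 6)"
      using f6 cont_supp_cont[OF f6]
      by (intro integral_subset_le integrable_on_cube cont_supp_integrable) auto
    also have "\<dots> \<le> 4096 * (\<Sum>i\<in>UNIV. integral UNIV (\<lambda>x. (\<D> i ?f x)\<^sup>2)) ^ 3"
      by (rule Sobolev[OF f1 fc])
    finally have main: "integral (cube r) (\<lambda>x. (v j x) ^ 6)
       \<le> 4096 * (\<Sum>i\<in>UNIV. integral UNIV (\<lambda>x. (\<D> i ?f x)\<^sup>2)) ^ 3" .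
    have "(\<Sum>i\<in>UNIV. integral UNIV (\<lambda>x. (\<D> i ?f x)\<^sup>2)) \<le> (\<Sum>i\<in>(UNIV::3 set). 2 * T)"
    proof (rule sum_mono)
      fix i
      have c2: "continuous_on UNIV (\<lambda>x. 2 * (K / d)\<^sup>2 * (v j x)\<^sup>2)"
        "continuous_on UNIV (\<lambda>x. 2 * (\<D> i (v j) x)\<^sup>2)"
        by (intro continuous_intros v_cont)+
      have "integral UNIV (\<lambda>x. (\<D> i ?f x)\<^sup>2)
         \<le> integral (cube (r + d)) (\<lambda>x. 2 * (K / d)\<^sup>2 * (v j x)\<^sup>2 + 2 * (\<D> i (v j) x)\<^sup>2)"
      proof (rule integral_UNIV_le_cube)
        show "cont_supp (\<lambda>x. (\<D> i ?f x)\<^sup>2)" by (rule cont_supp_power2[OF cdf])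
        show "(\<D> i ?f x)\<^sup>2 = 0" if "x \<notin> cube (r + d)" for x
          using \<eta>0[OF that] d\<eta>0[OF that] by (simp add: df)
        show "continuous_on UNIV (\<lambda>x. 2 * (K / d)\<^sup>2 * (v j x)\<^sup>2 + 2 * (\<D> i (v j) x)\<^sup>2)"
          by (intro continuous_on_add c2)
        fix x
        have "(\<D> i ?f x)\<^sup>2 \<le> 2 * (\<D> i \<eta> x * v j x)\<^sup>2 + 2 * (\<eta> x * \<D> i (v j) x)\<^sup>2"
          unfolding df using square_diff_le[of "\<D> i \<eta> x * v j x" "- (\<eta> x * \<D> i (v j) x)"] by simp
        moreover have "(\<D> i \<eta> x * v j x)\<^sup>2 \<le> (K / d)\<^sup>2 * (v j x)\<^sup>2"
          using power_mono[OF bd(2)[of i x], of 2] by (simp only: power_mult_distrib power2_abs mult_right_mono zero_le_power2 abs_ge_zero)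
        moreover have "(\<eta> x * \<D> i (v j) x)\<^sup>2 \<le> 1 * (\<D> i (v j) x)\<^sup>2"
          using power_mono[OF bd(1)[of x], of 2] by (simp only: power_mult_distrib power2_abs mult_right_mono zero_le_power2 abs_ge_zero power_one)
        ultimately show "(\<D> i ?f x)\<^sup>2 \<le> 2 * (K / d)\<^sup>2 * (v j x)\<^sup>2 + 2 * (\<D> i (v j) x)\<^sup>2"
          by linarith
      qed
      also have "\<dots> = 2 * (K / d)\<^sup>2 * integral (cube (r + d)) (\<lambda>x. (v j x)\<^sup>2)
          + 2 * integral (cube (r + d)) (\<lambda>x. (\<D> i (v j) x)\<^sup>2)"
        by (subst integral_add[OF integrable_on_cube[OF c2(1)] integrable_on_cube[OF c2(2)]])
          (simp only: integral_mult_right)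
      also have "\<dots> \<le> 2 * (K / d)\<^sup>2 * moment 2 v (r + d) + 2 * grad_energy v (r + d)"
        using moment_member[of 2 "r + d" j] by (intro add_mono mult_left_mono grad_energy_member) auto
      also have "\<dots> = 2 * T" by (simp add: T_def power_divide)
      finally show "integral UNIV (\<lambda>x. (\<D> i ?f x)\<^sup>2) \<le> 2 * T" .
    qed
    also have "(\<Sum>i\<in>(UNIV::3 set). 2 * T) = 6 * T" by simp
    finally have "(\<Sum>i\<in>UNIV. integral UNIV (\<lambda>x. (\<D> i ?f x)\<^sup>2)) ^ 3 \<le> (6 * T) ^ 3"
      by (rule power_mono) (intro sum_nonneg integral_nonneg cont_supp_integrable cont_supp_power2 cdf zero_le_power2)
    then show ?thesis using main by linarith
  qed
  have "moment 6 v r \<le> (\<Sum>j\<in>(UNIV::3 set). 4096 * (6 * T) ^ 3)"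
    unfolding moment_def by (intro sum_mono each)
  \<comment> \<open>4096 = 16 ^ 3, so the left side is \<open>3 * (96 * T) ^ 3\<close>, and 3 is
    below the cube of 144 / 96 = 3 / 2.\<close>
  also have "\<dots> \<le> (144 * T) ^ 3" using T0 by (simp add: power_mult_distrib)
  finally show ?thesis by (simp add: T_def)
qed

lemma moment_interpolation:
  assumes q: "0 < q" "q < 6" "q \<le> real n" "n \<le> 6" "even n" "0 < n"
    and C0: "\<And>j. integral (cube 2) (\<lambda>x. \<bar>v j x\<bar> powr q) \<le> C0"
    and r: "r \<le> 2" and G: "1 \<le> G" "moment 6 v r \<le> G ^ 3"
  shows "moment n v r \<le> 3 * (C0 + 1) * G powr (3 * (real n - q) / (6 - q))"
proof -
  \<comment> \<open>This level satisfies \<open>\<kappa> powr (6 - q) = G ^ 3\<close>, which makes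
    the two terms of \<open>power_interpolation\<close> contribute the same power of
    \<open>G\<close>.\<close>
  define \<kappa> where "\<kappa> = G powr (3 / (6 - q))"
  have l: "0 < \<kappa>" using G by (simp add: \<kappa>_def)
  have cq: "continuous_on UNIV (\<lambda>x. \<bar>v j x\<bar> powr q)" for j
    using q(1) by (intro continuous_on_powr' continuous_intros v_cont) auto
  have e1: "\<kappa> powr (real n - q) = G powr (3 * (real n - q) / (6 - q))"
    by (simp add: \<kappa>_def powr_powr)
  have e2: "\<kappa> powr (real n - 6) * G ^ 3 = G powr (3 * (real n - q) / (6 - q))"
  proof -
    have "G ^ 3 = G powr 3" using G by simp
    then have "\<kappa> powr (real n - 6) * G ^ 3 = G powr (3 / (6 - q) * (real n - 6) + 3)"
      by (simp only: \<kappa>_def powr_powr powr_add)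
    also have "3 / (6 - q) * (real n - 6) + 3 = 3 * (real n - q) / (6 - q)"
      using q(2) by (simp add: field_simps)
    finally show ?thesis .
  qed
  have "integral (cube r) (\<lambda>x. (v j x) ^ n) \<le> (C0 + 1) * G powr (3 * (real n - q) / (6 - q))" for j
  proof -
    have i: "(\<lambda>x. \<kappa> powr (real n - q) * \<bar>v j x\<bar> powr q) integrable_on cube r"
       "(\<lambda>x. \<kappa> powr (real n - 6) * (v j x) ^ 6) integrable_on cube r"
      by (intro integrable_on_cube continuous_intros cq v_cont)+
    have "integral (cube r) (\<lambda>x. (v j x) ^ n)
       \<le> integral (cube r) (\<lambda>x. \<kappa> powr (real n - q) * \<bar>v j x\<bar> powr q + \<kappa> powr (real n - 6) * (v j x) ^ 6)"
    proof (intro integral_le integrable_add i)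
      show "(\<lambda>x. (v j x) ^ n) integrable_on cube r" by (intro integrable_on_cube continuous_intros v_cont)
      fix x
      show "(v j x) ^ n \<le> \<kappa> powr (real n - q) * \<bar>v j x\<bar> powr q + \<kappa> powr (real n - 6) * (v j x) ^ 6"
        using power_interpolation[OF abs_ge_zero l q(3,4,6), of "v j x"] q(5)
        by (simp add: power_even_abs)
    qed
    also have "\<dots> = \<kappa> powr (real n - q) * integral (cube r) (\<lambda>x. \<bar>v j x\<bar> powr q)
        + \<kappa> powr (real n - 6) * integral (cube r) (\<lambda>x. (v j x) ^ 6)"
      by (subst integral_add[OF i]) simp
    also have "\<dots> \<le> \<kappa> powr (real n - q) * C0 + \<kappa> powr (real n - 6) * G ^ 3"
    proof (intro add_mono mult_left_mono)
      have "integral (cube r) (\<lambda>x. \<bar>v j x\<bar> powr q) \<le> integral (cube 2) (\<lambda>x. \<bar>v j x\<bar> powr q)"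
        using r by (intro integral_subset_le cube_mono integrable_on_cube cq) auto
      then show "integral (cube r) (\<lambda>x. \<bar>v j x\<bar> powr q) \<le> C0" using C0[of j] by simp
      show "integral (cube r) (\<lambda>x. (v j x) ^ 6) \<le> G ^ 3" using moment_member[of 6 r j] G by simp
    qed auto
    also have "\<dots> = (C0 + 1) * G powr (3 * (real n - q) / (6 - q))"
      unfolding e2 unfolding e1 by (simp add: algebra_simps)
    finally show ?thesis .
  qed
  then have "moment n v r \<le> (\<Sum>j\<in>(UNIV::3 set). (C0 + 1) * G powr (3 * (real n - q) / (6 - q)))"
    unfolding moment_def by (intro sum_mono)
  also have "\<dots> = 3 * (C0 + 1) * G powr (3 * (real n - q) / (6 - q))"
    by (simp only: mult.assoc sum_constant) simp
  finally show ?thesis .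
qed

end

text \<open>\<open>B\<close> is chosen before the flow and depends on \<open>q\<close> and
  \<open>C0\<close> alone, so one bound serves all rescalings of a given solution.\<close>

lemma unit_scale_energy_bound:
  assumes q: "3 / 2 < q" "q \<le> 2"
  obtains B where "\<And>v P. steady_flow v P \<Longrightarrow>
    (\<And>j. integral (cube 2) (\<lambda>x. \<bar>v j x\<bar> powr q) \<le> C0) \<Longrightarrow> grad_energy v 1 \<le> B"
proof -
  define K :: real where "K = 10 ^ 6"
  have cutoff: "cutoff_bound K" unfolding K_def by (rule cutoff_bound_exists)
  have K: "1 \<le> K" by (simp add: K_def)
  \<comment> \<open>The power of \<open>G\<close> on the right of the energy inequality;
    \<open>\<gamma> < 1\<close> amounts to \<open>3 / 2 < q\<close>.\<close>
  define \<gamma> where "\<gamma> = 3 * (3 - q) / (6 - q)"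
  define \<sigma> where "\<sigma> n = 3 * (real n - q) / (6 - q)" for n
  have \<gamma>: "0 \<le> \<gamma>" "\<gamma> < 1" using q by (simp_all add: \<gamma>_def field_simps)
  \<comment> \<open>\<open>1 \<le> \<sigma> 4\<close> lets the gradient energy be bounded like the
    fourth moment. The half-sum is the exponent produced by the product of square roots in
    \<open>local_energy\<close>.\<close>
  have \<sigma>: "0 \<le> \<sigma> 2" "\<sigma> 2 \<le> \<gamma>" "1 \<le> \<sigma> 4" "\<sigma> 2 / 2 + \<sigma> 4 / 2 = \<gamma>"
  proof -
    show "0 \<le> \<sigma> 2" "\<sigma> 2 \<le> \<gamma>" "1 \<le> \<sigma> 4"
      using q by (simp_all add: \<sigma>_def \<gamma>_def divide_right_mono)
    have "\<sigma> 2 / 2 + \<sigma> 4 / 2 = (3 * (2 - q) / 2 + 3 * (4 - q) / 2) / (6 - q)"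
      by (simp add: \<sigma>_def add_divide_distrib mult.commute)
    also have "3 * (2 - q) / 2 + 3 * (4 - q) / 2 = 3 * (3 - q)" by (simp add: field_simps)
    finally show "\<sigma> 2 / 2 + \<sigma> 4 / 2 = \<gamma>" by (simp add: \<gamma>_def)
  qed
  define c where "c = 3 * (\<bar>C0\<bar> + 1)"
  define C where "C = energy_const K"
  \<comment> \<open>The three summands serve the three parts of \<open>G\<close> below: the constant
    1, the gradient energy, and the sixth moment via \<open>local_Sobolev\<close>.\<close>
  define A where "A = 1 + 8 * C * c + 144 * (4 * K\<^sup>2 * c + 8 * C * c)"
  have c: "1 \<le> c" by (simp add: c_def)
  have C: "0 \<le> C"
    using K bump_mass_pos remainder_const_nonneg[of K] by (simp add: C_def energy_const_def)
  have A1: "1 \<le> A" using C c by (simp add: A_def)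
  show ?thesis
  proof (rule that)
    fix v P assume flow: "steady_flow v P"
      and C0: "\<And>j. integral (cube 2) (\<lambda>x. \<bar>v j x\<bar> powr q) \<le> C0"
    interpret steady_flow v P by (rule flow)
    \<comment> \<open>The cube root of the sixth moment is the quantity that the Sobolev inequality
      compares with the gradient energy. Adding 1 makes powers of \<open>G\<close> increase with the
      exponent and keeps logarithms nonnegative.\<close>
    define G where "G r = 1 + grad_energy v r + root 3 (moment 6 v r)" for r
    have G1: "1 \<le> G r" for r by (simp add: G_def grad_energy_nonneg moment_nonneg)
    have Gmono: "G r \<le> G s" if "r \<le> s" for r s
      using grad_energy_mono[OF that] moment_mono[OF _ that, of 6] by (simp add: G_def add_mono)
    have G6: "moment 6 v r \<le> G r ^ 3" for r
    proof -
      have "moment 6 v r = (root 3 (moment 6 v r)) ^ 3" by (simp add: moment_nonneg)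
      also have "\<dots> \<le> G r ^ 3"
        by (rule power_mono) (simp_all add: G_def grad_energy_nonneg moment_nonneg)
      finally show ?thesis .
    qed
    have C0': "integral (cube 2) (\<lambda>x. \<bar>v j x\<bar> powr q) \<le> \<bar>C0\<bar>" for j using C0[of j] by simp
    have X: "moment 2 v r \<le> c * G r powr \<sigma> 2" and Y: "moment 4 v r \<le> c * G r powr \<sigma> 4" if "r \<le> 2" for r
      using moment_interpolation[OF _ _ _ _ _ _ C0' that G1 G6, of 2]
        moment_interpolation[OF _ _ _ _ _ _ C0' that G1 G6, of 4] q
      by (simp_all add: c_def \<sigma>_def)
    have E: "grad_energy v r \<le> 2 * C * c / d\<^sup>2 * G (r + d) powr \<gamma>" if d: "0 < d" "d \<le> 1" "r + d \<le> 2" for r d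
    proof -
      let ?G = "G (r + d)"
      have sp: "sqrt (c * ?G powr s) = sqrt c * ?G powr (s / 2)" for s
        using G1[of "r + d"] by (simp add: real_sqrt_mult powr_half_sqrt[symmetric] powr_powr)
      have sX: "sqrt (moment 2 v (r + d)) \<le> sqrt c * ?G powr (\<sigma> 2 / 2)"
        using X[OF d(3)] unfolding sp[symmetric] by (rule real_sqrt_le_mono)
      have sY: "sqrt (moment 4 v (r + d)) \<le> sqrt c * ?G powr (\<sigma> 4 / 2)"
        using Y[OF d(3)] unfolding sp[symmetric] by (rule real_sqrt_le_mono)
      have sE: "sqrt (grad_energy v (r + d)) \<le> sqrt c * ?G powr (\<sigma> 4 / 2)"
      proof -
        have "grad_energy v (r + d) \<le> ?G" by (simp add: G_def moment_nonneg)
        also have "\<dots> = ?G powr 1" using G1[of "r + d"] by simp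
        also have "\<dots> \<le> ?G powr \<sigma> 4" using G1[of "r + d"] \<sigma> by (intro powr_mono) auto
        also have "\<dots> \<le> c * ?G powr \<sigma> 4" using c by (simp add: mult_le_cancel_right1)
        finally show ?thesis unfolding sp[symmetric] by (rule real_sqrt_le_mono)
      qed
      have "grad_energy v r \<le> C / d\<^sup>2 * sqrt (moment 2 v (r + d)) *
          (sqrt (grad_energy v (r + d)) + sqrt (moment 4 v (r + d)))"
        unfolding C_def by (rule local_energy[OF cutoff d(1,2)])
      also have "\<dots> \<le> C / d\<^sup>2 * (sqrt c * ?G powr (\<sigma> 2 / 2)) * (sqrt c * ?G powr (\<sigma> 4 / 2) + sqrt c * ?G powr (\<sigma> 4 / 2))"
        using C c sX sE sY by (intro mult_mono add_mono mult_left_mono) (auto intro!: add_nonneg_nonneg mult_nonneg_nonneg simp: grad_energy_nonneg moment_nonneg)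
      also have "\<dots> = 2 * C * (sqrt c * sqrt c) / d\<^sup>2 * (?G powr (\<sigma> 2 / 2) * ?G powr (\<sigma> 4 / 2))"
        by (simp add: algebra_simps)
      also have "\<dots> = 2 * C * c / d\<^sup>2 * ?G powr \<gamma>"
        using c \<sigma>(4) by (simp flip: powr_add)
      finally show ?thesis .
    qed
    have step: "G r \<le> A / d\<^sup>2 * G (r + d) powr \<gamma>" if r: "1 \<le> r" and d: "0 < d" "r + d \<le> 2" for r d
    proof -
      let ?g = "G (r + d) powr \<gamma>"
      have d1: "d \<le> 1" using r d by simp
      have g1: "1 \<le> ?g" using G1 \<gamma> by (simp add: ge_one_powr_ge_zero)
      have d2: "1 \<le> 1 / d\<^sup>2" using d d1 by (simp add: power_le_one)
      have one: "1 \<le> 1 / d\<^sup>2 * ?g" using mult_mono[OF d2 g1] d by simp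
      have E1: "grad_energy v r \<le> 8 * C * c / d\<^sup>2 * ?g"
      proof -
        have "grad_energy v r \<le> 2 * C * c / d\<^sup>2 * ?g" by (rule E[OF d(1) d1 d(2)])
        also have "\<dots> \<le> 8 * C * c / d\<^sup>2 * ?g"
          using C c by (intro mult_right_mono divide_right_mono) auto
        finally show ?thesis .
      qed
      \<comment> \<open>The step \<open>d\<close> is halved: \<open>local_Sobolev\<close> uses one
        half, the energy inequality the other. Hence 8 = 2 * 4 from the square of
        \<open>d / 2\<close>.\<close>
      have E2: "grad_energy v (r + d / 2) \<le> 8 * C * c / d\<^sup>2 * ?g"
        using E[of "d / 2" "r + d / 2"] d d1 by (simp add: power_divide ac_simps)
      have X2: "moment 2 v (r + d / 2) \<le> c * ?g"
      proof -
        have "moment 2 v (r + d / 2) \<le> c * G (r + d / 2) powr \<sigma> 2" using d by (intro X) simp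
        also have "\<dots> \<le> c * G (r + d) powr \<sigma> 2"
          using c d \<sigma> Gmono[of "r + d / 2" "r + d"] G1[of "r + d / 2"] by (intro mult_left_mono powr_mono2) auto
        also have "\<dots> \<le> c * ?g" using c \<sigma> G1[of "r + d"] by (intro mult_left_mono powr_mono) auto
        finally show ?thesis .
      qed
      have "moment 6 v r \<le> (144 * (K\<^sup>2 / (d / 2)\<^sup>2 * moment 2 v (r + d / 2) + grad_energy v (r + d / 2))) ^ 3"
        using d by (intro local_Sobolev[OF cutoff]) auto
      then have "root 3 (moment 6 v r) \<le> root 3 ((144 * (K\<^sup>2 / (d / 2)\<^sup>2 * moment 2 v (r + d / 2) + grad_energy v (r + d / 2))) ^ 3)"
        by (simp only: real_root_le_iff zero_less_numeral)
      also have "\<dots> = 144 * (K\<^sup>2 / (d / 2)\<^sup>2 * moment 2 v (r + d / 2) + grad_energy v (r + d / 2))"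
        by (rule real_root_power_cancel) (auto simp: moment_nonneg grad_energy_nonneg)
      also have "\<dots> \<le> 144 * (K\<^sup>2 / (d / 2)\<^sup>2 * (c * ?g) + 8 * C * c / d\<^sup>2 * ?g)"
        using X2 E2 by (intro mult_left_mono add_mono) auto
      also have "\<dots> = 144 * (4 * K\<^sup>2 * c + 8 * C * c) / d\<^sup>2 * ?g"
        by (simp add: power_divide add_divide_distrib algebra_simps)
      finally have Z: "root 3 (moment 6 v r) \<le> 144 * (4 * K\<^sup>2 * c + 8 * C * c) / d\<^sup>2 * ?g" .
      have "G r \<le> 1 / d\<^sup>2 * ?g + 8 * C * c / d\<^sup>2 * ?g + 144 * (4 * K\<^sup>2 * c + 8 * C * c) / d\<^sup>2 * ?g"
        unfolding G_def by (intro add_mono one[unfolded G_def] E1[unfolded G_def] Z[unfolded G_def])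
      also have "\<dots> = A / d\<^sup>2 * ?g"
        by (simp add: A_def add_divide_distrib algebra_simps)
      finally show ?thesis .
    qed
    have "grad_energy v 1 \<le> G 1" by (simp add: G_def moment_nonneg)
    also have "\<dots> \<le> exp ((ln A + 2 + \<gamma> * (2 / (1 - \<gamma>))) / (1 - \<gamma>))"
      \<comment> \<open>The a priori bound \<open>\<Lambda>\<close> is \<open>G 2\<close>, by
        monotonicity.\<close>
      by (rule sublinear_iteration[OF G1 Gmono[of _ 2] step A1 \<gamma>]) auto
    finally show "grad_energy v 1 \<le> exp ((ln A + 2 + \<gamma> * (2 / (1 - \<gamma>))) / (1 - \<gamma>))" .
  qed
qed

section \<open>Rescaling and the Liouville theorem\<close>

lemma content_cube: "0 \<le> r \<Longrightarrow> measure lborel (cube r) = (2 * r) ^ 3"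
  unfolding cube_def by (subst content_cbox_cart) (simp_all add: interval_ne_empty_cart)

lemma integral_cube_scale:
  fixes h :: "real^3 \<Rightarrow> real"
  assumes h: "continuous_on UNIV h" and R: "0 < R"
  shows "integral (cube (R * a)) h = R ^ 3 * integral (cube a) (\<lambda>x. h (R *\<^sub>R x))"
proof -
  have "(h has_integral integral (cube (R * a)) h) (cbox (\<chi> i. - (R * a)) (\<chi> i. R * a))"
    using integrable_integral[OF integrable_on_cube[OF h, of "R * a"]] by (simp add: cube_def)
  from has_integral_affinity[OF this, of R 0] R
  have "((\<lambda>x. h (R *\<^sub>R x)) has_integral (1 / R ^ 3) *\<^sub>R integral (cube (R * a)) h)
     ((\<lambda>x. (1 / R) *\<^sub>R x) ` cbox (\<chi> i. - (R * a)) (\<chi> i. R * a))"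
    by simp
  moreover have "(\<lambda>x. (1 / R) *\<^sub>R x) ` cbox (\<chi> i. - (R * a)) (\<chi> i. R * a) = cube a"
  proof (intro equalityI subsetI)
    fix x :: "real^3" assume "x \<in> (\<lambda>x. (1 / R) *\<^sub>R x) ` cbox (\<chi> i. - (R * a)) (\<chi> i. R * a)"
    then obtain y where y: "x = (1 / R) *\<^sub>R y" "y \<in> cube (R * a)" unfolding cube_def by blast
    have "\<bar>y $ i\<bar> / R \<le> a" for i using y(2) R by (simp add: mem_cube divide_le_eq mult.commute)
    then show "x \<in> cube a" using R by (simp add: y(1) mem_cube abs_mult)
  next
    fix x assume x: "x \<in> cube a"
    have "R *\<^sub>R x \<in> cube (R * a)" using x R by (simp add: mem_cube abs_mult)
    then show "x \<in> (\<lambda>x. (1 / R) *\<^sub>R x) ` cbox (\<chi> i. - (R * a)) (\<chi> i. R * a)"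
      using R unfolding cube_def[symmetric] by (intro image_eqI[of _ _ "R *\<^sub>R x"]) (auto simp: cube_def)
  qed
  ultimately have "integral (cube a) (\<lambda>x. h (R *\<^sub>R x)) = (1 / R ^ 3) *\<^sub>R integral (cube (R * a)) h"
    by (simp add: integral_unique)
  then show ?thesis using R by simp
qed

lemma C_class_scale: "C_class k f \<Longrightarrow> C_class k (\<lambda>x. c * f (R *\<^sub>R x))"
  using C_class_cmult[OF C_class_affine[where k=k and f=f and a=0 and c=R]] by simp

lemma partial_deriv_scale:
  assumes "C_class 1 f"
  shows "\<D> i (\<lambda>x. c * f (R *\<^sub>R x)) = (\<lambda>x. c * R * \<D> i f (R *\<^sub>R x))"
proof
  fix x
  have "(\<lambda>x. f (0 + R *\<^sub>R x)) differentiable (at x)"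
    using C_class_1D(1)[OF C_class_affine[OF assms]] .
  then show "\<D> i (\<lambda>x. c * f (R *\<^sub>R x)) x = c * R * \<D> i f (R *\<^sub>R x)"
    using partial_deriv_cmult[of "\<lambda>x. f (0 + R *\<^sub>R x)" x i c]
      partial_deriv_affine[OF C_class_1D(1)[OF assms], where a=0 and c=R and x=x and i=i] by simp
qed

context steady_flow
begin

text \<open>The scaling symmetry of the equations: with these powers of \<open>R\<close> every term
  of the momentum equation gains the same factor \<open>R ^ 3\<close>.\<close>

lemma rescaled_flow:
  "steady_flow (\<lambda>j x. R * v j (R *\<^sub>R x)) (\<lambda>x. R\<^sup>2 * P (R *\<^sub>R x))"
proof
  note d1 = partial_deriv_scale[OF C_class_2D(1)[OF v_C2]]
  note d2 = partial_deriv_scale[OF C_class_2D(2)[OF v_C2]]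
  show "C_class 2 (\<lambda>x. R * v j (R *\<^sub>R x))" for j by (rule C_class_scale[OF v_C2])
  show "C_class 1 (\<lambda>x. R\<^sup>2 * P (R *\<^sub>R x))" by (rule C_class_scale[OF P_C1])
  show "(\<Sum>j\<in>UNIV. \<D> j (\<lambda>x. R * v j (R *\<^sub>R x)) x) = 0" for x
    unfolding d1 sum_distrib_left[symmetric] divergence_0 by simp
  show "- (\<Sum>l\<in>UNIV. \<D> l (\<D> l (\<lambda>x. R * v j (R *\<^sub>R x))) x) +
       (\<Sum>l\<in>UNIV. R * v l (R *\<^sub>R x) * \<D> l (\<lambda>x. R * v j (R *\<^sub>R x)) x) +
       \<D> j (\<lambda>x. R\<^sup>2 * P (R *\<^sub>R x)) x = 0" for j x
  proof -
    have "- (\<Sum>l\<in>UNIV. \<D> l (\<D> l (\<lambda>x. R * v j (R *\<^sub>R x))) x) +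
       (\<Sum>l\<in>UNIV. R * v l (R *\<^sub>R x) * \<D> l (\<lambda>x. R * v j (R *\<^sub>R x)) x) +
       \<D> j (\<lambda>x. R\<^sup>2 * P (R *\<^sub>R x)) x
     = R ^ 3 * (- (\<Sum>l\<in>UNIV. \<D> l (\<D> l (v j)) (R *\<^sub>R x))
        + (\<Sum>l\<in>UNIV. v l (R *\<^sub>R x) * \<D> l (v j) (R *\<^sub>R x)) + \<D> j P (R *\<^sub>R x))"
      unfolding d1 d2 partial_deriv_scale[OF P_C1]
      by (simp add: sum_distrib_left power2_eq_square power3_eq_cube algebra_simps)
    also have "\<dots> = 0" by (simp only: momentum mult_zero_right)
    finally show ?thesis .
  qed
qed

text \<open>The squared gradient gains \<open>R ^ 4\<close> and the volume takes back
  \<open>R ^ 3\<close>; the remaining \<open>R\<close> is the source of the decay.\<close>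

lemma rescaled_energy:
  assumes "0 < R"
  shows "grad_energy (\<lambda>j x. R * v j (R *\<^sub>R x)) 1 = R * grad_energy v R"
proof -
  have "integral (cube 1) (\<lambda>x. (\<D> l (\<lambda>x. R * v j (R *\<^sub>R x)) x)\<^sup>2)
      = R * integral (cube R) (\<lambda>x. (\<D> l (v j) x)\<^sup>2)" for l j
  proof -
    have "integral (cube 1) (\<lambda>x. (\<D> l (\<lambda>x. R * v j (R *\<^sub>R x)) x)\<^sup>2)
       = integral (cube 1) (\<lambda>x. R ^ 4 * (\<D> l (v j) (R *\<^sub>R x))\<^sup>2)"
      unfolding partial_deriv_scale[OF C_class_2D(1)[OF v_C2]]
      by (simp only: power_mult_distrib) (simp add: power2_eq_square power4_eq_xxxx mult_ac)
    also have "\<dots> = R * (R ^ 3 * integral (cube 1) (\<lambda>x. (\<D> l (v j) (R *\<^sub>R x))\<^sup>2))"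
      by (simp add: power4_eq_xxxx power3_eq_cube)
    also have "R ^ 3 * integral (cube 1) (\<lambda>x. (\<D> l (v j) (R *\<^sub>R x))\<^sup>2)
       = integral (cube R) (\<lambda>x. (\<D> l (v j) x)\<^sup>2)"
      using integral_cube_scale[of "\<lambda>x. (\<D> l (v j) x)\<^sup>2" R 1] assms
      by (simp add: v_cont continuous_intros)
    finally show ?thesis .
  qed
  then show ?thesis by (simp add: grad_energy_def sum_distrib_left)
qed

end

lemma constant_if_partial_derivs_0:
  assumes "\<And>x. f differentiable (at x)" "\<And>i x. \<D> i f x = 0"
  shows "\<exists>c. \<forall>x. f x = c"
proof -
  have "(f has_derivative (\<lambda>h. 0)) (at x)" for x
    using has_derivative_partial_deriv[OF assms(1)[of x]] by (simp add: assms(2))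
  then show ?thesis
    using has_derivative_zero_constant[of UNIV f] by auto
qed

lemma (in steady_flow) Liouville:
  assumes p: "3 / 2 < p" "p < 3"
    and Lp: "\<And>j. (\<lambda>x. \<bar>v j x\<bar> powr p) integrable_on UNIV"
  shows "v j x = 0" and "\<exists>c. \<forall>x. P x = c"
proof -
  \<comment> \<open>\<open>q \<le> 2\<close> is what \<open>unit_scale_energy_bound\<close> asks
    for, and \<open>q \<le> p\<close> lets L^p control L^q on a bounded cube.\<close>
  define q where "q = min p 2"
  define N where "N = (\<Sum>j\<in>UNIV. integral UNIV (\<lambda>x. \<bar>v j x\<bar> powr p))"
  have q: "3 / 2 < q" "q \<le> 2" "q \<le> p" using p by (auto simp: q_def)
  have cp: "continuous_on A (\<lambda>x. \<bar>v j x\<bar> powr p)" for A j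
    using p by (intro continuous_on_powr' continuous_intros v_cont) auto
  have Nj: "integral (cube r) (\<lambda>x. \<bar>v j x\<bar> powr p) \<le> N" for r j
  proof -
    have "integral (cube r) (\<lambda>x. \<bar>v j x\<bar> powr p) \<le> integral UNIV (\<lambda>x. \<bar>v j x\<bar> powr p)"
      by (intro integral_subset_le integrable_on_cube cp Lp) auto
    also have "\<dots> \<le> N" unfolding N_def
      by (rule member_le_sum[of j UNIV "\<lambda>j. integral UNIV (\<lambda>x. \<bar>v j x\<bar> powr p)"])
        (auto intro!: integral_nonneg Lp)
    finally show ?thesis .
  qed
  \<comment> \<open>64 is the volume of \<open>cube 2\<close>, from the summand 1 in the bound of a
    power \<open>q\<close> by 1 plus the power \<open>p\<close>.\<close>
  obtain B where B: "\<And>v P. steady_flow v P \<Longrightarrow>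
      (\<And>j. integral (cube 2) (\<lambda>x. \<bar>v j x\<bar> powr q) \<le> 64 + N) \<Longrightarrow> grad_energy v 1 \<le> B"
    using unit_scale_energy_bound[OF q(1,2), of "64 + N"] by blast
  have decay: "R * grad_energy v R \<le> B" if R: "1 \<le> R" for R
  proof -
    let ?w = "\<lambda>j x. R * v j (R *\<^sub>R x)"
    have "integral (cube 2) (\<lambda>x. \<bar>?w j x\<bar> powr q) \<le> 64 + N" for j
    proof -
      have cw: "continuous_on UNIV (\<lambda>x. \<bar>?w j x\<bar> powr s)" if "0 < s" for s
        using that by (intro continuous_on_powr' continuous_intros continuous_on_compose2[OF v_cont(1)[of UNIV]]) auto
      have cs: "continuous_on UNIV (\<lambda>x. \<bar>v j (R *\<^sub>R x)\<bar> powr p)"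
        by (rule continuous_on_compose2[OF cp[of UNIV]]) (auto intro!: continuous_intros)
      have i: "(\<lambda>x. 1 :: real) integrable_on cube 2" "(\<lambda>x. R powr p * \<bar>v j (R *\<^sub>R x)\<bar> powr p) integrable_on cube 2"
        by (intro integrable_on_cube continuous_intros cs)+
      have "integral (cube 2) (\<lambda>x. \<bar>?w j x\<bar> powr q)
         \<le> integral (cube 2) (\<lambda>x. 1 + R powr p * \<bar>v j (R *\<^sub>R x)\<bar> powr p)"
      proof (intro integral_le integrable_add i)
        show "(\<lambda>x. \<bar>?w j x\<bar> powr q) integrable_on cube 2" using q by (intro integrable_on_cube cw) simp
        fix x
        have "a powr q \<le> 1 + a powr p" if "0 \<le> a" for a :: real
        proof (cases "a \<le> 1")
          case True
          then have "a powr q \<le> 1 powr q" using that q by (intro powr_mono2) auto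
          then show ?thesis by (simp add: add_increasing2)
        next
          case False
          then have "a powr q \<le> a powr p" using q by (intro powr_mono) auto
          then show ?thesis by simp
        qed
        from this[of "\<bar>?w j x\<bar>"] show "\<bar>?w j x\<bar> powr q \<le> 1 + R powr p * \<bar>v j (R *\<^sub>R x)\<bar> powr p"
          using R by (simp add: abs_mult powr_mult)
      qed
      also have "\<dots> = integral (cube 2) (\<lambda>x. 1) + R powr p * integral (cube 2) (\<lambda>x. \<bar>v j (R *\<^sub>R x)\<bar> powr p)"
        by (subst integral_add[OF i]) simp
      also have "integral (cube 2) (\<lambda>x. 1 :: real) = 64"
        using content_cube[of 2] by (simp add: cube_def)
      also have "R powr p * integral (cube 2) (\<lambda>x. \<bar>v j (R *\<^sub>R x)\<bar> powr p) \<le> N"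
      proof -
        \<comment> \<open>Here \<open>p < 3\<close> is decisive: \<open>R powr 3\<close> is the
          volume factor that undoes the rescaling of the integral.\<close>
        have "R powr p * integral (cube 2) (\<lambda>x. \<bar>v j (R *\<^sub>R x)\<bar> powr p)
           \<le> R powr 3 * integral (cube 2) (\<lambda>x. \<bar>v j (R *\<^sub>R x)\<bar> powr p)"
          using R p by (intro mult_right_mono powr_mono integral_nonneg integrable_on_cube cs) auto
        also have "\<dots> = integral (cube (R * 2)) (\<lambda>x. \<bar>v j x\<bar> powr p)"
          using integral_cube_scale[OF cp, of R 2] R by simp
        also have "\<dots> \<le> N" by (rule Nj)
        finally show ?thesis .
      qed
      finally show ?thesis by simp
    qed
    from B[OF rescaled_flow this] show ?thesis using rescaled_energy[of R] R by simp
  qed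
  \<comment> \<open>The energy on a fixed cube is at most \<open>B / R\<close> for every large
    \<open>R\<close>.\<close>
  have E0: "grad_energy v r = 0" for r
  proof (rule ccontr)
    assume ne: "grad_energy v r \<noteq> 0"
    then have pos: "0 < grad_energy v r" using grad_energy_nonneg[of r] by simp
    define R where "R = max (max 1 r) ((\<bar>B\<bar> + 1) / grad_energy v r)"
    have R: "1 \<le> R" "r \<le> R" "(\<bar>B\<bar> + 1) / grad_energy v r \<le> R" by (auto simp: R_def)
    have "\<bar>B\<bar> + 1 \<le> R * grad_energy v r" using R(3) pos by (simp add: divide_le_eq)
    also have "\<dots> \<le> R * grad_energy v R" using R by (intro mult_left_mono grad_energy_mono) auto
    also have "\<dots> \<le> B" by (rule decay[OF R(1)])
    finally show False by simp
  qed
  have dv0: "\<D> l (v j) x = 0" for l j x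
  proof -
    \<comment> \<open>Large enough for \<open>x\<close> to lie in the cube, and positive, so that
      the box has interior and a continuous nonnegative function with integral 0 vanishes on
      it.\<close>
    define r where "r = norm x + 1"
    have x: "x \<in> cube r"
      unfolding mem_cube r_def by (intro allI add_increasing2 component_le_norm_cart) simp
    let ?h = "\<lambda>x. (\<D> l (v j) x)\<^sup>2"
    have ch: "continuous_on UNIV ?h" by (intro continuous_intros v_cont)
    have "integral (cube r) ?h \<le> 0" using grad_energy_member[of r l j] E0 by simp
    moreover have "0 \<le> integral (cube r) ?h" by (intro integral_nonneg integrable_on_cube ch) simp
    ultimately have "integral (cube r) ?h = 0" by simp
    then have "(?h has_integral 0) (cbox (\<chi> i. - r) (\<chi> i. r))"
      using integrable_integral[OF integrable_on_cube[OF ch, of r]] by (simp add: cube_def)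
    moreover have "box (\<chi> i. - r) ((\<chi> i. r) :: real^3) \<noteq> {}"
    proof -
      have "0 < r" by (simp add: r_def add_nonneg_pos)
      then show ?thesis by (simp add: interval_ne_empty_cart)
    qed
    ultimately have "?h x = 0"
      using x by (intro has_integral_0_cbox_imp_0[of "\<chi> i. - r" "\<chi> i. r" ?h x] continuous_on_subset[OF ch])
        (auto simp: cube_def)
    then show ?thesis by simp
  qed
  have v0: "v j x = 0" for j x
  proof -
    obtain c where c: "\<And>x. v j x = c"
      using constant_if_partial_derivs_0[of "v j"] C_class_1D(1)[OF C_class_2D(1)[OF v_C2]] dv0 by blast
    have "c = 0"
    proof (rule ccontr)
      assume "c \<noteq> 0"
      then have k: "0 < \<bar>c\<bar> powr p" by simp
      \<comment> \<open>With this radius \<open>r\<close> times the power of \<open>|c|\<close>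
        already exceeds \<open>N\<close>, and the volume of the cube is at least
        \<open>r\<close>.\<close>
      define r where "r = \<bar>N\<bar> / \<bar>c\<bar> powr p + 1"
      have r: "1 \<le> r" using k by (simp add: r_def)
      have "integral (cube r) (\<lambda>x. \<bar>v j x\<bar> powr p) = measure lborel (cube r) * \<bar>c\<bar> powr p"
        by (simp add: c cube_def)
      also have "measure lborel (cube r) = (2 * r) ^ 3" using r by (intro content_cube) simp
      finally have 1: "(2 * r) ^ 3 * \<bar>c\<bar> powr p \<le> N" using Nj[of r j] by simp
      have "r \<le> (2 * r) ^ 3"
        using r self_le_power[of "2 * r" 3] by simp
      then have "r * \<bar>c\<bar> powr p \<le> N" using 1 k mult_right_mono[of r "(2 * r) ^ 3" "\<bar>c\<bar> powr p"] by linarith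
      moreover have "r * \<bar>c\<bar> powr p = \<bar>N\<bar> + \<bar>c\<bar> powr p" using k by (simp add: r_def distrib_right)
      ultimately show False using k by linarith
    qed
    then show ?thesis using c by simp
  qed
  then show "v j x = 0" .
  \<comment> \<open>For \<open>v = 0\<close> the momentum equation says that the gradient of
    \<open>P\<close> vanishes, which determines \<open>P\<close> up to a constant.\<close>
  have "\<D> j P x = 0" for j x
  proof -
    have "v i = (\<lambda>x. 0)" for i using v0 by auto
    then show ?thesis using momentum[of j x] by simp
  qed
  then show "\<exists>c. \<forall>x. P x = c"
    using constant_if_partial_derivs_0[of P] C_class_1D(1)[OF P_C1] by blast
qed

theorem theorem1:
  fixes U :: "real^3 \<Rightarrow> real^3" and P :: "real^3 \<Rightarrow> real" and p :: real
  assumes "smooth_steady_NS_solution U P"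
    and "3/2 < p" and "p < 3"
    and "\<And>i. in_Lp p (\<lambda>x. U x $ i)"
  shows "(\<forall>x. U x = 0) \<and> (\<exists>c. \<forall>x. P x = c)"
proof -
  note NS = assms(1)[unfolded smooth_steady_NS_solution_def]
  interpret steady_flow "\<lambda>j x. U x $ j" P
  proof
    show "C_class 2 (\<lambda>x. U x $ j)" for j using NS by blast
    show "C_class 1 P" using NS by blast
    show "(\<Sum>j\<in>UNIV. \<D> j (\<lambda>x. U x $ j) x) = 0" for x
      using NS by (simp add: divergence_def)
    fix j x
    have "(- laplacian U x + advection U U x + gradient P x) $ j = 0" using NS by simp
    then show "- (\<Sum>l\<in>UNIV. \<D> l (\<D> l (\<lambda>x. U x $ j)) x) +
       (\<Sum>l\<in>UNIV. U x $ l * \<D> l (\<lambda>x. U x $ j) x) + \<D> j P x = 0"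
      by (simp add: laplacian_def advection_def gradient_def)
  qed
  \<comment> \<open>Lebesgue integrability from \<open>in_Lp\<close> yields Henstock-Kurzweil
    integrability, the notion of integral used throughout.\<close>
  have Lp: "(\<lambda>x. \<bar>U x $ j\<bar> powr p) integrable_on UNIV" for j
    using assms(4)[of j] has_integral_integral_lebesgue unfolding in_Lp_def by blast
  show ?thesis
    using Liouville[OF assms(2,3) Lp] by (simp add: vec_eq_iff)
qed

end
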